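(* Let $\mathcal L=\mathcal L^h_{N,M}$, $\mathcal C=\mathcal C^h_N$, $\boldsymbol\tau:\mathcal L\to\mathcal C$ and $\boldsymbol\pi:{\rm Inv}(\mathcal L)\to{\rm Inv}(\mathcal C)$ be as in the context. For all $\lambda,\mu\in\mathbb C$, $\mathcal A,\mathcal B\in\mathcal L$ and $\mathcal C_1,\mathcal D\in{\rm Inv}(\mathcal L)$, $\boldsymbol\tau(\lambda\mathcal A+\mu\mathcal B)=\lambda\boldsymbol\tau(\mathcal A)+\mu\boldsymbol\tau(\mathcal B)$, $\boldsymbol\tau(\mathcal A\mathcal B)=\boldsymbol\tau(\mathcal B\mathcal A)$, $\boldsymbol\pi(\mathcal C_1\mathcal D)=\boldsymbol\pi(\mathcal C_1)\boldsymbol\pi(\mathcal D)$. Moreover $\boldsymbol\tau$ and $\boldsymbol\pi$ are continuous (with respect to $\|\cdot\|_{\mathcal L}$ and $\|\cdot\|_{\mathcal C}$), $\boldsymbol\pi(e^{\mathcal A})=e^{\boldsymbol\tau(\mathcal A)}$ for every $\mathcal A\in\mathcal L$, and the operator norm of $\boldsymbol\tau$ from $(\mathcal L,\|\cdot\|_{\mathcal L})$ to $(\mathcal C,\|\cdot\|_{\mathcal C})$ equals $M$.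
   Context: Let $N,M,p$ be positive integers and $h=1/p$. Let $I_N$ be the set of all subsets of $\{1,\dots,N\}$; for $\alpha\in I_N$, $|\alpha|$ is its cardinality and $\bar\alpha$ its complement. For $\mathbf x=(x_i)$ write $\mathbf x_\alpha=(x_i)_{i\in\alpha}\in[0,1)^{|\alpha|}$ (increasing indices). For disjoint $\alpha,\beta$, $\mathbf y_\beta\diamond\mathbf x_\alpha=\mathbf z_{\alpha\cup\beta}$ where $z_i=x_i$ for $i\in\alpha$ and $z_i=y_i$ for $i\in\beta$. Write $\langle f\rangle_\alpha=\int_{[0,1)^{|\alpha|}}f\,d\mathbf x_\alpha$, $\langle f\rangle_\emptyset=f$. Let $\chi^h_i$ be the indicator of $[i/p,(i+1)/p)$; a function on $[0,1)^R$ is $h$-staircase if it is a finite linear combination of $\prod_{j=1}^R\chi^h_{i_j}(y_j)$; a matrix function is $h$-staircase if all entries are. For an $h$-staircase $M\times M$ matrix function $\mathbf A(\mathbf k,\mathbf x_\alpha)$ on $[0,1)^N\times[0,1)^{|\alpha|}$, $\langle\mathbf A(\mathbf k,\mathbf x_\alpha)\cdot\rangle_\alpha$ is the operator on $L^2([0,1)^N,\mathbb C^M)$, $\mathbf u\mapsto\langle\mathbf A(\mathbf k,\mathbf x_\alpha)\mathbf u(\mathbf k_{\bar\alpha}\diamond\mathbf x_\alpha)\rangle_\alpha$. $\mathcal L$ is the set of all $\mathcal A=\sum_{\alpha\in I_N}\langle\mathbf A_\alpha(\mathbf k,\mathbf x_\alpha)\cdot\rangle_\alpha$ with $h$-staircase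 $\mathbf A_\alpha=(a_{i,j,\alpha})$ (the $\mathbf A_\alpha$ are uniquely determined by $\mathcal A$), with norm $\|\mathcal A\|_{\mathcal L}=\sum_\alpha\max_{(\mathbf k,\mathbf x_\alpha),i}\sum_j|a_{i,j,\alpha}|$; it is a Banach algebra under composition, so $e^{\mathcal A}=\sum_{n\ge0}\mathcal A^n/n!\in\mathcal L$. $\mathcal I$ is the identity. ${\rm Inv}(\mathcal L)$ is the set of elements of $\mathcal L$ invertible as bounded operators. Every $\mathcal A\in{\rm Inv}(\mathcal L)$ can be written uniquely (for a fixed chosen ordering of $I_N$ that is ascending, or descending, in $|\alpha|$) as a product $\mathcal A=\prod_{\alpha\in I_N}\mathcal G_\alpha$ in that order, where $\mathcal G_\emptyset=\mathbf G_\emptyset(\mathbf k)\cdot$ is multiplication by an invertible $h$-staircase matrix function and, for $\alpha\neq\emptyset$, $\mathcal G_\alpha=\mathcal I+\langle\mathbf G_\alpha(\mathbf k,\mathbf x_\alpha)\cdot\rangle_\alpha$ is invertible with $\mathbf G_\alpha$ $h$-staircase. $\mathcal C=\mathcal C^h_N$ is the set of tuples $\mathbf f=(f_\alpha)_{\alpha\in I_N}$ where $f_\alpha$ is a complex $h$-staircase function of $\mathbf k_{\bar\alpha}\in[0,1)^{N-|\alpha|}$ (a constant if $\alpha=\{1,\dots,N\}$); operations (sum, product, exponential) are componentwise and $\|\mathbf f\|_{\mathcal C}=\max_{\alpha,\mathbf k_{\bar\alpha}}|f_\alpha(\mathbf k_{\bar\alpha})|$. ${\rm Inv}(\mathcal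 C)$ is the set of $\mathbf f\in\mathcal C$ with no zeros. Trace: $\boldsymbol\tau(\mathcal A)=(\tau_\alpha(\mathcal A))_{\alpha}$, $\tau_\alpha(\mathcal A)(\mathbf k_{\bar\alpha})={\rm Tr}\langle\mathbf A_\alpha(\mathbf k_{\bar\alpha}\diamond\mathbf x_\alpha,\mathbf x_\alpha)\rangle_\alpha$ (matrix trace). Determinant: for $\mathcal A\in{\rm Inv}(\mathcal L)$ with factorization above (fixed ordering), $\boldsymbol\pi(\mathcal A)=(\pi_\alpha(\mathcal G_\alpha))_\alpha$ where $\pi_\emptyset(\mathcal G_\emptyset)(\mathbf k)=\det\mathbf G_\emptyset(\mathbf k)$ and, for $\alpha\ne\emptyset$ and fixed $\mathbf k_{\bar\alpha}$, $\pi_\alpha(\mathcal G_\alpha)(\mathbf k_{\bar\alpha})$ is the (Fredholm) determinant of the identity-plus-finite-rank operator $\mathcal I+\langle\mathbf G_\alpha(\mathbf k_{\bar\alpha}\diamond\mathbf k_\alpha,\mathbf x_\alpha)\cdot\rangle_\alpha$ acting on $L^2([0,1)^{|\alpha|},\mathbb C^M)$ in the variable $\mathbf k_\alpha$. *)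

theory Defs
  imports "HOL-Analysis.Analysis"
begin

(* Coordinates are indexed by {..<N} (0-based instead of 1..N).
   Points of [0,1)^S are functions nat => real, only coordinates in S matter. *)

type_synonym pt = "nat \<Rightarrow> real"
(* element of L: alpha |-> A_alpha(k, x_alpha) (i,j) ; canonical: zero outside the domain *)
type_synonym opL = "nat set \<Rightarrow> pt \<Rightarrow> pt \<Rightarrow> nat \<Rightarrow> nat \<Rightarrow> complex"
(* element of C: alpha |-> f_alpha(k_{bar alpha}) *)
type_synonym elC = "nat set \<Rightarrow> pt \<Rightarrow> complex"
type_synonym vfun = "pt \<Rightarrow> nat \<Rightarrow> complex"  (* C^M-valued function on [0,1)^N *)

definition cube :: "nat set \<Rightarrow> pt set" where
  "cube S = {x. \<forall>i\<in>S. 0 \<le> x i \<and> x i < 1}"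

definition merge :: "pt \<Rightarrow> pt \<Rightarrow> nat set \<Rightarrow> pt" where
  "merge k x \<alpha> = (\<lambda>i. if i \<in> \<alpha> then x i else k i)"

definition chi :: "nat \<Rightarrow> nat \<Rightarrow> real \<Rightarrow> complex" where
  "chi p i t = (if real i / real p \<le> t \<and> t < real (Suc i) / real p then 1 else 0)"

definition cells :: "nat \<Rightarrow> nat set \<Rightarrow> (nat \<Rightarrow> nat) set" where
  "cells p S = {c. (\<forall>j\<in>S. c j < p) \<and> (\<forall>j. j \<notin> S \<longrightarrow> c j = 0)}"

(* h-staircase function of the variables (k_S, x_T) on [0,1)^S x [0,1)^T, h = 1/p:
   a finite linear combination of products of the indicators chi *)
definition staircase2 :: "nat \<Rightarrow> nat set \<Rightarrow> nat set \<Rightarrow> (pt \<Rightarrow> pt \<Rightarrow> complex) \<Rightarrow> bool" where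
  "staircase2 p S T f \<longleftrightarrow> (\<exists>a. \<forall>k\<in>cube S. \<forall>x\<in>cube T.
      f k x = (\<Sum>c\<in>cells p S. \<Sum>d\<in>cells p T.
                 a c d * (\<Prod>j\<in>S. chi p (c j) (k j)) * (\<Prod>j\<in>T. chi p (d j) (x j))))"

(* the algebra L = L^h_{N,M}, via its coefficient tuples (A_alpha) *)
definition Lset :: "nat \<Rightarrow> nat \<Rightarrow> nat \<Rightarrow> opL set" where
  "Lset N M p = {A.
     (\<forall>\<alpha> k x i j. \<not> (\<alpha> \<subseteq> {..<N} \<and> k \<in> cube {..<N} \<and> x \<in> cube \<alpha> \<and> i < M \<and> j < M)
          \<longrightarrow> A \<alpha> k x i j = 0)
   \<and> (\<forall>\<alpha> k x k' x'. (\<forall>i<N. k i = k' i) \<and> (\<forall>i\<in>\<alpha>. x i = x' i) \<longrightarrow> A \<alpha> k x = A \<alpha> k' x')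
   \<and> (\<forall>\<alpha>. \<alpha> \<subseteq> {..<N} \<longrightarrow> (\<forall>i<M. \<forall>j<M. staircase2 p {..<N} \<alpha> (\<lambda>k x. A \<alpha> k x i j)))}"

definition unitI :: "real measure" where
  "unitI = restrict_space lborel {0..<1}"

definition cubeM :: "nat set \<Rightarrow> pt measure" where
  "cubeM S = (\<Pi>\<^sub>M i\<in>S. unitI)"

definition L2 :: "nat \<Rightarrow> nat \<Rightarrow> vfun set" where
  "L2 N M = {u. \<forall>j<M. (\<lambda>k. u k j) \<in> borel_measurable (cubeM {..<N})
                 \<and> integrable (cubeM {..<N}) (\<lambda>k. (cmod (u k j))\<^sup>2)}"

definition L2norm :: "nat \<Rightarrow> nat \<Rightarrow> vfun \<Rightarrow> real" where
  "L2norm N M u = sqrt (\<integral>k. (\<Sum>j<M. (cmod (u k j))\<^sup>2) \<partial>cubeM {..<N})"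

definition aeeq :: "nat \<Rightarrow> nat \<Rightarrow> vfun \<Rightarrow> vfun \<Rightarrow> bool" where
  "aeeq N M u v \<longleftrightarrow> (AE k in cubeM {..<N}. \<forall>j<M. u k j = v k j)"

definition opapp :: "nat \<Rightarrow> nat \<Rightarrow> opL \<Rightarrow> vfun \<Rightarrow> vfun" where
  "opapp N M A u = (\<lambda>k i. \<Sum>\<alpha>\<in>Pow {..<N}. \<Sum>j<M.
       \<integral>x. A \<alpha> k x i j * u (merge k x \<alpha>) j \<partial>cubeM \<alpha>)"

definition idL :: "nat \<Rightarrow> nat \<Rightarrow> opL" where
  "idL N M = (\<lambda>\<alpha> k x i j. if \<alpha> = {} \<and> k \<in> cube {..<N} \<and> i < M \<and> i = j then 1 else 0)"

definition zeroL :: "pt \<Rightarrow> pt \<Rightarrow> nat \<Rightarrow> nat \<Rightarrow> complex" where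
  "zeroL = (\<lambda>k x i j. 0)"

definition linL :: "complex \<Rightarrow> opL \<Rightarrow> complex \<Rightarrow> opL \<Rightarrow> opL" where
  "linL c A d B = (\<lambda>\<alpha> k x i j. c * A \<alpha> k x i j + d * B \<alpha> k x i j)"

definition mulL :: "nat \<Rightarrow> nat \<Rightarrow> nat \<Rightarrow> opL \<Rightarrow> opL \<Rightarrow> opL" where
  "mulL N M p A B = (THE C. C \<in> Lset N M p \<and>
      (\<forall>u\<in>L2 N M. aeeq N M (opapp N M C u) (opapp N M A (opapp N M B u))))"

definition normL :: "nat \<Rightarrow> nat \<Rightarrow> opL \<Rightarrow> real" where
  "normL N M A = (\<Sum>\<alpha>\<in>Pow {..<N}.
      Sup {(\<Sum>j<M. cmod (A \<alpha> k x i j)) | k x i. k \<in> cube {..<N} \<and> x \<in> cube \<alpha> \<and> i < M})"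

fun powL :: "nat \<Rightarrow> nat \<Rightarrow> nat \<Rightarrow> opL \<Rightarrow> nat \<Rightarrow> opL" where
  "powL N M p A 0 = idL N M"
| "powL N M p A (Suc n) = mulL N M p A (powL N M p A n)"

definition expL :: "nat \<Rightarrow> nat \<Rightarrow> nat \<Rightarrow> opL \<Rightarrow> opL" where
  "expL N M p A = (THE E. E \<in> Lset N M p \<and>
      (\<lambda>n. normL N M (\<lambda>\<alpha> k x i j. E \<alpha> k x i j -
              (\<Sum>m<n. powL N M p A m \<alpha> k x i j / of_nat (fact m)))) \<longlonglongrightarrow> 0)"

definition InvL :: "nat \<Rightarrow> nat \<Rightarrow> nat \<Rightarrow> opL set" where
  "InvL N M p = {A \<in> Lset N M p. \<exists>T :: vfun \<Rightarrow> vfun.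
      (\<forall>u\<in>L2 N M. T u \<in> L2 N M)
    \<and> (\<forall>u\<in>L2 N M. \<forall>v\<in>L2 N M. aeeq N M u v \<longrightarrow> aeeq N M (T u) (T v))
    \<and> (\<forall>u\<in>L2 N M. \<forall>v\<in>L2 N M. \<forall>c d. aeeq N M (T (\<lambda>k j. c * u k j + d * v k j))
                                     (\<lambda>k j. c * T u k j + d * T v k j))
    \<and> (\<exists>C. \<forall>u\<in>L2 N M. L2norm N M (T u) \<le> C * L2norm N M u)
    \<and> (\<forall>u\<in>L2 N M. aeeq N M (opapp N M A (T u)) u \<and> aeeq N M (T (opapp N M A u)) u)}"

definition tau :: "nat \<Rightarrow> opL \<Rightarrow> elC" where
  "tau M A = (\<lambda>\<alpha> k. \<Sum>i<M. \<integral>x. A \<alpha> (merge k x \<alpha>) x i i \<partial>cubeM \<alpha>)"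

definition ceq :: "nat \<Rightarrow> elC \<Rightarrow> elC \<Rightarrow> bool" where
  "ceq N f g \<longleftrightarrow> (\<forall>\<alpha>. \<alpha> \<subseteq> {..<N} \<longrightarrow> (\<forall>k\<in>cube ({..<N} - \<alpha>). f \<alpha> k = g \<alpha> k))"

definition distC :: "nat \<Rightarrow> elC \<Rightarrow> elC \<Rightarrow> real" where
  "distC N f g = Sup {cmod (f \<alpha> k - g \<alpha> k) | \<alpha> k. \<alpha> \<subseteq> {..<N} \<and> k \<in> cube ({..<N} - \<alpha>)}"

definition normC :: "nat \<Rightarrow> elC \<Rightarrow> real" where
  "normC N f = Sup {cmod (f \<alpha> k) | \<alpha> k. \<alpha> \<subseteq> {..<N} \<and> k \<in> cube ({..<N} - \<alpha>)}"

definition det_on :: "'a set \<Rightarrow> ('a \<Rightarrow> 'a \<Rightarrow> complex) \<Rightarrow> complex" where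
  "det_on S A = (\<Sum>\<sigma> | \<sigma> permutes S. of_int (sign \<sigma>) * (\<Prod>i\<in>S. A i (\<sigma> i)))"

definition cellpt :: "nat \<Rightarrow> (nat \<Rightarrow> nat) \<Rightarrow> pt" where
  "cellpt p d = (\<lambda>j. real (d j) / real p)"

(* Fredholm determinant of I + <B(k_{bar alpha} \<diamond> k_alpha, x_alpha) .>_alpha on L^2([0,1)^alpha, C^M)
   (k_alpha the variable).  The perturbation has finite rank with range in the finite-dimensional
   space of h-staircase functions of k_alpha; the determinant is that of the restriction of the
   operator to this invariant space, written as a matrix in the basis chi_d(k_alpha) e_m. *)
definition fdet :: "nat \<Rightarrow> nat \<Rightarrow> nat set \<Rightarrow> pt \<Rightarrow> (pt \<Rightarrow> pt \<Rightarrow> nat \<Rightarrow> nat \<Rightarrow> complex) \<Rightarrow> complex" where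
  "fdet M p \<alpha> k B = det_on (cells p \<alpha> \<times> {..<M})
     (\<lambda>(d', m') (d, m). (if (d', m') = (d, m) then 1 else 0)
        + of_real ((1 / real p) ^ card \<alpha>) * B (merge k (cellpt p d') \<alpha>) (cellpt p d) m' m)"

definition valid_order :: "nat \<Rightarrow> nat set list \<Rightarrow> bool" where
  "valid_order N ord \<longleftrightarrow> set ord = Pow {..<N} \<and> distinct ord \<and>
     (sorted_wrt (\<lambda>a b. card a \<le> card b) ord \<or> sorted_wrt (\<lambda>a b. card a \<ge> card b) ord)"

definition factorization :: "nat \<Rightarrow> nat \<Rightarrow> nat \<Rightarrow> (nat set \<Rightarrow> opL) \<Rightarrow> bool" where
  "factorization N M p G \<longleftrightarrow>
     (\<forall>\<alpha>. \<not> \<alpha> \<subseteq> {..<N} \<longrightarrow> G \<alpha> = idL N M)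
   \<and> G {} \<in> Lset N M p \<and> (\<forall>\<beta>. \<beta> \<noteq> {} \<longrightarrow> G {} \<beta> = zeroL)
   \<and> (\<forall>k\<in>cube {..<N}. det_on {..<M} (\<lambda>i j. G {} {} k (\<lambda>_. 0) i j) \<noteq> 0)
   \<and> (\<forall>\<alpha>. \<alpha> \<subseteq> {..<N} \<and> \<alpha> \<noteq> {} \<longrightarrow>
        G \<alpha> \<in> InvL N M p \<and> G \<alpha> {} = idL N M {} \<and> (\<forall>\<beta>. \<beta> \<noteq> {} \<and> \<beta> \<noteq> \<alpha> \<longrightarrow> G \<alpha> \<beta> = zeroL))"

definition prodL :: "nat \<Rightarrow> nat \<Rightarrow> nat \<Rightarrow> nat set list \<Rightarrow> (nat set \<Rightarrow> opL) \<Rightarrow> opL" where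
  "prodL N M p ord G = foldr (\<lambda>\<alpha> acc. mulL N M p (G \<alpha>) acc) ord (idL N M)"

definition piL :: "nat \<Rightarrow> nat \<Rightarrow> nat \<Rightarrow> nat set list \<Rightarrow> opL \<Rightarrow> elC" where
  "piL N M p ord A = (let G = (THE G. factorization N M p G \<and> prodL N M p ord G = A) in
      (\<lambda>\<alpha> k. if \<alpha> = {} then det_on {..<M} (\<lambda>i j. G {} {} k (\<lambda>_. 0) i j)
               else fdet M p \<alpha> k (G \<alpha> \<alpha>)))"

end

theory Submission
  imports Defs "Jordan_Normal_Form.Schur_Decomposition" "HOL-Probability.Infinite_Product_Measure"
begin

text \<open>
  For a set of variables \<open>\<gamma>\<close>, functions that are staircase in the variables of \<open>\<gamma>\<close> and have zero mean on
  every cell in each remaining variable form a subspace invariant under the whole algebra: on it the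
  components \<open>\<alpha>\<close> not contained in \<open>\<gamma>\<close> act by zero, and the others act by a finite matrix for each cell of the
  remaining variables. These matrices form a family of representations that is jointly faithful, and an element
  is invertible iff all of them are. The matrix at \<open>\<gamma>\<close> of a factor \<open>G\<^sub>\<alpha>\<close> is the identity unless
  \<open>\<alpha> \<subseteq> \<gamma>\<close>, and then it is block diagonal with blocks indexed by cells in the variables of \<open>\<gamma> - \<alpha>\<close>. Hence
  the block determinant at \<open>\<gamma>\<close> is the product of the values of \<open>\<pi>\<^sub>\<alpha>\<close> over all \<open>\<alpha> \<subseteq> \<gamma>\<close> and all such
  cells, and likewise the block trace is the sum of the values of \<open>\<tau>\<^sub>\<alpha>\<close>. Induction on the size of \<open>\<gamma>\<close>
  therefore carries multiplicativity, continuity and the identity \<open>det (exp X) = exp (tr X)\<close> over from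
  matrices to \<open>\<pi>\<close> and \<open>\<tau>\<close>.
\<close>

section \<open>Determinants over finite index sets\<close>

hide_const (open) Determinants.det
hide_const (open) Finite_Cartesian_Product.mat Finite_Cartesian_Product.vec Finite_Product_Measure.merge

text \<open>On a function that is staircase in all variables, only a weighted sum of all components
  is visible, so such functions alone cannot separate the components. The zero-mean condition cuts
  this sum down to the sets below a given one, and functions satisfying it exist because every cell
  can be halved, with opposite signs on the halves. The resulting blocks are triangular in the
  components, with weight \<open>h ^ card \<gamma>\<close> on the diagonal, so coefficients can be
  recovered from blocks by induction on the size of the set. The operations \<open>mulL\<close>,
  \<open>expL\<close> and \<open>piL\<close> are definite descriptions. Integration on the cube
  shows that composites stay in the algebra and that blocks multiply; injectivity of the block maps
  supplies uniqueness. Passing from block determinants back to \<open>piL\<close> is a division by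
  the contribution of the proper subsets, which is legitimate because no block of an invertible
  element is singular. Both orderings of the factors are covered at once: determinants of a product
  do not depend on the order, and in the block at \<gamma> the factor at \<gamma> can be isolated
  between invertible matrices wherever it stands.\<close>

lemma det_on_reindex:
  assumes f: "bij_betw f S T" and fin: "finite S"
  shows "det_on T A = det_on S (\<lambda>i j. A (f i) (f j))"
proof -
  let ?g = "inv_into S f"
  have g: "bij_betw ?g T S" using f by (rule bij_betw_inv_into)
  have inj: "inj_on f S" using f by (simp add: bij_betw_def)
  have fS: "f ` S = T" using f by (simp add: bij_betw_def)
  have gf: "?g (f x) = x" if "x \<in> S" for x using inj that by simp
  have fg: "f (?g x) = x" if "x \<in> T" for x using f that by (simp add: bij_betw_inv_into_right)
  \<comment> \<open>Conjugation by \<open>f\<close> identifies the two symmetric groups and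
    preserves signs; conjugation by the inverse bijection undoes it.\<close>
  have "bij_betw (map_permutation S f) {\<sigma>. \<sigma> permutes S} {\<sigma>. \<sigma> permutes T}"
  proof (rule bij_betwI[where g = "map_permutation T ?g"])
    show "map_permutation S f \<in> {\<sigma>. \<sigma> permutes S} \<rightarrow> {\<sigma>. \<sigma> permutes T}"
      using map_permutation_permutes[OF f] by auto
    show "map_permutation T ?g \<in> {\<sigma>. \<sigma> permutes T} \<rightarrow> {\<sigma>. \<sigma> permutes S}"
      using map_permutation_permutes[OF g] by auto
    show "map_permutation T ?g (map_permutation S f x) = x" if "x \<in> {\<sigma>. \<sigma> permutes S}" for x
      using map_permutation_compose_inv[OF f _ gf] that by auto
    show "map_permutation S f (map_permutation T ?g x) = x" if "x \<in> {\<sigma>. \<sigma> permutes T}" for x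
      using map_permutation_compose_inv[OF g _ fg] that by auto
  qed
  then have "det_on T A = (\<Sum>\<sigma> | \<sigma> permutes S. of_int (sign (map_permutation S f \<sigma>)) *
      (\<Prod>i\<in>T. A i (map_permutation S f \<sigma> i)))"
    unfolding det_on_def by (rule sum.reindex_bij_betw[symmetric])
  also have "\<dots> = det_on S (\<lambda>i j. A (f i) (f j))"
    unfolding det_on_def
  proof (intro sum.cong refl arg_cong2[where f = "(*)"])
    fix \<sigma> assume s: "\<sigma> \<in> {\<sigma>. \<sigma> permutes S}"
    show "of_int (sign (map_permutation S f \<sigma>)) = (of_int (sign \<sigma>) :: complex)"
      using sign_map_permutation[OF inj _ fin] s by simp
    have "(\<Prod>i\<in>T. A i (map_permutation S f \<sigma> i)) = (\<Prod>i\<in>S. A (f i) (map_permutation S f \<sigma> (f i)))"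
      by (rule prod.reindex_bij_betw[OF f, symmetric])
    also have "\<dots> = (\<Prod>i\<in>S. A (f i) (f (\<sigma> i)))"
      by (intro prod.cong refl) (simp add: map_permutation_apply[OF inj])
    finally show "(\<Prod>i\<in>T. A i (map_permutation S f \<sigma> i)) = (\<Prod>i\<in>S. A (f i) (f (\<sigma> i)))" .
  qed
  finally show ?thesis .
qed

lemma det_on_cong:
  assumes "\<And>i j. i \<in> S \<Longrightarrow> j \<in> S \<Longrightarrow> A i j = B i j"
  shows "det_on S A = det_on S B"
  unfolding det_on_def
  by (intro sum.cong refl arg_cong2[where f = "(*)"] prod.cong)
     (auto simp: assms permutes_in_image)

lemma det_mat_eq_det_on:
  "det (mat n n (\<lambda>(i, j). A i j)) = det_on {0..<n} A"
proof -
  have "det (mat n n (\<lambda>(i, j). A i j)) = (\<Sum>q | q permutes {0..<n}. of_int (sign q) * (\<Prod>i = 0..<n. A i (q i)))"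
    unfolding det_def'[OF mat_carrier]
    by (intro sum.cong refl arg_cong2[where f = "(*)"] prod.cong)
       (auto simp: permutes_in_image[where S="{0..<n}",simplified])
  then show ?thesis by (simp add: det_on_def)
qed

text \<open>The bridge to matrix theory: matrices are indexed by initial segments of the naturals
  and \<open>det_on\<close> by an arbitrary finite set, so facts about matrices are transported
  along an enumeration \<open>f\<close> of \<open>S\<close>.\<close>

lemma det_mat_reindex:
  assumes "bij_betw f {0..<n} S"
  shows "det (mat n n (\<lambda>(i, j). A (f i) (f j))) = det_on S A"
  using det_on_reindex[OF assms, of A] det_mat_eq_det_on[of n "\<lambda>i j. A (f i) (f j)"] by simp

lemma det_on_mult:
  assumes "finite S"
  shows "det_on S (\<lambda>i j. \<Sum>l\<in>S. A i l * B l j) = det_on S A * det_on S B"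
proof -
  obtain f where f: "bij_betw f {0..<card S} S"
    using ex_bij_betw_nat_finite[OF assms] by blast
  let ?n = "card S"
  let ?M = "\<lambda>A. mat ?n ?n (\<lambda>(i, j). A (f i) (f j)) :: complex mat"
  have "?M (\<lambda>i j. \<Sum>l\<in>S. A i l * B l j) = ?M A * ?M B"
    by (rule eq_matI) (auto simp: scalar_prod_def sum.reindex_bij_betw[OF f, symmetric])
  moreover have "det (?M A * ?M B) = det (?M A) * det (?M B)"
    by (rule det_mult) auto
  ultimately have "det (?M (\<lambda>i j. \<Sum>l\<in>S. A i l * B l j)) = det (?M A) * det (?M B)" by simp
  then show ?thesis
    using det_mat_reindex[OF f, of "\<lambda>i j. \<Sum>l\<in>S. A i l * B l j"]
    unfolding det_mat_reindex[OF f] by simp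
qed

lemma det_on_empty: "det_on {} A = 1"
  by (simp add: det_on_def)

text \<open>A permutation with nonvanishing contribution must fix every index whose row is a unit row.\<close>
lemma det_on_unit_rows:
  assumes "finite S" "T \<subseteq> S"
    and row: "\<And>i j. i \<in> S - T \<Longrightarrow> j \<in> S \<Longrightarrow> A i j = (if i = j then 1 else 0)"
  shows "det_on S A = det_on T A"
proof -
  have "det_on S A = (\<Sum>\<sigma> | \<sigma> permutes T. of_int (sign \<sigma>) * (\<Prod>i\<in>S. A i (\<sigma> i)))"
    unfolding det_on_def
  proof (rule sum.mono_neutral_right)
    show "finite {\<sigma>. \<sigma> permutes S}" using assms(1) by (rule finite_permutations)
    show "{\<sigma>. \<sigma> permutes T} \<subseteq> {\<sigma>. \<sigma> permutes S}"
      using permutes_subset[OF _ assms(2)] by auto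
    show "\<forall>\<sigma>\<in>{\<sigma>. \<sigma> permutes S} - {\<sigma>. \<sigma> permutes T}. of_int (sign \<sigma>) * (\<Prod>i\<in>S. A i (\<sigma> i)) = 0"
    proof
      fix \<sigma> assume s: "\<sigma> \<in> {\<sigma>. \<sigma> permutes S} - {\<sigma>. \<sigma> permutes T}"
      then obtain i where i: "i \<in> S - T" "\<sigma> i \<noteq> i"
        using permutes_superset[of \<sigma> S T] by auto
      then have "A i (\<sigma> i) = 0" using row[of i "\<sigma> i"] s permutes_in_image[of \<sigma> S i] by auto
      then show "of_int (sign \<sigma>) * (\<Prod>i\<in>S. A i (\<sigma> i)) = 0"
        using i assms(1) by auto
    qed
  qed
  also have "\<dots> = det_on T A"
    unfolding det_on_def
  proof (intro sum.cong refl arg_cong2[where f = "(*)"])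
    fix \<sigma> assume s: "\<sigma> \<in> {\<sigma>. \<sigma> permutes T}"
    show "(\<Prod>i\<in>S. A i (\<sigma> i)) = (\<Prod>i\<in>T. A i (\<sigma> i))"
      using assms(1,2) row s by (intro prod.mono_neutral_right) (auto simp: permutes_not_in)
  qed
  finally show ?thesis .
qed

text \<open>Peels off one block \<open>e\<close> by writing the matrix as \<open>?Y\<close> times
  \<open>?Z\<close>, where \<open>?Y\<close> keeps block \<open>e\<close> and is the identity
  elsewhere, and \<open>?Z\<close> is the identity on block \<open>e\<close> and keeps the others.
  The determinant of the product splits, and the unit rows of each factor can be discarded.\<close>

lemma det_on_block_diagonal:
  assumes "finite D" "finite J"
  shows "det_on (D \<times> J) (\<lambda>(d', a) (d, b). if d' = d then X d a b else 0) = (\<Prod>d\<in>D. det_on J (X d))"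
  using assms(1)
proof (induction D rule: finite_induct)
  case empty
  then show ?case by (simp add: det_on_empty)
next
  case (insert e D)
  let ?S = "insert e D \<times> J"
  let ?Y = "\<lambda>(d', a) (d, b). if d' = d then (if d = e then X d a b else if a = b then 1 else 0) else 0"
  let ?Z = "\<lambda>(d', a) (d, b). if d' = d then (if d = e then if a = b then 1 else 0 else X d a b) else 0"
  have fin: "finite ?S" using insert assms by auto
  have bij: "bij_betw (Pair e) J ({e} \<times> J)"
    by (auto simp: bij_betw_def inj_on_def)
  have "det_on ?S (\<lambda>(d', a) (d, b). if d' = d then X d a b else 0)
      = det_on ?S (\<lambda>i j. \<Sum>l\<in>?S. ?Y i l * ?Z l j)"
  proof (rule det_on_cong)
    fix i j assume ij: "i \<in> ?S" "j \<in> ?S"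
    obtain d' a d b where [simp]: "i = (d', a)" "j = (d, b)" by (cases i, cases j)
    have "(\<Sum>l\<in>?S. ?Y i l * ?Z l j) = (if d' = d then X d a b else 0)"
    proof (cases "d' = e")
      case True
      have "(\<Sum>l\<in>?S. ?Y i l * ?Z l j) = (\<Sum>l\<in>{(e, b)}. ?Y i l * ?Z l j)"
        using fin True ij by (intro sum.mono_neutral_right) (auto split: if_splits)
      then show ?thesis using True by auto
    next
      case False
      have "(\<Sum>l\<in>?S. ?Y i l * ?Z l j) = (\<Sum>l\<in>{(d', a)}. ?Y i l * ?Z l j)"
        using fin False ij by (intro sum.mono_neutral_right) (auto split: if_splits)
      then show ?thesis using False by auto
    qed
    then show "(case i of (d', a) \<Rightarrow> \<lambda>(d, b). if d' = d then X d a b else 0) j = (\<Sum>l\<in>?S. ?Y i l * ?Z l j)"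
      by simp
  qed
  also have "\<dots> = det_on ?S ?Y * det_on ?S ?Z"
    by (rule det_on_mult[OF fin])
  also have "det_on ?S ?Y = det_on ({e} \<times> J) ?Y"
    by (rule det_on_unit_rows[OF fin]) (auto split: if_splits)
  also have "det_on ({e} \<times> J) ?Y = det_on J (X e)"
    using det_on_reindex[OF bij assms(2), of ?Y] by simp
  also have "det_on ?S ?Z = det_on (D \<times> J) ?Z"
    by (rule det_on_unit_rows[OF fin]) (auto split: if_splits)
  also have "\<dots> = det_on (D \<times> J) (\<lambda>(d', a) (d, b). if d' = d then X d a b else 0)"
    using insert by (intro det_on_cong) auto
  finally show ?case using insert by simp
qed

section \<open>The determinant of a matrix exponential\<close>

lemma upper_triangular_pow:
  assumes T: "T \<in> carrier_mat n n" and ut: "upper_triangular T"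
  shows "(\<forall>i<n. \<forall>j<i. (T ^\<^sub>m m) $$ (i, j) = 0) \<and> (\<forall>i<n. (T ^\<^sub>m m) $$ (i, i) = (T $$ (i, i)) ^ m)"
proof (induction m)
  case 0
  then show ?case using T by auto
next
  case (Suc m)
  have Tm: "T ^\<^sub>m m \<in> carrier_mat n n" using T by simp
  have e: "(T ^\<^sub>m Suc m) $$ (i, j) = (\<Sum>l = 0..<n. (T ^\<^sub>m m) $$ (i, l) * T $$ (l, j))" if "i < n" "j < n" for i j
    using that T Tm by (simp add: scalar_prod_def)
  have z: "T $$ (l, j) = 0" if "j < l" "l < n" for l j
    using ut that T by auto
  have "(T ^\<^sub>m Suc m) $$ (i, j) = 0" if "i < n" "j < i" for i j
    unfolding e[OF that(1) less_trans[OF that(2,1)]]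
  proof (rule sum.neutral, rule ballI)
    fix l assume "l \<in> {0..<n}"
    then show "(T ^\<^sub>m m) $$ (i, l) * T $$ (l, j) = 0"
      using Suc z[of j l] that by (cases "l < i") auto
  qed
  moreover have "(T ^\<^sub>m Suc m) $$ (i, i) = (T $$ (i, i)) ^ Suc m" if i: "i < n" for i
  proof -
    have "(\<Sum>l = 0..<n. (T ^\<^sub>m m) $$ (i, l) * T $$ (l, i)) = (\<Sum>l\<in>{i}. (T ^\<^sub>m m) $$ (i, l) * T $$ (l, i))"
    proof (rule sum.mono_neutral_right)
      show "\<forall>l\<in>{0..<n} - {i}. (T ^\<^sub>m m) $$ (i, l) * T $$ (l, i) = 0"
      proof
        fix l assume l: "l \<in> {0..<n} - {i}"
        show "(T ^\<^sub>m m) $$ (i, l) * T $$ (l, i) = 0"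
        proof (cases "l < i")
          case True
          then show ?thesis using Suc i by simp
        next
          case False
          then show ?thesis using z[of i l] l by simp
        qed
      qed
    qed (use i in auto)
    then show ?thesis using e[OF i i] Suc i by (simp add: power_commutes)
  qed
  ultimately show ?case by blast
qed

text \<open>Triangularisation reduces the identity to the diagonal entries, on which the exponential
  series is the scalar one.\<close>
lemma det_exp:
  fixes X :: "complex mat"
  assumes X: "X \<in> carrier_mat n n" and E: "E \<in> carrier_mat n n"
    and sums: "\<And>i j. i < n \<Longrightarrow> j < n \<Longrightarrow> (\<lambda>m. (X ^\<^sub>m m) $$ (i, j) / of_nat (fact m)) sums (E $$ (i, j))"
  shows "det E = exp (\<Sum>i<n. X $$ (i, i))"
proof -
  obtain as where "char_poly X = (\<Prod>a\<leftarrow>as. [:- a, 1:])"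
    using char_poly_factorized[OF X] by auto
  then obtain T where T: "T \<in> carrier_mat n n" and ut: "upper_triangular T" and sim: "similar_mat X T"
    using schur_decomposition_exists[OF X] by blast
  obtain P Q where wit: "similar_mat_wit X T P Q" using sim unfolding similar_mat_def by auto
  note w = similar_mat_witD2[OF X wit]
  note P = w(6) and Q = w(7) and QP1 = w(2)
  define F where "F = Q * E * P"
  have F: "F \<in> carrier_mat n n" unfolding F_def using P Q E by simp
  have Tpow: "T ^\<^sub>m m = Q * X ^\<^sub>m m * P" for m
    using similar_mat_wit_pow_id[OF similar_mat_wit_sym[OF wit]] .
  \<comment> \<open>Every entry of a conjugated matrix is a fixed finite linear combination of the
    original entries. Entrywise convergence of the exponential series of \<open>X\<close> to
    \<open>E\<close> therefore passes to the triangular form \<open>T\<close>, with limit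
    \<open>F\<close>.\<close>
  have ent: "(Q * Y * P) $$ (i, j) = (\<Sum>b = 0..<n. \<Sum>a = 0..<n. Q $$ (i, a) * Y $$ (a, b) * P $$ (b, j))"
    if "i < n" "j < n" "Y \<in> carrier_mat n n" for i j Y
  proof -
    have "(Q * Y * P) $$ (i, j) = (\<Sum>b = 0..<n. (Q * Y) $$ (i, b) * P $$ (b, j))"
      using that P Q by (simp add: scalar_prod_def del: assoc_mult_mat)
    also have "\<dots> = (\<Sum>b = 0..<n. \<Sum>a = 0..<n. Q $$ (i, a) * Y $$ (a, b) * P $$ (b, j))"
      using that P Q by (intro sum.cong) (auto simp: scalar_prod_def sum_distrib_right)
    finally show ?thesis .
  qed
  have ent': "(P * Y * Q) $$ (i, j) = (\<Sum>b = 0..<n. \<Sum>a = 0..<n. P $$ (i, a) * Y $$ (a, b) * Q $$ (b, j))"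
    if "i < n" "j < n" "Y \<in> carrier_mat n n" for i j Y
  proof -
    have "(P * Y * Q) $$ (i, j) = (\<Sum>b = 0..<n. (P * Y) $$ (i, b) * Q $$ (b, j))"
      using that P Q by (simp add: scalar_prod_def del: assoc_mult_mat)
    also have "\<dots> = (\<Sum>b = 0..<n. \<Sum>a = 0..<n. P $$ (i, a) * Y $$ (a, b) * Q $$ (b, j))"
      using that P Q by (intro sum.cong) (auto simp: scalar_prod_def sum_distrib_right)
    finally show ?thesis .
  qed
  have Fs: "(\<lambda>m. (T ^\<^sub>m m) $$ (i, j) / of_nat (fact m)) sums (F $$ (i, j))" if ij: "i < n" "j < n" for i j
  proof -
    have "(\<lambda>m. \<Sum>b = 0..<n. \<Sum>a = 0..<n. Q $$ (i, a) * ((X ^\<^sub>m m) $$ (a, b) / of_nat (fact m)) * P $$ (b, j))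
       sums (\<Sum>b = 0..<n. \<Sum>a = 0..<n. Q $$ (i, a) * E $$ (a, b) * P $$ (b, j))"
      by (intro sums_sum sums_mult sums_mult2 sums) auto
    then show ?thesis
      unfolding Tpow F_def ent[OF ij pow_carrier_mat[OF X]] ent[OF ij E]
      by (simp add: sum_divide_distrib)
  qed
  have "F $$ (i, j) = 0" if "i < n" "j < i" for i j
  proof -
    have "(\<lambda>m. (T ^\<^sub>m m) $$ (i, j) / of_nat (fact m)) = (\<lambda>m. 0)"
      using upper_triangular_pow[OF T ut] that by auto
    then show ?thesis using Fs[of i j] that sums_unique2[OF _ sums_zero] by auto
  qed
  then have utF: "upper_triangular F" using F by auto
  have Fd: "F $$ (i, i) = exp (T $$ (i, i))" if "i < n" for i
  proof -
    have "(\<lambda>m. (T ^\<^sub>m m) $$ (i, i) / of_nat (fact m)) = (\<lambda>m. (T $$ (i, i)) ^ m /\<^sub>R fact m)"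
      using upper_triangular_pow[OF T ut] that by (auto simp: scaleR_conv_of_real divide_inverse mult.commute)
    then show ?thesis using Fs[of i i] that sums_unique2[OF _ exp_converges] by auto
  qed
  have "det F = det Q * det E * det P"
    unfolding F_def using P Q E by (simp add: det_mult[where n = n])
  also have "\<dots> = det E * det (Q * P)" using P Q by (subst det_mult[where n = n]) auto
  also have "\<dots> = det E" unfolding QP1 by simp
  finally have "det E = prod_list (diag_mat F)" using det_upper_triangular[OF utF F] by simp
  also have "\<dots> = (\<Prod>i = 0..<n. F $$ (i, i))"
    using F by (simp add: diag_mat_def prod.list_conv_set_nth)
  also have "\<dots> = exp (\<Sum>i = 0..<n. T $$ (i, i))"
    by (simp add: exp_sum Fd)
  \<comment> \<open>Invariance of the trace under conjugation: when the outer index is summed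
    innermost, the entries of \<open>Q * P = 1\<close> appear.\<close>
  also have "(\<Sum>i = 0..<n. T $$ (i, i)) = (\<Sum>i = 0..<n. X $$ (i, i))"
  proof -
    have QP: "(\<Sum>i = 0..<n. Q $$ (a, i) * P $$ (i, b)) = (if a = b then 1 else 0)" if "a < n" "b < n" for a b
    proof -
      have "(Q * P) $$ (a, b) = (\<Sum>i = 0..<n. Q $$ (a, i) * P $$ (i, b))"
        using P Q that by (simp add: scalar_prod_def)
      then show ?thesis using QP1 that by simp
    qed
    have "(\<Sum>i = 0..<n. X $$ (i, i)) = (\<Sum>i = 0..<n. \<Sum>b = 0..<n. \<Sum>a = 0..<n. P $$ (i, a) * T $$ (a, b) * Q $$ (b, i))"
      using ent'[OF _ _ T] w(3) by (intro sum.cong) auto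
    also have "\<dots> = (\<Sum>b = 0..<n. \<Sum>a = 0..<n. T $$ (a, b) * (\<Sum>i = 0..<n. Q $$ (b, i) * P $$ (i, a)))"
      by (subst sum.swap, rule sum.cong[OF refl], subst sum.swap)
         (simp add: sum_distrib_left mult_ac)
    also have "\<dots> = (\<Sum>b = 0..<n. \<Sum>a = 0..<n. if b = a then T $$ (a, b) else 0)"
      by (intro sum.cong) (auto simp: QP)
    also have "\<dots> = (\<Sum>b = 0..<n. T $$ (b, b))" by simp
    finally show ?thesis by simp
  qed
  finally show ?thesis by (simp add: atLeast0LessThan)
qed

section \<open>Cells and staircase functions\<close>

text \<open>The label of the cell containing \<open>k\<close> in the coordinates of
  \<open>S\<close>. The value 0 off \<open>S\<close> is the normal form demanded by
  \<open>cells\<close>, so that labels can be compared as functions.\<close>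

definition cl :: "nat \<Rightarrow> nat set \<Rightarrow> pt \<Rightarrow> nat \<Rightarrow> nat" where
  "cl p S k = (\<lambda>i. if i \<in> S then nat \<lfloor>real p * k i\<rfloor> else 0)"

definition cmerge :: "(nat \<Rightarrow> nat) \<Rightarrow> (nat \<Rightarrow> nat) \<Rightarrow> nat set \<Rightarrow> nat \<Rightarrow> nat" where
  "cmerge d e \<beta> = (\<lambda>i. if i \<in> \<beta> then e i else d i)"

definition cres :: "(nat \<Rightarrow> nat) \<Rightarrow> nat set \<Rightarrow> nat \<Rightarrow> nat" where
  "cres d S = (\<lambda>i. if i \<in> S then d i else 0)"

lemma finite_cells: "finite S \<Longrightarrow> finite (cells p S)"
proof -
  assume S: "finite S"
  have "cells p S \<subseteq> {f. \<forall>x. (x \<in> S \<longrightarrow> f x \<in> {..<p}) \<and> (x \<notin> S \<longrightarrow> f x = 0)}"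
    by (auto simp: cells_def)
  then show ?thesis
    using finite_set_of_finite_funs[OF S, of "{..<p}" 0] by (simp add: finite_subset)
qed

lemma cells_empty [simp]: "cells p {} = {\<lambda>_. 0}"
  by (auto simp: cells_def)

lemma cube_mono: "k \<in> cube S \<Longrightarrow> T \<subseteq> S \<Longrightarrow> k \<in> cube T"
  by (auto simp: cube_def)

lemma cube_empty [simp]: "k \<in> cube {}"
  by (auto simp: cube_def)

lemma cl_cong: "(\<And>i. i \<in> S \<Longrightarrow> k i = k' i) \<Longrightarrow> cl p S k = cl p S k'"
  by (auto simp: cl_def fun_eq_iff)

lemma cl_in_cells:
  assumes "0 < p" "k \<in> cube S" shows "cl p S k \<in> cells p S"
proof -
  have "nat \<lfloor>real p * k i\<rfloor> < p" if "i \<in> S" for i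
  proof -
    have "0 \<le> k i" "k i < 1" using assms that by (auto simp: cube_def)
    then have "0 \<le> real p * k i" "real p * k i < real p" using assms(1) by auto
    then show ?thesis by linarith
  qed
  then show ?thesis by (auto simp: cells_def cl_def)
qed

text \<open>\<open>T\<close> is independent of \<open>S\<close>: labels vanish outside
  \<open>S\<close>, so the corner has a legitimate value in every coordinate.\<close>

lemma cellpt_in_cube:
  assumes "0 < p" "c \<in> cells p S" shows "cellpt p c \<in> cube T"
proof -
  have "c i < p" for i using assms by (cases "i \<in> S") (auto simp: cells_def)
  then show ?thesis using assms by (auto simp: cube_def cellpt_def)
qed

lemma cl_cellpt: "0 < p \<Longrightarrow> cl p T (cellpt p c) = cres c T"
  by (auto simp: cl_def cellpt_def cres_def fun_eq_iff)

lemma cres_cells [simp]: "c \<in> cells p S \<Longrightarrow> cres c S = c"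
  by (auto simp: cres_def cells_def)

lemma cres_in_cells: "c \<in> cells p S \<Longrightarrow> T \<subseteq> S \<Longrightarrow> cres c T \<in> cells p T"
  by (auto simp: cres_def cells_def)

lemma cres_cl: "T \<subseteq> S \<Longrightarrow> cres (cl p S k) T = cl p T k"
  by (auto simp: cres_def cl_def fun_eq_iff)

lemma cmerge_in_cells:
  "d \<in> cells p (\<gamma> - \<beta>) \<Longrightarrow> e \<in> cells p \<beta> \<Longrightarrow> \<beta> \<subseteq> \<gamma> \<Longrightarrow> cmerge d e \<beta> \<in> cells p \<gamma>"
  by (auto simp: cells_def cmerge_def)

lemma cres_cmerge: "e \<in> cells p \<beta> \<Longrightarrow> cres (cmerge d e \<beta>) \<beta> = e"
  by (rule ext) (simp add: cmerge_def cres_def cells_def)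

lemma cells_eq_iff: "d' \<in> cells p S \<Longrightarrow> d \<in> cells p S \<Longrightarrow> (\<forall>l\<in>S. d' l = d l) \<longleftrightarrow> d' = d"
  unfolding cells_def by (auto simp: fun_eq_iff)

text \<open>The index bijection behind all block decompositions: the part of a cell in \<gamma> -
  \<beta> plays the role of a parameter, the part in \<beta> that of a matrix index or summation
  variable.\<close>

lemma bij_cmerge:
  assumes "\<beta> \<subseteq> \<gamma>"
  shows "bij_betw (\<lambda>(d, e). cmerge d e \<beta>) (cells p (\<gamma> - \<beta>) \<times> cells p \<beta>) (cells p \<gamma>)"
proof (rule bij_betwI[where g = "\<lambda>c. (cres c (\<gamma> - \<beta>), cres c \<beta>)"])
  show "(\<lambda>(d, e). cmerge d e \<beta>) \<in> cells p (\<gamma> - \<beta>) \<times> cells p \<beta> \<rightarrow> cells p \<gamma>"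
    using cmerge_in_cells[OF _ _ assms] by auto
  show "(\<lambda>c. (cres c (\<gamma> - \<beta>), cres c \<beta>)) \<in> cells p \<gamma> \<rightarrow> cells p (\<gamma> - \<beta>) \<times> cells p \<beta>"
    using cres_in_cells[of _ p \<gamma>] assms by auto
  show "(cres (case x of (d, e) \<Rightarrow> cmerge d e \<beta>) (\<gamma> - \<beta>), cres (case x of (d, e) \<Rightarrow> cmerge d e \<beta>) \<beta>) = x"
    if "x \<in> cells p (\<gamma> - \<beta>) \<times> cells p \<beta>" for x
    using that by (auto simp: cells_def cres_def cmerge_def fun_eq_iff)
  show "(case (cres y (\<gamma> - \<beta>), cres y \<beta>) of (d, e) \<Rightarrow> cmerge d e \<beta>) = y" if "y \<in> cells p \<gamma>" for y
    using that assms by (auto simp: cells_def cres_def cmerge_def fun_eq_iff)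
qed

lemma sum_cells_split:
  assumes "\<beta> \<subseteq> \<gamma>"
  shows "(\<Sum>c\<in>cells p \<gamma>. F c) = (\<Sum>d\<in>cells p (\<gamma> - \<beta>). \<Sum>e\<in>cells p \<beta>. F (cmerge d e \<beta>))"
  using sum.reindex_bij_betw[OF bij_cmerge[OF assms], of F]
  unfolding sum.cartesian_product by (simp add: case_prod_unfold)

section \<open>Cell indicators and constancy on cells\<close>

lemma chi_eq:
  assumes "0 < p" "0 \<le> t"
  shows "chi p c t = (if nat \<lfloor>real p * t\<rfloor> = c then 1 else 0)"
proof -
  have "real c / real p \<le> t \<and> t < real (Suc c) / real p \<longleftrightarrow> real c \<le> real p * t \<and> real p * t < real c + 1"
    using assms by (auto simp: field_simps)
  also have "\<dots> \<longleftrightarrow> \<lfloor>real p * t\<rfloor> = int c"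
    by (simp add: floor_eq_iff)
  also have "\<dots> \<longleftrightarrow> nat \<lfloor>real p * t\<rfloor> = c"
    using assms by (auto simp: nat_eq_iff)
  finally show ?thesis by (simp add: chi_def)
qed

definition ind :: "nat \<Rightarrow> nat set \<Rightarrow> (nat \<Rightarrow> nat) \<Rightarrow> pt \<Rightarrow> complex" where
  "ind p S c x = (\<Prod>j\<in>S. chi p (c j) (x j))"

lemma ind_eq:
  assumes "0 < p" "finite S" "x \<in> cube S" "c \<in> cells p S"
  shows "ind p S c x = (if cl p S x = c then 1 else 0)"
proof -
  have e: "chi p (c j) (x j) = (if cl p S x j = c j then 1 else 0)" if "j \<in> S" for j
    using assms that by (subst chi_eq) (auto simp: cl_def cube_def)
  show ?thesis
  proof (cases "cl p S x = c")
    case True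
    then show ?thesis by (simp add: ind_def e)
  next
    case False
    then obtain j where "cl p S x j \<noteq> c j" by auto
    moreover from this have "j \<in> S" using assms(4) by (auto simp: cl_def cells_def split: if_splits)
    ultimately have "\<exists>j\<in>S. chi p (c j) (x j) = 0" using e by auto
    then show ?thesis using False assms(2) by (auto simp: ind_def prod_zero_iff)
  qed
qed

lemma sum_ind:
  assumes "0 < p" "finite S" "x \<in> cube S"
  shows "(\<Sum>c\<in>cells p S. F c * ind p S c x) = F (cl p S x)"
proof -
  have "(\<Sum>c\<in>cells p S. F c * ind p S c x) = (\<Sum>c\<in>cells p S. if c = cl p S x then F c else 0)"
    using assms by (intro sum.cong) (auto simp: ind_eq)
  then show ?thesis using assms cl_in_cells[of p x S] finite_cells[of S p] by simp
qed

text \<open>Evaluating the linear combination at a point leaves exactly one coefficient, that of the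
  cell of the point. Conversely, a function that is constant on cells is the combination whose
  coefficients are its values at the lower corners. This turns the existential definition into a
  condition that can be checked pointwise.\<close>

lemma staircase2_iff:
  assumes p: "0 < p" and S: "finite S" and T: "finite T"
  shows "staircase2 p S T f \<longleftrightarrow> (\<forall>k\<in>cube S. \<forall>x\<in>cube T. \<forall>k'\<in>cube S. \<forall>x'\<in>cube T.
     cl p S k = cl p S k' \<longrightarrow> cl p T x = cl p T x' \<longrightarrow> f k x = f k' x')"
proof
  assume "staircase2 p S T f"
  then obtain a where a: "\<And>k x. k \<in> cube S \<Longrightarrow> x \<in> cube T \<Longrightarrow>
    f k x = (\<Sum>c\<in>cells p S. (\<Sum>d\<in>cells p T. a c d * ind p S c k * ind p T d x))"
    unfolding staircase2_def ind_def by blast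
  have "f k x = a (cl p S k) (cl p T x)" if "k \<in> cube S" "x \<in> cube T" for k x
    using a[OF that] sum_ind[OF p T that(2)] sum_ind[OF p S that(1)] by simp
  then show "\<forall>k\<in>cube S. \<forall>x\<in>cube T. \<forall>k'\<in>cube S. \<forall>x'\<in>cube T.
     cl p S k = cl p S k' \<longrightarrow> cl p T x = cl p T x' \<longrightarrow> f k x = f k' x'" by simp
next
  assume r: "\<forall>k\<in>cube S. \<forall>x\<in>cube T. \<forall>k'\<in>cube S. \<forall>x'\<in>cube T.
     cl p S k = cl p S k' \<longrightarrow> cl p T x = cl p T x' \<longrightarrow> f k x = f k' x'"
  show "staircase2 p S T f"
    unfolding staircase2_def
  proof (intro exI[of _ "\<lambda>c d. f (cellpt p c) (cellpt p d)"] ballI)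
    fix k x assume kx: "k \<in> cube S" "x \<in> cube T"
    let ?k = "cellpt p (cl p S k)" and ?x = "cellpt p (cl p T x)"
    have "f k x = f ?k ?x"
      by (rule r[rule_format, OF kx cellpt_in_cube[OF p cl_in_cells[OF p kx(1)]] cellpt_in_cube[OF p cl_in_cells[OF p kx(2)]]])
         (simp_all add: cl_cellpt[OF p] cres_cl)
    also have "\<dots> = (\<Sum>c\<in>cells p S. \<Sum>d\<in>cells p T. f (cellpt p c) (cellpt p d) * ind p S c k * ind p T d x)"
      by (simp add: sum_ind[OF p T kx(2)] sum_ind[OF p S kx(1)])
    finally show "f k x = (\<Sum>c\<in>cells p S. \<Sum>d\<in>cells p T. f (cellpt p c) (cellpt p d) *
        (\<Prod>j\<in>S. chi p (c j) (k j)) * (\<Prod>j\<in>T. chi p (d j) (x j)))"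
      unfolding ind_def .
  qed
qed

lemma merge_cube: "k \<in> cube (S - \<alpha>) \<Longrightarrow> x \<in> cube \<alpha> \<Longrightarrow> merge k x \<alpha> \<in> cube S"
  by (auto simp: cube_def merge_def)

lemma merge_empty [simp]: "merge k x {} = k"
  by (simp add: merge_def)

lemma cl_merge_in: "S \<subseteq> \<alpha> \<Longrightarrow> cl p S (merge k x \<alpha>) = cl p S x"
  by (auto simp: cl_def merge_def fun_eq_iff)

lemma cl_merge_off: "S \<inter> \<alpha> = {} \<Longrightarrow> cl p S (merge k x \<alpha>) = cl p S k"
  by (auto simp: cl_def merge_def fun_eq_iff)

lemma cl_eq_iff: "cl p S k = cl p S k' \<longleftrightarrow> (\<forall>i\<in>S. nat \<lfloor>real p * k i\<rfloor> = nat \<lfloor>real p * k' i\<rfloor>)"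
  by (auto simp: cl_def fun_eq_iff split: if_splits)

lemma cl_merge_cong:
  "cl p (S - \<alpha>) k = cl p (S - \<alpha>) k' \<Longrightarrow> cl p (S \<inter> \<alpha>) x = cl p (S \<inter> \<alpha>) x' \<Longrightarrow>
   cl p S (merge k x \<alpha>) = cl p S (merge k' x' \<alpha>)"
  by (auto simp: cl_eq_iff merge_def)

section \<open>Elements of the algebra and their block matrices\<close>

locale staircase_algebra =
  fixes N M p :: nat
  assumes M_pos: "0 < M" and p_pos: "0 < p"
begin

text \<open>Two of the clauses of \<open>Lset\<close> merge into constancy on cells: points that
  agree in the relevant coordinates are either in a common cell or both outside the cube, where the
  coefficient is 0.\<close>

lemma Lset_iff:
  "A \<in> Lset N M p \<longleftrightarrow>
     (\<forall>\<alpha> k x i j. \<not> (\<alpha> \<subseteq> {..<N} \<and> k \<in> cube {..<N} \<and> x \<in> cube \<alpha> \<and> i < M \<and> j < M) \<longrightarrow> A \<alpha> k x i j = 0)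
   \<and> (\<forall>\<alpha> k x k' x' i j. \<alpha> \<subseteq> {..<N} \<longrightarrow> k \<in> cube {..<N} \<longrightarrow> k' \<in> cube {..<N} \<longrightarrow> x \<in> cube \<alpha> \<longrightarrow> x' \<in> cube \<alpha>
        \<longrightarrow> i < M \<longrightarrow> j < M \<longrightarrow> cl p {..<N} k = cl p {..<N} k' \<longrightarrow> cl p \<alpha> x = cl p \<alpha> x' \<longrightarrow> A \<alpha> k x i j = A \<alpha> k' x' i j)"
   (is "_ \<longleftrightarrow> ?Z \<and> ?C")
proof
  assume A: "A \<in> Lset N M p"
  then have "?Z" by (auto simp: Lset_def)
  moreover have ?C
  proof (intro allI impI)
    fix \<alpha> k x k' x' i j
    assume a: "\<alpha> \<subseteq> {..<N}" "k \<in> cube {..<N}" "k' \<in> cube {..<N}" "x \<in> cube \<alpha>" "x' \<in> cube \<alpha>"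
      "i < M" "j < M" "cl p {..<N} k = cl p {..<N} k'" "cl p \<alpha> x = cl p \<alpha> x'"
    have "staircase2 p {..<N} \<alpha> (\<lambda>k x. A \<alpha> k x i j)" using A a(1,6,7) unfolding Lset_def by blast
    then show "A \<alpha> k x i j = A \<alpha> k' x' i j"
      unfolding staircase2_iff[OF p_pos finite_lessThan finite_subset[OF a(1) finite_lessThan]] using a by blast
  qed
  ultimately show "?Z \<and> ?C" ..
next
  assume ZC: "?Z \<and> ?C"
  have "A \<alpha> k x = A \<alpha> k' x'" if "\<forall>i<N. k i = k' i" "\<forall>i\<in>\<alpha>. x i = x' i" for \<alpha> k x k' x'
  proof (intro ext)
    fix i j
    have "k \<in> cube {..<N} \<longleftrightarrow> k' \<in> cube {..<N}" "x \<in> cube \<alpha> \<longleftrightarrow> x' \<in> cube \<alpha>"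
      using that by (simp_all add: cube_def)
    moreover have "cl p {..<N} k = cl p {..<N} k'" "cl p \<alpha> x = cl p \<alpha> x'"
      using that by (auto intro: cl_cong)
    ultimately show "A \<alpha> k x i j = A \<alpha> k' x' i j"
      using conjunct1[OF ZC, rule_format, of \<alpha> k x i j] conjunct1[OF ZC, rule_format, of \<alpha> k' x' i j]
        conjunct2[OF ZC, rule_format, of \<alpha> k k' x x' i j] by argo
  qed
  moreover have "staircase2 p {..<N} \<alpha> (\<lambda>k x. A \<alpha> k x i j)" if "\<alpha> \<subseteq> {..<N}" "i < M" "j < M" for \<alpha> i j
    unfolding staircase2_iff[OF p_pos finite_lessThan finite_subset[OF that(1) finite_lessThan]]
    using conjunct2[OF ZC] that by blast
  ultimately show "A \<in> Lset N M p" using conjunct1[OF ZC] unfolding Lset_def by blast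
qed

lemma LsetI:
  assumes "\<And>\<alpha> k x i j. \<not> (\<alpha> \<subseteq> {..<N} \<and> k \<in> cube {..<N} \<and> x \<in> cube \<alpha> \<and> i < M \<and> j < M) \<Longrightarrow> A \<alpha> k x i j = 0"
   and "\<And>\<alpha> k x k' x' i j. \<alpha> \<subseteq> {..<N} \<Longrightarrow> k \<in> cube {..<N} \<Longrightarrow> k' \<in> cube {..<N} \<Longrightarrow> x \<in> cube \<alpha> \<Longrightarrow> x' \<in> cube \<alpha>
        \<Longrightarrow> i < M \<Longrightarrow> j < M \<Longrightarrow> cl p {..<N} k = cl p {..<N} k' \<Longrightarrow> cl p \<alpha> x = cl p \<alpha> x' \<Longrightarrow> A \<alpha> k x i j = A \<alpha> k' x' i j"
  shows "A \<in> Lset N M p"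
  unfolding Lset_iff using assms by blast

lemma Lset_outside:
  "A \<in> Lset N M p \<Longrightarrow> \<not> (\<alpha> \<subseteq> {..<N} \<and> k \<in> cube {..<N} \<and> x \<in> cube \<alpha> \<and> i < M \<and> j < M) \<Longrightarrow> A \<alpha> k x i j = 0"
  unfolding Lset_iff by blast

text \<open>The set \<alpha> and the indices are unrestricted, since both sides vanish out of range.
  This is the workhorse for moving the arguments of a coefficient to the corner of a cell.\<close>

lemma Lset_cell:
  assumes "A \<in> Lset N M p" "k \<in> cube {..<N}" "k' \<in> cube {..<N}" "x \<in> cube \<alpha>" "x' \<in> cube \<alpha>"
    "cl p {..<N} k = cl p {..<N} k'" "cl p \<alpha> x = cl p \<alpha> x'"
  shows "A \<alpha> k x i j = A \<alpha> k' x' i j"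
proof (cases "\<alpha> \<subseteq> {..<N} \<and> i < M \<and> j < M")
  case True
  then show ?thesis using assms unfolding Lset_iff by blast
next
  case False
  then show ?thesis using Lset_outside[OF assms(1)] by metis
qed

lemma Lset_eqI:
  assumes "A \<in> Lset N M p" "B \<in> Lset N M p"
    and "\<And>\<alpha> k x i j. \<alpha> \<subseteq> {..<N} \<Longrightarrow> k \<in> cube {..<N} \<Longrightarrow> x \<in> cube \<alpha> \<Longrightarrow> i < M \<Longrightarrow> j < M \<Longrightarrow> A \<alpha> k x i j = B \<alpha> k x i j"
  shows "A = B"
proof (intro ext)
  fix \<alpha> k x i j
  show "A \<alpha> k x i j = B \<alpha> k x i j"
    using assms Lset_outside[OF assms(1)] Lset_outside[OF assms(2)] by metis
qed

lemma idL_Lset: "idL N M \<in> Lset N M p"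
  by (rule LsetI) (auto simp: idL_def)

lemma linL_Lset: "A \<in> Lset N M p \<Longrightarrow> B \<in> Lset N M p \<Longrightarrow> linL c A d B \<in> Lset N M p"
proof (rule LsetI)
  fix \<alpha> k x k' x' i j
  assume A: "A \<in> Lset N M p" and B: "B \<in> Lset N M p" and a: "k \<in> cube {..<N}" "k' \<in> cube {..<N}" "x \<in> cube \<alpha>"
    "x' \<in> cube \<alpha>" "cl p {..<N} k = cl p {..<N} k'" "cl p \<alpha> x = cl p \<alpha> x'"
  show "linL c A d B \<alpha> k x i j = linL c A d B \<alpha> k' x' i j"
    using Lset_cell[OF A a] Lset_cell[OF B a] by (simp add: linL_def)
next
  fix \<alpha> k x i j
  assume "A \<in> Lset N M p" "B \<in> Lset N M p"
    "\<not> (\<alpha> \<subseteq> {..<N} \<and> k \<in> cube {..<N} \<and> x \<in> cube \<alpha> \<and> i < M \<and> j < M)"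
  then show "linL c A d B \<alpha> k x i j = 0"
    using Lset_outside[of A \<alpha> k x i j] Lset_outside[of B \<alpha> k x i j] by (simp add: linL_def)
qed

definition J :: "nat set \<Rightarrow> ((nat \<Rightarrow> nat) \<times> nat) set" where
  "J \<alpha> = cells p \<alpha> \<times> {..<M}"

definition h :: complex where "h = of_real (1 / real p)"

text \<open>The matrix of the sum of the components below \<open>\<alpha>\<close> acting on functions that are staircase
  in the variables of \<open>\<alpha>\<close> and have zero mean on cells in each remaining variable.\<close>
definition phi :: "nat set \<Rightarrow> pt \<Rightarrow> opL \<Rightarrow> (nat \<Rightarrow> nat) \<times> nat \<Rightarrow> (nat \<Rightarrow> nat) \<times> nat \<Rightarrow> complex" where
  "phi \<alpha> k A = (\<lambda>(d', m') (d, m). \<Sum>\<beta>\<in>Pow \<alpha>. if \<forall>i\<in>\<alpha> - \<beta>. d' i = d i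
      then h ^ card \<beta> * A \<beta> (merge k (cellpt p d') \<alpha>) (cellpt p d) m' m else 0)"

lemma h_nonzero: "h \<noteq> 0" using p_pos by (simp add: h_def)

lemma finite_J: "\<alpha> \<subseteq> {..<N} \<Longrightarrow> finite (J \<alpha>)"
  unfolding J_def using finite_cells[of \<alpha> p] finite_subset[of \<alpha>] by auto

lemma phi_cell_cong:
  assumes A: "A \<in> Lset N M p" and \<alpha>: "\<alpha> \<subseteq> {..<N}" and k: "k \<in> cube ({..<N} - \<alpha>)" "k' \<in> cube ({..<N} - \<alpha>)"
    and cl: "cl p ({..<N} - \<alpha>) k = cl p ({..<N} - \<alpha>) k'" and ab: "a \<in> J \<alpha>" "b \<in> J \<alpha>"
  shows "phi \<alpha> k A a b = phi \<alpha> k' A a b"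
proof -
  obtain d' m' d m where [simp]: "a = (d', m')" "b = (d, m)" by (cases a, cases b)
  have d: "d' \<in> cells p \<alpha>" "d \<in> cells p \<alpha>" using ab by (auto simp: J_def)
  have "A \<beta> (merge k (cellpt p d') \<alpha>) (cellpt p d) m' m = A \<beta> (merge k' (cellpt p d') \<alpha>) (cellpt p d) m' m" for \<beta>
    using k cl cellpt_in_cube[OF p_pos d(1)] cellpt_in_cube[OF p_pos d(2)]
    by (intro Lset_cell[OF A] merge_cube cl_merge_cong) auto
  then show ?thesis unfolding phi_def by (simp cong: if_cong)
qed

lemma phi_linear:
  "phi \<alpha> k (\<lambda>\<beta> k x i j. c * A \<beta> k x i j + d * B \<beta> k x i j) a b = c * phi \<alpha> k A a b + d * phi \<alpha> k B a b"
proof -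
  obtain d1 m1 d2 m2 where [simp]: "a = (d1, m1)" "b = (d2, m2)" by (cases a, cases b)
  show ?thesis
    unfolding phi_def \<open>a = _\<close> \<open>b = _\<close> prod.case sum_distrib_left sum.distrib[symmetric]
    by (rule sum.cong[OF refl]) (simp split: if_split add: algebra_simps)
qed

text \<open>Isolates the top component: for \<beta> = \<gamma> the matching condition is void, and
  the corners can be replaced by the points \<open>k\<close> and \<open>x\<close> in the same cells.
  Reading the equation backwards recovers \<open>C \<gamma>\<close> from the block and the
  components on proper subsets.\<close>

lemma phi_split:
  assumes C: "C \<in> Lset N M p" and \<gamma>: "\<gamma> \<subseteq> {..<N}" and k: "k \<in> cube {..<N}" and x: "x \<in> cube \<gamma>"
  shows "phi \<gamma> k C (cl p \<gamma> k, i) (cl p \<gamma> x, j) = (\<Sum>\<beta>\<in>Pow \<gamma> - {\<gamma>}. if \<forall>l\<in>\<gamma> - \<beta>. cl p \<gamma> k l = cl p \<gamma> x l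
      then h ^ card \<beta> * C \<beta> (merge k (cellpt p (cl p \<gamma> k)) \<gamma>) (cellpt p (cl p \<gamma> x)) i j else 0)
       + h ^ card \<gamma> * C \<gamma> k x i j"
proof -
  let ?d' = "cl p \<gamma> k" and ?d = "cl p \<gamma> x"
  have kg: "k \<in> cube \<gamma>" "k \<in> cube ({..<N} - \<gamma>)" using k \<gamma> by (auto simp: cube_def)
  have d: "?d' \<in> cells p \<gamma>" "?d \<in> cells p \<gamma>" using kg x by (auto intro: cl_in_cells p_pos)
  have fin: "finite (Pow \<gamma>)" using \<gamma> finite_subset by auto
  have "C \<gamma> (merge k (cellpt p ?d') \<gamma>) (cellpt p ?d) i j = C \<gamma> k x i j"
  proof (rule Lset_cell[OF C])
    show "merge k (cellpt p ?d') \<gamma> \<in> cube {..<N}"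
      using kg cellpt_in_cube[OF p_pos d(1)] by (intro merge_cube)
    show "cl p {..<N} (merge k (cellpt p ?d') \<gamma>) = cl p {..<N} k"
      using cl_cellpt[OF p_pos, of \<gamma> ?d'] unfolding cl_eq_iff
      by (auto simp: merge_def cl_def cres_def fun_eq_iff split: if_splits)
    show "cl p \<gamma> (cellpt p ?d) = cl p \<gamma> x" by (simp add: cl_cellpt[OF p_pos] cres_cl)
  qed (use k x cellpt_in_cube[OF p_pos d(2)] in auto)
  then show ?thesis
    unfolding phi_def using fin by (simp add: sum.remove[of "Pow \<gamma>" \<gamma>])
qed

lemma phi_determines_component:
  assumes A: "A \<in> Lset N M p" and B: "B \<in> Lset N M p" and \<gamma>: "\<gamma> \<subseteq> {..<N}"
    and below: "\<And>\<beta>. \<beta> \<subset> \<gamma> \<Longrightarrow> A \<beta> = B \<beta>"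
    and eq: "\<And>k a b. k \<in> cube ({..<N} - \<gamma>) \<Longrightarrow> a \<in> J \<gamma> \<Longrightarrow> b \<in> J \<gamma> \<Longrightarrow> phi \<gamma> k A a b = phi \<gamma> k B a b"
  shows "A \<gamma> = B \<gamma>"
proof (intro ext)
  fix k x i j
  show "A \<gamma> k x i j = B \<gamma> k x i j"
  proof (cases "k \<in> cube {..<N} \<and> x \<in> cube \<gamma> \<and> i < M \<and> j < M")
    case False
    then show ?thesis using Lset_outside[OF A] Lset_outside[OF B] by metis
  next
    case True
    let ?d' = "cl p \<gamma> k" and ?d = "cl p \<gamma> x"
    have kg: "k \<in> cube \<gamma>" "k \<in> cube ({..<N} - \<gamma>)" using True \<gamma> by (auto simp: cube_def)
    have d: "?d' \<in> cells p \<gamma>" "?d \<in> cells p \<gamma>" using kg True by (auto intro: cl_in_cells p_pos)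
    have phi: "phi \<gamma> k C (?d', i) (?d, j) = (\<Sum>\<beta>\<in>Pow \<gamma> - {\<gamma>}. if \<forall>l\<in>\<gamma> - \<beta>. ?d' l = ?d l
      then h ^ card \<beta> * C \<beta> (merge k (cellpt p ?d') \<gamma>) (cellpt p ?d) i j else 0)
       + h ^ card \<gamma> * C \<gamma> k x i j" if C: "C \<in> Lset N M p" for C
      using True by (intro phi_split[OF C \<gamma>]) auto
    have "phi \<gamma> k A (?d', i) (?d, j) = phi \<gamma> k B (?d', i) (?d, j)"
      using eq kg d True by (simp add: J_def)
    moreover have "(\<Sum>\<beta>\<in>Pow \<gamma> - {\<gamma>}. if \<forall>l\<in>\<gamma> - \<beta>. ?d' l = ?d l
      then h ^ card \<beta> * A \<beta> (merge k (cellpt p ?d') \<gamma>) (cellpt p ?d) i j else 0)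
      = (\<Sum>\<beta>\<in>Pow \<gamma> - {\<gamma>}. if \<forall>l\<in>\<gamma> - \<beta>. ?d' l = ?d l
      then h ^ card \<beta> * B \<beta> (merge k (cellpt p ?d') \<gamma>) (cellpt p ?d) i j else 0)"
    proof (rule sum.cong[OF refl])
      fix \<beta> assume "\<beta> \<in> Pow \<gamma> - {\<gamma>}"
      then have "A \<beta> = B \<beta>" using below by auto
      then show "(if \<forall>l\<in>\<gamma> - \<beta>. ?d' l = ?d l
        then h ^ card \<beta> * A \<beta> (merge k (cellpt p ?d') \<gamma>) (cellpt p ?d) i j else 0) = (if \<forall>l\<in>\<gamma> - \<beta>. ?d' l = ?d l
        then h ^ card \<beta> * B \<beta> (merge k (cellpt p ?d') \<gamma>) (cellpt p ?d) i j else 0)" by simp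
    qed
    ultimately show ?thesis using phi[OF A] phi[OF B] h_nonzero by simp
  qed
qed

text \<open>The blocks form a triangular system for the components with nonzero diagonal weight
  \<open>h ^ card \<gamma>\<close>, which is solved upwards in the cardinality of \<gamma>.\<close>

lemma phi_injective:
  assumes A: "A \<in> Lset N M p" and B: "B \<in> Lset N M p"
    and eq: "\<And>\<gamma> k a b. \<gamma> \<subseteq> {..<N} \<Longrightarrow> k \<in> cube ({..<N} - \<gamma>) \<Longrightarrow> a \<in> J \<gamma> \<Longrightarrow> b \<in> J \<gamma> \<Longrightarrow> phi \<gamma> k A a b = phi \<gamma> k B a b"
  shows "A = B"
proof -
  have "A \<gamma> = B \<gamma>" if "\<gamma> \<subseteq> {..<N}" for \<gamma>
    using that
  proof (induction "card \<gamma>" arbitrary: \<gamma> rule: less_induct)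
    case less
    have "finite \<gamma>" using less.prems finite_subset by auto
    then show ?case
    proof (intro phi_determines_component[OF A B less.prems _ eq[OF less.prems]])
      show "A \<beta> = B \<beta>" if "\<beta> \<subset> \<gamma>" for \<beta>
        using less.hyps[OF psubset_card_mono[OF \<open>finite \<gamma>\<close> that]] less.prems that by blast
    qed
  qed
  then show ?thesis by (intro Lset_eqI[OF A B]) auto
qed

lemma phi_id:
  assumes \<gamma>: "\<gamma> \<subseteq> {..<N}" and k: "k \<in> cube ({..<N} - \<gamma>)" and ab: "a \<in> J \<gamma>" "b \<in> J \<gamma>"
  shows "phi \<gamma> k (idL N M) a b = (if a = b then 1 else 0)"
proof -
  obtain d' m' d m where [simp]: "a = (d', m')" "b = (d, m)" by (cases a, cases b)
  have d: "d' \<in> cells p \<gamma>" "d \<in> cells p \<gamma>" using ab by (auto simp: J_def)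
  have fin: "finite (Pow \<gamma>)" using \<gamma> finite_subset by auto
  have c: "merge k (cellpt p d') \<gamma> \<in> cube {..<N}"
    using k cellpt_in_cube[OF p_pos d(1)] by (intro merge_cube)
  have dd: "(\<forall>i\<in>\<gamma>. d' i = d i) \<longleftrightarrow> d' = d" using d by (rule cells_eq_iff)
  have "phi \<gamma> k (idL N M) a b = (\<Sum>\<beta>\<in>Pow \<gamma>. if \<beta> = {} then if \<forall>i\<in>\<gamma>. d' i = d i then idL N M {} (merge k (cellpt p d') \<gamma>) (cellpt p d) m' m else 0 else 0)"
    unfolding phi_def by (auto intro!: sum.cong simp: idL_def)
  also have "\<dots> = (if a = b then 1 else 0)"
    using fin c ab by (auto simp: idL_def dd J_def)
  finally show ?thesis .
qed

text \<open>The shape of a single factor. For \<alpha> = {} the component at {} is itself the factor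
  and is left free; for all other \<alpha> it has to be that of the identity.\<close>

definition elementary :: "nat set \<Rightarrow> opL \<Rightarrow> bool" where
  "elementary \<alpha> A \<longleftrightarrow> A \<in> Lset N M p \<and> (\<alpha> \<noteq> {} \<longrightarrow> A {} = idL N M {}) \<and> (\<forall>\<beta>. \<beta> \<noteq> {} \<and> \<beta> \<noteq> \<alpha> \<longrightarrow> A \<beta> = zeroL)"

lemma phi_elementary_not_subset:
  assumes e: "elementary \<alpha> A" and \<gamma>: "\<gamma> \<subseteq> {..<N}" and n: "\<not> \<alpha> \<subseteq> \<gamma>"
  shows "phi \<gamma> k A a b = phi \<gamma> k (idL N M) a b"
proof -
  have "A \<beta> = idL N M \<beta>" if "\<beta> \<in> Pow \<gamma>" for \<beta>
    using that e n by (cases "\<beta> = {}") (auto simp: elementary_def zeroL_def idL_def fun_eq_iff)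
  then show ?thesis unfolding phi_def by (auto intro!: sum.cong split: prod.split)
qed

text \<open>The variables in \<gamma> - \<alpha> are spectators: neither the component at {} nor the
  one at \<alpha> integrates over them. The block is therefore diagonal in their cells, and they
  enter the smaller block as frozen parameters through \<open>merge\<close>.\<close>

lemma phi_elementary_subset:
  assumes e: "elementary \<alpha> A" and \<gamma>: "\<gamma> \<subseteq> {..<N}" and n: "\<alpha> \<subseteq> \<gamma>" and k: "k \<in> cube ({..<N} - \<gamma>)"
    and d: "d' \<in> cells p \<gamma>" "d \<in> cells p \<gamma>"
  shows "phi \<gamma> k A (d', i) (d, j) =
    (if \<forall>l\<in>\<gamma> - \<alpha>. d' l = d l then phi \<alpha> (merge k (cellpt p d') (\<gamma> - \<alpha>)) A (cres d' \<alpha>, i) (cres d \<alpha>, j) else 0)"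
proof -
  have A: "A \<in> Lset N M p" using e by (simp add: elementary_def)
  have fin: "finite (Pow \<gamma>)" "finite (Pow \<alpha>)" using \<gamma> n finite_subset[of _ "{..<N}"] by auto
  let ?t = "\<lambda>\<beta>. h ^ card \<beta> * A \<beta> (merge k (cellpt p d') \<gamma>) (cellpt p d) i j"
  have mm: "merge (merge k (cellpt p d') (\<gamma> - \<alpha>)) (cellpt p (cres d' \<alpha>)) \<alpha> = merge k (cellpt p d') \<gamma>"
    using n by (auto simp: merge_def cellpt_def cres_def fun_eq_iff)
  have AA: "A \<beta> (merge k (cellpt p d') \<gamma>) (cellpt p (cres d \<alpha>)) i j = A \<beta> (merge k (cellpt p d') \<gamma>) (cellpt p d) i j"
    if "\<beta> \<subseteq> \<alpha>" for \<beta>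
  proof (rule Lset_cell[OF A])
    show "merge k (cellpt p d') \<gamma> \<in> cube {..<N}" using k cellpt_in_cube[OF p_pos d(1)] by (intro merge_cube)
    then show "merge k (cellpt p d') \<gamma> \<in> cube {..<N}" .
    show "cl p \<beta> (cellpt p (cres d \<alpha>)) = cl p \<beta> (cellpt p d)"
      using that by (auto simp: cl_cellpt[OF p_pos] cres_def fun_eq_iff)
    show "cellpt p (cres d \<alpha>) \<in> cube \<beta>" using cellpt_in_cube[OF p_pos cres_in_cells[OF d(2) n]] .
    show "cellpt p d \<in> cube \<beta>" using cellpt_in_cube[OF p_pos d(2)] .
  qed simp
  have z: "A \<beta> k x i j = 0" if "\<beta> \<noteq> {}" "\<beta> \<noteq> \<alpha>" for \<beta> k x i j
    using e that by (auto simp: elementary_def zeroL_def)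
  have "phi \<gamma> k A (d', i) (d, j) = (\<Sum>\<beta>\<in>Pow \<gamma>. if \<forall>l\<in>\<gamma> - \<beta>. d' l = d l then ?t \<beta> else 0)"
    by (simp add: phi_def)
  also have "\<dots> = (\<Sum>\<beta>\<in>Pow \<alpha>. if \<forall>l\<in>\<gamma> - \<beta>. d' l = d l then ?t \<beta> else 0)"
  proof (rule sum.mono_neutral_right[OF fin(1)])
    show "\<forall>\<beta>\<in>Pow \<gamma> - Pow \<alpha>. (if \<forall>l\<in>\<gamma> - \<beta>. d' l = d l then ?t \<beta> else 0) = 0"
    proof
      fix \<beta> assume "\<beta> \<in> Pow \<gamma> - Pow \<alpha>"
      then have "\<beta> \<noteq> {}" "\<beta> \<noteq> \<alpha>" by auto
      then show "(if \<forall>l\<in>\<gamma> - \<beta>. d' l = d l then ?t \<beta> else 0) = 0" by (simp add: z)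
    qed
  qed (use n in auto)
  also have "\<dots> = (\<Sum>\<beta>\<in>Pow \<alpha>. if \<forall>l\<in>\<gamma> - \<alpha>. d' l = d l then if \<forall>l\<in>\<alpha> - \<beta>. d' l = d l then ?t \<beta> else 0 else 0)"
  proof (rule sum.cong[OF refl])
    fix \<beta> assume "\<beta> \<in> Pow \<alpha>"
    then have "\<gamma> - \<beta> = (\<gamma> - \<alpha>) \<union> (\<alpha> - \<beta>)" using n by blast
    then show "(if \<forall>l\<in>\<gamma> - \<beta>. d' l = d l then ?t \<beta> else 0) =
      (if \<forall>l\<in>\<gamma> - \<alpha>. d' l = d l then if \<forall>l\<in>\<alpha> - \<beta>. d' l = d l then ?t \<beta> else 0 else 0)"
      by (simp add: ball_Un)
  qed
  also have "\<dots> = (if \<forall>l\<in>\<gamma> - \<alpha>. d' l = d l then \<Sum>\<beta>\<in>Pow \<alpha>. if \<forall>l\<in>\<alpha> - \<beta>. d' l = d l then ?t \<beta> else 0 else 0)"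
  proof (cases "\<forall>l\<in>\<gamma> - \<alpha>. d' l = d l")
    case True
    show ?thesis unfolding if_P[OF True] ..
  next
    case False
    show ?thesis unfolding if_not_P[OF False] by (rule sum.neutral_const)
  qed
  also have "(\<Sum>\<beta>\<in>Pow \<alpha>. if \<forall>l\<in>\<alpha> - \<beta>. d' l = d l then ?t \<beta> else 0) =
     phi \<alpha> (merge k (cellpt p d') (\<gamma> - \<alpha>)) A (cres d' \<alpha>, i) (cres d \<alpha>, j)"
    unfolding phi_def prod.case mm
  proof (rule sum.cong[OF refl])
    fix \<beta> assume "\<beta> \<in> Pow \<alpha>"
    moreover have "(\<forall>l\<in>\<alpha> - \<beta>. cres d' \<alpha> l = cres d \<alpha> l) \<longleftrightarrow> (\<forall>l\<in>\<alpha> - \<beta>. d' l = d l)"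
      by (simp add: cres_def)
    ultimately show "(if \<forall>l\<in>\<alpha> - \<beta>. d' l = d l then ?t \<beta> else 0) = (if \<forall>l\<in>\<alpha> - \<beta>. cres d' \<alpha> l = cres d \<alpha> l
       then h ^ card \<beta> * A \<beta> (merge k (cellpt p d') \<gamma>) (cellpt p (cres d \<alpha>)) i j else 0)"
      using AA[of \<beta>] by simp
  qed
  finally show ?thesis .
qed

text \<open>Solves \<open>phi_split\<close> for an element of elementary shape with prescribed block
  \<open>X\<close> at \<alpha>: the identity is subtracted and the remainder is divided by the
  volume of a cell. For \<alpha> = {} the two identities cancel and \<open>X\<close> itself
  remains.\<close>

definition elemL :: "nat set \<Rightarrow> (pt \<Rightarrow> (nat \<Rightarrow> nat) \<times> nat \<Rightarrow> (nat \<Rightarrow> nat) \<times> nat \<Rightarrow> complex) \<Rightarrow> opL" where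
  "elemL \<alpha> X = (\<lambda>\<beta> k x i j. idL N M \<beta> k x i j + (if \<beta> = \<alpha> \<and> k \<in> cube {..<N} \<and> x \<in> cube \<alpha> \<and> i < M \<and> j < M
     then (X k (cl p \<alpha> k, i) (cl p \<alpha> x, j) - (if (cl p \<alpha> k, i) = (cl p \<alpha> x, j) then 1 else 0)) / h ^ card \<alpha> else 0))"

context
  fixes \<alpha> and X :: "pt \<Rightarrow> (nat \<Rightarrow> nat) \<times> nat \<Rightarrow> (nat \<Rightarrow> nat) \<times> nat \<Rightarrow> complex"
  assumes \<alpha>: "\<alpha> \<subseteq> {..<N}"
    and X: "\<And>k k' a b. k \<in> cube ({..<N} - \<alpha>) \<Longrightarrow> k' \<in> cube ({..<N} - \<alpha>) \<Longrightarrow>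
       cl p ({..<N} - \<alpha>) k = cl p ({..<N} - \<alpha>) k' \<Longrightarrow> a \<in> J \<alpha> \<Longrightarrow> b \<in> J \<alpha> \<Longrightarrow> X k a b = X k' a b"
begin

lemma elem_elementary: "elementary \<alpha> (elemL \<alpha> X)"
proof -
  have "elemL \<alpha> X \<in> Lset N M p"
  proof (rule LsetI)
    fix \<beta> k x k' x' i j
    assume a: "\<beta> \<subseteq> {..<N}" "k \<in> cube {..<N}" "k' \<in> cube {..<N}" "x \<in> cube \<beta>" "x' \<in> cube \<beta>"
      "i < M" "j < M" "cl p {..<N} k = cl p {..<N} k'" "cl p \<beta> x = cl p \<beta> x'"
    have c: "cl p S k = cl p S k'" if "S \<subseteq> {..<N}" for S using a(8) cres_cl[OF that] by metis
    have "X k (cl p \<alpha> k, i) (cl p \<alpha> x, j) = X k' (cl p \<alpha> k', i) (cl p \<alpha> x', j)" if "\<beta> = \<alpha>"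
      unfolding c[OF \<alpha>] a(9)[unfolded that]
      using a that c[of "{..<N} - \<alpha>"] cube_mono[OF a(2)] cube_mono[OF a(3)] \<alpha>
      by (intro X) (auto simp: J_def intro!: cl_in_cells p_pos)
    then show "elemL \<alpha> X \<beta> k x i j = elemL \<alpha> X \<beta> k' x' i j"
      using a c[OF \<alpha>] by (auto simp: elemL_def idL_def)
  qed (use \<alpha> in \<open>auto simp: elemL_def idL_def\<close>)
  then show ?thesis by (auto simp: elementary_def elemL_def idL_def zeroL_def fun_eq_iff)
qed

lemma phi_elem:
  assumes k: "k \<in> cube ({..<N} - \<alpha>)" and ab: "a \<in> J \<alpha>" "b \<in> J \<alpha>"
  shows "phi \<alpha> k (elemL \<alpha> X) a b = X k a b"
proof -
  obtain d' m' d m where [simp]: "a = (d', m')" "b = (d, m)" by (cases a, cases b)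
  have d: "d' \<in> cells p \<alpha>" "d \<in> cells p \<alpha>" and m: "m' < M" "m < M" using ab by (auto simp: J_def)
  have fin: "finite (Pow \<alpha>)" using \<alpha> finite_subset by auto
  let ?K = "merge k (cellpt p d') \<alpha>"
  let ?Y = "\<lambda>\<beta> k x i j. if \<beta> = \<alpha> \<and> k \<in> cube {..<N} \<and> x \<in> cube \<alpha> \<and> i < M \<and> j < M
     then (X k (cl p \<alpha> k, i) (cl p \<alpha> x, j) - (if (cl p \<alpha> k, i) = (cl p \<alpha> x, j) then 1 else 0)) / h ^ card \<alpha> else 0"
  have K: "?K \<in> cube {..<N}" using k cellpt_in_cube[OF p_pos d(1)] by (intro merge_cube)
  have "phi \<alpha> k (elemL \<alpha> X) a b = phi \<alpha> k (idL N M) a b + phi \<alpha> k ?Y a b"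
    using phi_linear[of \<alpha> k 1 "idL N M" 1 ?Y a b] by (simp add: elemL_def)
  also have "phi \<alpha> k ?Y a b = (\<Sum>\<beta>\<in>Pow \<alpha>. if \<beta> = \<alpha> then h ^ card \<alpha> * ?Y \<alpha> ?K (cellpt p d) m' m else 0)"
    unfolding phi_def by (auto intro!: sum.cong)
  also have "\<dots> = h ^ card \<alpha> * ?Y \<alpha> ?K (cellpt p d) m' m"
    using fin by simp
  also have "\<dots> = X ?K a b - (if a = b then 1 else 0)"
    using K cellpt_in_cube[OF p_pos d(2)] m h_nonzero d
    by (simp add: cl_merge_in cl_cellpt[OF p_pos])
  also have "X ?K a b = X k a b"
    using k cube_mono[OF K, of "{..<N} - \<alpha>"] ab
    by (intro X) (simp_all only: cl_merge_off Diff_disjoint Int_commute Diff_subset)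
  finally show ?thesis unfolding phi_id[OF \<alpha> k ab] by simp
qed

end

lemma det_phi_elementary:
  assumes e: "elementary \<alpha> A" and \<gamma>: "\<gamma> \<subseteq> {..<N}" and n: "\<alpha> \<subseteq> \<gamma>" and k: "k \<in> cube ({..<N} - \<gamma>)"
  shows "det_on (J \<gamma>) (phi \<gamma> k A) =
    (\<Prod>d\<in>cells p (\<gamma> - \<alpha>). det_on (J \<alpha>) (phi \<alpha> (merge k (cellpt p d) (\<gamma> - \<alpha>)) A))"
proof -
  have fin: "finite \<alpha>" "finite \<gamma>" using \<gamma> n finite_subset[of _ "{..<N}"] by auto
  let ?f = "\<lambda>(d, e, m). (cmerge d e \<alpha>, m) :: (nat \<Rightarrow> nat) \<times> nat"
  have bij: "bij_betw ?f (cells p (\<gamma> - \<alpha>) \<times> J \<alpha>) (J \<gamma>)"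
  proof -
    have "inj_on ?f (cells p (\<gamma> - \<alpha>) \<times> J \<alpha>)"
    proof (rule inj_onI)
      fix x y assume x: "x \<in> cells p (\<gamma> - \<alpha>) \<times> J \<alpha>" and y: "y \<in> cells p (\<gamma> - \<alpha>) \<times> J \<alpha>" and e: "?f x = ?f y"
      obtain d1 e1 m1 where [simp]: "x = (d1, e1, m1)" by (cases x rule: prod_cases3)
      obtain d2 e2 m2 where [simp]: "y = (d2, e2, m2)" by (cases y rule: prod_cases3)
      have "(d1, e1) = (d2, e2)"
        using x y e by (intro inj_onD[OF bij_betw_imp_inj_on[OF bij_cmerge[OF n, of p]]]) (auto simp: J_def)
      then show "x = y" using e by simp
    qed
    moreover have "?f ` (cells p (\<gamma> - \<alpha>) \<times> J \<alpha>) = J \<gamma>"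
    proof -
      have "?f ` (cells p (\<gamma> - \<alpha>) \<times> J \<alpha>) = (\<lambda>(d, e). cmerge d e \<alpha>) ` (cells p (\<gamma> - \<alpha>) \<times> cells p \<alpha>) \<times> {..<M}"
        by (force simp: J_def)
      then show ?thesis using bij_betw_imp_surj_on[OF bij_cmerge[OF n, of p]] by (simp add: J_def)
    qed
    ultimately show ?thesis by (simp add: bij_betw_def)
  qed
  have "det_on (J \<gamma>) (phi \<gamma> k A) = det_on (cells p (\<gamma> - \<alpha>) \<times> J \<alpha>) (\<lambda>i j. phi \<gamma> k A (?f i) (?f j))"
    using fin \<gamma> n by (intro det_on_reindex[OF bij]) (auto intro!: finite_cells finite_J)
  also have "\<dots> = det_on (cells p (\<gamma> - \<alpha>) \<times> J \<alpha>)
     (\<lambda>(d', a) (d, b). if d' = d then phi \<alpha> (merge k (cellpt p d) (\<gamma> - \<alpha>)) A a b else 0)"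
  proof (rule det_on_cong)
    fix i j assume ij: "i \<in> cells p (\<gamma> - \<alpha>) \<times> J \<alpha>" "j \<in> cells p (\<gamma> - \<alpha>) \<times> J \<alpha>"
    obtain d' e'' m' where [simp]: "i = (d', e'', m')" by (cases i rule: prod_cases3)
    obtain d e' m where [simp]: "j = (d, e', m)" by (cases j rule: prod_cases3)
    have m: "cmerge d' e'' \<alpha> \<in> cells p \<gamma>" "cmerge d e' \<alpha> \<in> cells p \<gamma>"
      using ij cmerge_in_cells[OF _ _ n] by (auto simp: J_def)
    have a1: "(\<forall>l\<in>\<gamma> - \<alpha>. cmerge d' e'' \<alpha> l = cmerge d e' \<alpha> l) \<longleftrightarrow> d' = d"
      using ij cells_eq_iff[of d' p "\<gamma> - \<alpha>" d] by (simp add: cmerge_def)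
    have a2: "cres (cmerge d' e'' \<alpha>) \<alpha> = e''" "cres (cmerge d e' \<alpha>) \<alpha> = e'"
      using ij by (auto simp: J_def cres_cmerge)
    have a3: "merge k (cellpt p (cmerge d' e'' \<alpha>)) (\<gamma> - \<alpha>) = merge k (cellpt p d') (\<gamma> - \<alpha>)"
      by (auto simp: merge_def cellpt_def cmerge_def)
    show "phi \<gamma> k A (?f i) (?f j) = (\<lambda>(d', a) (d, b). if d' = d then phi \<alpha> (merge k (cellpt p d) (\<gamma> - \<alpha>)) A a b else 0) i j"
      using phi_elementary_subset[OF e \<gamma> n k m, of m' m] unfolding a1 a2 a3 by simp
  qed
  also have "\<dots> = (\<Prod>d\<in>cells p (\<gamma> - \<alpha>). det_on (J \<alpha>) (phi \<alpha> (merge k (cellpt p d) (\<gamma> - \<alpha>)) A))"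
    using fin \<gamma> n by (intro det_on_block_diagonal) (auto intro!: finite_cells finite_J)
  finally show ?thesis .
qed

end

section \<open>Product measures on cubes\<close>

lemma emeasure_unitI_cell:
  assumes "0 \<le> a" "a \<le> b" "b \<le> 1"
  shows "emeasure unitI {a..<b} = ennreal (b - a)"
  unfolding unitI_def using assms by (subst emeasure_restrict_space) auto

lemma space_unitI [simp]: "space unitI = {0..<1}"
  by (simp add: unitI_def space_restrict_space)

lemma prob_space_unitI: "prob_space unitI"
  by (rule prob_spaceI) (use emeasure_unitI_cell[of 0 1] in simp)

interpretation unitI: prob_space unitI by (rule prob_space_unitI)

interpretation cub: product_sigma_finite "\<lambda>_::nat. unitI"
  by standard

lemma prob_space_cubeM: "prob_space (cubeM S)"
  unfolding cubeM_def by (rule prob_space_PiM) (rule prob_space_unitI)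

lemma sigma_finite_cubeM: "sigma_finite_measure (cubeM S)"
  using prob_space_cubeM prob_space_imp_sigma_finite by blast

lemma pair_sigma_finite_cubeM: "pair_sigma_finite (cubeM S) (cubeM T)"
  using sigma_finite_cubeM by (simp add: pair_sigma_finite_def)

lemma space_cubeM: "space (cubeM S) = S \<rightarrow>\<^sub>E {0..<1}"
  by (simp add: cubeM_def space_PiM)

lemma cubeM_in_cube: "x \<in> space (cubeM S) \<Longrightarrow> x \<in> cube S"
  by (auto simp: space_cubeM cube_def PiE_def Pi_def)

lemma measurable_merge_cubeM [measurable]:
  "(\<lambda>z. merge (fst z) (snd z) T) \<in> cubeM S \<Otimes>\<^sub>M cubeM T \<rightarrow>\<^sub>M cubeM (S \<union> T)"
proof -
  have "(\<lambda>z. \<lambda>i\<in>S \<union> T. if i \<in> T then snd z i else fst z i) \<in> cubeM S \<Otimes>\<^sub>M cubeM T \<rightarrow>\<^sub>M cubeM (S \<union> T)"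
    unfolding cubeM_def
  proof (rule measurable_restrict)
    fix i assume i: "i \<in> S \<union> T"
    show "(\<lambda>z. if i \<in> T then snd z i else fst z i) \<in> (\<Pi>\<^sub>M i\<in>S. unitI) \<Otimes>\<^sub>M (\<Pi>\<^sub>M i\<in>T. unitI) \<rightarrow>\<^sub>M unitI"
      using i by (cases "i \<in> T") (auto intro!: measurable_compose[OF measurable_snd measurable_component_singleton]
        measurable_compose[OF measurable_fst measurable_component_singleton])
  qed
  then show ?thesis
  \<comment> \<open>On the product space both arguments are \<open>undefined\<close> outside their
    index sets, so \<open>merge\<close> already coincides there with its restriction to S \<union>
    T.\<close>
  proof (rule measurable_cong[THEN iffD1, rotated])
    fix z assume "z \<in> space (cubeM S \<Otimes>\<^sub>M cubeM T)"
    then show "(\<lambda>i\<in>S \<union> T. if i \<in> T then snd z i else fst z i) = merge (fst z) (snd z) T"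
      by (auto simp: space_pair_measure space_cubeM merge_def fun_eq_iff PiE_def extensional_def)
  qed
qed

text \<open>The index sets may overlap. Coordinates of \<open>S\<close> that lie in \<open>T\<close>
  are overwritten and integrate out with mass 1, because every factor is a probability space. One
  lemma thus serves both genuine splittings of variables and sections of the whole cube, where
  \<open>T\<close> is a subset of \<open>S\<close>.\<close>

lemma distr_merge_cubeM:
  assumes S: "finite S" and T: "finite T"
  shows "distr (cubeM S \<Otimes>\<^sub>M cubeM T) (cubeM (S \<union> T)) (\<lambda>z. merge (fst z) (snd z) T) = cubeM (S \<union> T)"
  unfolding cubeM_def[of "S \<union> T"]
proof (rule cub.PiM_eqI)
  interpret TT: sigma_finite_measure "cubeM T" by (rule sigma_finite_cubeM)
  fix A :: "nat \<Rightarrow> real set" assume A: "\<And>i. i \<in> S \<union> T \<Longrightarrow> A i \<in> sets unitI"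
  \<comment> \<open>Overwritten coordinates of the first argument are unconstrained, so the preimage
    of a box is a box with the full interval in these places.\<close>
  let ?A = "\<lambda>i. if i \<in> T then {0..<1} else A i"
  have As: "A i \<subseteq> {0..<1}" if "i \<in> S \<union> T" for i using sets.sets_into_space[OF A[OF that]] by simp
  have sp: "{0..<1} \<in> sets unitI" using sets.top[of unitI] by simp
  have one: "emeasure unitI {0..<1} = 1" using unitI.emeasure_space_1 by simp
  have "emeasure (distr (cubeM S \<Otimes>\<^sub>M cubeM T) (PiM (S \<union> T) (\<lambda>_. unitI)) (\<lambda>z. merge (fst z) (snd z) T)) (Pi\<^sub>E (S \<union> T) A)
    = emeasure (cubeM S \<Otimes>\<^sub>M cubeM T) ((\<lambda>z. merge (fst z) (snd z) T) -` (Pi\<^sub>E (S \<union> T) A) \<inter> space (cubeM S \<Otimes>\<^sub>M cubeM T))"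
    using S T A measurable_merge_cubeM[of T S] by (intro emeasure_distr) (auto simp: cubeM_def)
  also have "(\<lambda>z. merge (fst z) (snd z) T) -` (Pi\<^sub>E (S \<union> T) A) \<inter> space (cubeM S \<Otimes>\<^sub>M cubeM T) = Pi\<^sub>E S ?A \<times> Pi\<^sub>E T A"
  proof (intro equalityI subsetI)
    fix z assume z: "z \<in> (\<lambda>z. merge (fst z) (snd z) T) -` (Pi\<^sub>E (S \<union> T) A) \<inter> space (cubeM S \<Otimes>\<^sub>M cubeM T)"
    then have zs: "fst z \<in> S \<rightarrow>\<^sub>E {0..<1}" "snd z \<in> T \<rightarrow>\<^sub>E {0..<1}"
      by (auto simp: space_pair_measure space_cubeM)
    have m: "merge (fst z) (snd z) T i \<in> A i" if "i \<in> S \<union> T" for i using z that by auto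
    have "fst z \<in> Pi\<^sub>E S ?A"
    proof (rule PiE_I)
      show "fst z i \<in> ?A i" if "i \<in> S" for i
        using m[of i] PiE_mem[OF zs(1) that] that by (cases "i \<in> T") (simp_all add: merge_def)
    qed (rule PiE_arb[OF zs(1)])
    moreover have "snd z \<in> Pi\<^sub>E T A"
    proof (rule PiE_I)
      show "snd z i \<in> A i" if "i \<in> T" for i
        using m[of i] that by (simp add: merge_def)
    qed (rule PiE_arb[OF zs(2)])
    ultimately show "z \<in> Pi\<^sub>E S ?A \<times> Pi\<^sub>E T A" by (cases z) auto
  next
    fix z assume "z \<in> Pi\<^sub>E S ?A \<times> Pi\<^sub>E T A"
    then have z: "fst z \<in> Pi\<^sub>E S ?A" "snd z \<in> Pi\<^sub>E T A" by auto
    have "fst z \<in> S \<rightarrow>\<^sub>E {0..<1}"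
    proof (rule PiE_I)
      show "fst z i \<in> {0..<1}" if "i \<in> S" for i
        using PiE_mem[OF z(1) that] As[of i] that by (cases "i \<in> T") auto
    qed (rule PiE_arb[OF z(1)])
    moreover have "snd z \<in> T \<rightarrow>\<^sub>E {0..<1}"
    proof (rule PiE_I)
      show "snd z i \<in> {0..<1}" if "i \<in> T" for i
        using PiE_mem[OF z(2) that] As[of i] that by blast
    qed (rule PiE_arb[OF z(2)])
    ultimately have "z \<in> space (cubeM S \<Otimes>\<^sub>M cubeM T)" by (cases z) (auto simp: space_pair_measure space_cubeM)
    moreover have "merge (fst z) (snd z) T \<in> Pi\<^sub>E (S \<union> T) A"
    proof (rule PiE_I)
      show "merge (fst z) (snd z) T i \<in> A i" if "i \<in> S \<union> T" for i
        using PiE_mem[OF z(1), of i] PiE_mem[OF z(2), of i] that by (auto simp: merge_def)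
      show "merge (fst z) (snd z) T i = undefined" if "i \<notin> S \<union> T" for i
        using PiE_arb[OF z(1), of i] that by (auto simp: merge_def)
    qed
    ultimately show "z \<in> (\<lambda>z. merge (fst z) (snd z) T) -` (Pi\<^sub>E (S \<union> T) A) \<inter> space (cubeM S \<Otimes>\<^sub>M cubeM T)" by simp
  qed
  also have "emeasure (cubeM S \<Otimes>\<^sub>M cubeM T) (Pi\<^sub>E S ?A \<times> Pi\<^sub>E T A) = emeasure (cubeM S) (Pi\<^sub>E S ?A) * emeasure (cubeM T) (Pi\<^sub>E T A)"
    using S T A sp by (intro TT.emeasure_pair_measure_Times) (auto simp: cubeM_def intro!: sets_PiM_I_finite)
  also have "emeasure (cubeM S) (Pi\<^sub>E S ?A) = (\<Prod>i\<in>S. if i \<in> T then 1 else emeasure unitI (A i))"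
    unfolding cubeM_def using S A sp one by (subst cub.emeasure_PiM) (auto intro!: prod.cong)
  also have "\<dots> = (\<Prod>i\<in>S - T. emeasure unitI (A i))"
    using S by (intro prod.mono_neutral_cong_right) auto
  also have "emeasure (cubeM T) (Pi\<^sub>E T A) = (\<Prod>i\<in>T. emeasure unitI (A i))"
    unfolding cubeM_def using T A by (subst cub.emeasure_PiM) auto
  also have "(\<Prod>i\<in>S - T. emeasure unitI (A i)) * (\<Prod>i\<in>T. emeasure unitI (A i)) = (\<Prod>i\<in>(S - T) \<union> T. emeasure unitI (A i))"
    using S T by (intro prod.union_disjoint[symmetric]) auto
  also have "(S - T) \<union> T = S \<union> T" by auto
  finally show "emeasure (distr (cubeM S \<Otimes>\<^sub>M cubeM T) (PiM (S \<union> T) (\<lambda>_. unitI)) (\<lambda>z. merge (fst z) (snd z) T)) (Pi\<^sub>E (S \<union> T) A)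
     = (\<Prod>i\<in>S \<union> T. emeasure unitI (A i))" .
qed (use S T in auto)

lemma integrable_merge:
  fixes f :: "pt \<Rightarrow> 'b::{banach, second_countable_topology}"
  assumes "finite S" "finite T" "integrable (cubeM (S \<union> T)) f"
  shows "integrable (cubeM S \<Otimes>\<^sub>M cubeM T) (\<lambda>(x, y). f (merge x y T))"
proof -
  have "integrable (distr (cubeM S \<Otimes>\<^sub>M cubeM T) (cubeM (S \<union> T)) (\<lambda>z. merge (fst z) (snd z) T)) f"
    using assms by (simp add: distr_merge_cubeM)
  then have "integrable (cubeM S \<Otimes>\<^sub>M cubeM T) (\<lambda>z. f (merge (fst z) (snd z) T))"
    by (rule integrable_distr[OF measurable_merge_cubeM])
  then show ?thesis by (simp add: case_prod_beta')
qed

lemma integral_merge: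
  fixes f :: "pt \<Rightarrow> 'b::{banach, second_countable_topology}"
  assumes "finite S" "finite T" "integrable (cubeM (S \<union> T)) f"
  shows "(\<integral>z. f z \<partial>cubeM (S \<union> T)) = (\<integral>x. \<integral>y. f (merge x y T) \<partial>cubeM T \<partial>cubeM S)"
proof -
  interpret pair_sigma_finite "cubeM S" "cubeM T" by (rule pair_sigma_finite_cubeM)
  have "(\<integral>z. f z \<partial>cubeM (S \<union> T)) = (\<integral>z. f z \<partial>distr (cubeM S \<Otimes>\<^sub>M cubeM T) (cubeM (S \<union> T)) (\<lambda>z. merge (fst z) (snd z) T))"
    using assms by (simp add: distr_merge_cubeM)
  also have "\<dots> = (\<integral>z. f (merge (fst z) (snd z) T) \<partial>(cubeM S \<Otimes>\<^sub>M cubeM T))"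
    using assms(3) by (intro integral_distr measurable_merge_cubeM) auto
  also have "\<dots> = (\<integral>x. \<integral>y. f (merge x y T) \<partial>cubeM T \<partial>cubeM S)"
    using integral_fst[OF integrable_merge[OF assms]] by (simp add: case_prod_beta')
  finally show ?thesis .
qed

lemma AE_merge:
  assumes "finite S" "finite T" "AE z in cubeM (S \<union> T). P z"
  shows "AE x in cubeM S. AE y in cubeM T. P (merge x y T)"
proof -
  interpret pair_sigma_finite "cubeM S" "cubeM T" by (rule pair_sigma_finite_cubeM)
  have "AE z in cubeM S \<Otimes>\<^sub>M cubeM T. P (merge (fst z) (snd z) T)"
    by (rule AE_distrD[OF measurable_merge_cubeM]) (unfold distr_merge_cubeM[OF assms(1,2)], rule assms(3))
  then show ?thesis using AE_pair by fastforce
qed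

section \<open>Measurability and integrals of cell indicators\<close>

lemma chi_measurable [measurable]: "chi p i \<in> borel_measurable borel"
  unfolding chi_def by measurable

lemma measurable_unitI_borel [measurable]: "f \<in> borel_measurable borel \<Longrightarrow> f \<in> borel_measurable unitI"
  unfolding unitI_def by (rule measurable_restrict_space1) simp

lemma measurable_cubeM_coord:
  assumes "f \<in> borel_measurable borel" "i \<in> S"
  shows "(\<lambda>x. f (x i)) \<in> borel_measurable (cubeM S)"
  unfolding cubeM_def
  by (rule measurable_compose[OF measurable_component_singleton[OF assms(2)] measurable_unitI_borel[OF assms(1)]])

lemma ind_measurable [measurable]:
  assumes "T \<subseteq> S" shows "ind p T c \<in> borel_measurable (cubeM S)"
  unfolding ind_def[abs_def] using assms by (intro borel_measurable_prod measurable_cubeM_coord) auto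

lemma norm_chi_le: "cmod (chi p i t) \<le> 1"
  by (simp add: chi_def)

lemma norm_ind_le: "cmod (ind p S c x) \<le> 1"
  unfolding ind_def prod_norm[symmetric] by (intro prod_le_1) (auto simp: norm_chi_le)

lemma integrable_bounded_mult:
  fixes f g :: "'a \<Rightarrow> complex"
  assumes "integrable M f" "g \<in> borel_measurable M" "\<And>x. x \<in> space M \<Longrightarrow> cmod (g x) \<le> B"
  shows "integrable M (\<lambda>x. g x * f x)"
proof (rule Bochner_Integration.integrable_bound[of M "\<lambda>x. B * cmod (f x)"])
  show "integrable M (\<lambda>x. B * cmod (f x))" using assms by simp
  show "(\<lambda>x. g x * f x) \<in> borel_measurable M" using assms by simp
  show "AE x in M. cmod (g x * f x) \<le> norm (B * cmod (f x))"
  proof (rule AE_I2)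
    fix x assume "x \<in> space M"
    from assms(3)[OF this] have "cmod (g x) * cmod (f x) \<le> B * cmod (f x)"
      by (intro mult_right_mono) auto
    then show "cmod (g x * f x) \<le> norm (B * cmod (f x))" by (simp add: norm_mult) 
  qed
qed

text \<open>The mesh \<open>q\<close> is general because half cells, of width
  \<open>1 / (2 * p)\<close>, are needed besides the cells of width \<open>1 / p\<close>.\<close>

lemma integral_chi:
  assumes "i < q" shows "integrable unitI (chi q i)" "(\<integral>t. chi q i t \<partial>unitI) = of_real (1 / real q)"
proof -
  let ?I = "{real i / real q..<real (Suc i) / real q}"
  have le: "0 \<le> real i / real q" "real i / real q \<le> real (Suc i) / real q" "real (Suc i) / real q \<le> 1"
    using assms by (auto simp: divide_simps)
  have sub: "?I \<subseteq> {0..<1}" using le by auto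
  have chi: "chi q i = (\<lambda>t. indicator ?I t *\<^sub>R (1::complex))"
    by (auto simp: chi_def fun_eq_iff indicator_def)
  have e: "emeasure unitI ?I = ennreal (1 / real q)"
    using emeasure_unitI_cell[OF le] by (simp add: diff_divide_distrib[symmetric])
  have s: "?I \<in> sets unitI"
    unfolding unitI_def using sub by (subst sets_restrict_space_iff) auto
  have ii: "integrable unitI (indicator ?I :: real \<Rightarrow> real)"
    using s by (rule integrable_real_indicator) (simp only: e ennreal_less_top infinity_ennreal_def)
  then show "integrable unitI (chi q i)" unfolding chi by (intro integrable_scaleR_left)
  have "measure unitI ?I = 1 / real q" unfolding measure_def e by simp
  moreover have "(\<integral>t. indicator ?I t \<partial>unitI) = measure unitI ?I"
    by (simp only: Bochner_Integration.integral_indicator space_unitI Int_absorb2[OF sub])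
  ultimately show "(\<integral>t. chi q i t \<partial>unitI) = of_real (1 / real q)"
    unfolding chi using ii by (simp add: scaleR_conv_of_real)
qed

lemma (in prob_space) square_expectation_le:
  fixes X :: "'a \<Rightarrow> real"
  assumes "integrable M X" "integrable M (\<lambda>x. (X x)\<^sup>2)"
  shows "(expectation X)\<^sup>2 \<le> expectation (\<lambda>x. (X x)\<^sup>2)"
  using variance_eq[OF assms] variance_positive[of X] by simp

lemma finite_subN: "\<alpha> \<subseteq> {..<N::nat} \<Longrightarrow> finite \<alpha>"
  using finite_subset by blast

context staircase_algebra
begin

abbreviation \<mu> :: "pt measure" where "\<mu> \<equiv> cubeM {..<N}"

lemma Un_sub: "\<alpha> \<subseteq> {..<N} \<Longrightarrow> {..<N} \<union> \<alpha> = {..<N}" by auto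

lemma integral_ind:
  assumes "finite S" "c \<in> cells p S"
  shows "(\<integral>x. ind p S c x \<partial>cubeM S) = h ^ card S"
proof -
  have "(\<integral>x. ind p S c x \<partial>cubeM S) = (\<Prod>i\<in>S. \<integral>t. chi p (c i) t \<partial>unitI)"
    unfolding cubeM_def ind_def using assms by (intro cub.product_integral_prod) (auto simp: cells_def integral_chi)
  also have "\<dots> = (\<Prod>i\<in>S. h)"
    using assms by (intro prod.cong) (auto simp: cells_def integral_chi h_def)
  finally show ?thesis by simp
qed

text \<open>The basic building block of all operators: integration over the variables of \<alpha>
  against the indicator of one cell. The result no longer depends on these variables.\<close>

definition W :: "nat set \<Rightarrow> (nat \<Rightarrow> nat) \<Rightarrow> (pt \<Rightarrow> complex) \<Rightarrow> pt \<Rightarrow> complex" where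
  "W \<alpha> d f k = (\<integral>x. ind p \<alpha> d x * f (merge k x \<alpha>) \<partial>cubeM \<alpha>)"

lemma AE_integrable_section:
  fixes f :: "pt \<Rightarrow> 'b::{banach, second_countable_topology}"
  assumes \<alpha>: "\<alpha> \<subseteq> {..<N}" and f: "integrable \<mu> f"
  shows "AE k in \<mu>. integrable (cubeM \<alpha>) (\<lambda>x. f (merge k x \<alpha>))"
proof -
  interpret pair_sigma_finite \<mu> "cubeM \<alpha>" by (rule pair_sigma_finite_cubeM)
  show ?thesis
    using integrable_merge[OF finite_lessThan[of N] finite_subN[OF \<alpha>], of f] f
    unfolding Un_sub[OF \<alpha>] by (intro AE_integrable_fst) blast
qed

lemma AE_section:
  assumes \<alpha>: "\<alpha> \<subseteq> {..<N}" and "AE k in \<mu>. P k"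
  shows "AE k in \<mu>. AE x in cubeM \<alpha>. P (merge k x \<alpha>)"
  using AE_merge[OF finite_lessThan[of N] finite_subN[OF \<alpha>], of P] assms(2) unfolding Un_sub[OF \<alpha>] by blast

lemma integrable_section_mult:
  assumes \<alpha>: "\<alpha> \<subseteq> {..<N}" and f: "integrable \<mu> (f :: pt \<Rightarrow> complex)"
  shows "integrable (\<mu> \<Otimes>\<^sub>M cubeM \<alpha>) (\<lambda>(k, x). ind p \<alpha> d x * f (merge k x \<alpha>))"
proof -
  have "integrable (\<mu> \<Otimes>\<^sub>M cubeM \<alpha>) (\<lambda>(k, x). f (merge k x \<alpha>))"
    using integrable_merge[OF _ finite_subN[OF \<alpha>], of "{..<N}" f] f Un_sub[OF \<alpha>] by simp
  then have "integrable (\<mu> \<Otimes>\<^sub>M cubeM \<alpha>) (\<lambda>z. ind p \<alpha> d (snd z) * (case z of (k, x) \<Rightarrow> f (merge k x \<alpha>)))"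
    by (rule integrable_bounded_mult[where B = 1])
       (auto simp: norm_ind_le intro!: measurable_compose[OF measurable_snd ind_measurable])
  then show ?thesis by (simp add: case_prod_beta')
qed

lemma integrable_W:
  assumes \<alpha>: "\<alpha> \<subseteq> {..<N}" and f: "integrable \<mu> f"
  shows "integrable \<mu> (W \<alpha> d f)"
proof -
  interpret pair_sigma_finite \<mu> "cubeM \<alpha>" by (rule pair_sigma_finite_cubeM)
  show ?thesis
    unfolding W_def[abs_def] using integrable_fst[OF integrable_section_mult[OF assms]] by simp
qed

lemma integrable_ind_mult:
  assumes "integrable (cubeM \<alpha>) f"
  shows "integrable (cubeM \<alpha>) (\<lambda>x. ind p \<alpha> d x * f x)"
  using assms by (rule integrable_bounded_mult[where B = 1]) (auto simp: norm_ind_le ind_measurable)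

lemma W_off_cong:
  assumes "\<And>i. i \<notin> \<alpha> \<Longrightarrow> k i = k' i"
  shows "W \<alpha> d f k = W \<alpha> d f k'"
proof -
  have "merge k x \<alpha> = merge k' x \<alpha>" for x using assms by (auto simp: merge_def)
  then show ?thesis by (simp add: W_def)
qed

text \<open>The inner integral does not depend on the variables of \<beta>, so over \<alpha>
  \<inter> \<beta> the outer weight integrates to the volume of a cell, and only the cell
  \<open>e\<close> of the inner operator survives there. The rest is a single integral over \<alpha>
  \<union> \<beta>. The identity is claimed almost everywhere because Fubini requires integrable
  sections.\<close>

lemma W_comp:
  assumes \<alpha>: "\<alpha> \<subseteq> {..<N}" and \<beta>: "\<beta> \<subseteq> {..<N}" and d: "d \<in> cells p \<alpha>" and e: "e \<in> cells p \<beta>"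
    and f: "integrable \<mu> f"
  shows "AE k in \<mu>. W \<alpha> d (W \<beta> e f) k = h ^ card (\<alpha> \<inter> \<beta>) * W (\<alpha> \<union> \<beta>) (cmerge (cres d (\<alpha> - \<beta>)) e \<beta>) f k"
proof -
  let ?g = "cmerge (cres d (\<alpha> - \<beta>)) e \<beta>"
  have fin: "finite (\<alpha> - \<beta>)" "finite \<beta>" "finite (\<alpha> \<inter> \<beta>)" using finite_subN[OF \<alpha>] finite_subN[OF \<beta>] by auto
  have un: "(\<alpha> - \<beta>) \<union> \<beta> = \<alpha> \<union> \<beta>" "(\<alpha> \<inter> \<beta>) \<union> (\<alpha> - \<beta>) = \<alpha>" by auto
  have ab: "\<alpha> \<union> \<beta> \<subseteq> {..<N}" using \<alpha> \<beta> by auto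
  have "W \<alpha> d (W \<beta> e f) k = h ^ card (\<alpha> \<inter> \<beta>) * W (\<alpha> \<union> \<beta>) ?g f k"
    if i1: "integrable (cubeM (\<alpha> \<union> \<beta>)) (\<lambda>x. f (merge k x (\<alpha> \<union> \<beta>)))"
    and i2: "integrable (cubeM \<alpha>) (\<lambda>x. W \<beta> e f (merge k x \<alpha>))" for k
  proof -
    \<comment> \<open>The common value of both sides up to the volume factor. The right side reaches
      it by splitting \<alpha> \<union> \<beta> into \<alpha> - \<beta> and \<beta>, the left side
      by splitting \<alpha> into \<alpha> \<inter> \<beta> and \<alpha> - \<beta>.\<close>
    define Q where "Q = (\<integral>x. ind p (\<alpha> - \<beta>) d x * W \<beta> e f (merge k x (\<alpha> - \<beta>)) \<partial>cubeM (\<alpha> - \<beta>))"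
    have "W (\<alpha> \<union> \<beta>) ?g f k = (\<integral>z. ind p (\<alpha> \<union> \<beta>) ?g z * f (merge k z (\<alpha> \<union> \<beta>)) \<partial>cubeM ((\<alpha> - \<beta>) \<union> \<beta>))"
      unfolding un W_def ..
    also have "\<dots> = (\<integral>x. \<integral>y. ind p (\<alpha> \<union> \<beta>) ?g (merge x y \<beta>) * f (merge k (merge x y \<beta>) (\<alpha> \<union> \<beta>)) \<partial>cubeM \<beta> \<partial>cubeM (\<alpha> - \<beta>))"
      using integrable_ind_mult[OF i1] un fin by (intro integral_merge) auto
    also have "\<dots> = (\<integral>x. \<integral>y. ind p (\<alpha> - \<beta>) d x * (ind p \<beta> e y * f (merge (merge k x (\<alpha> - \<beta>)) y \<beta>)) \<partial>cubeM \<beta> \<partial>cubeM (\<alpha> - \<beta>))"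
    proof (intro Bochner_Integration.integral_cong refl)
      fix x y
      have "merge k (merge x y \<beta>) (\<alpha> \<union> \<beta>) = merge (merge k x (\<alpha> - \<beta>)) y \<beta>"
        by (auto simp: merge_def)
      moreover have "ind p (\<alpha> \<union> \<beta>) ?g (merge x y \<beta>) = ind p (\<alpha> - \<beta>) d x * ind p \<beta> e y"
        unfolding ind_def un(1)[symmetric] using fin
        by (subst prod.union_disjoint) (auto intro!: arg_cong2[where f = "(*)"] prod.cong simp: cmerge_def cres_def merge_def)
      ultimately show "ind p (\<alpha> \<union> \<beta>) ?g (merge x y \<beta>) * f (merge k (merge x y \<beta>) (\<alpha> \<union> \<beta>)) =
        ind p (\<alpha> - \<beta>) d x * (ind p \<beta> e y * f (merge (merge k x (\<alpha> - \<beta>)) y \<beta>))" by simp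
    qed
    also have "\<dots> = Q" unfolding Q_def W_def by simp
    finally have R: "W (\<alpha> \<union> \<beta>) ?g f k = Q" .
    have "W \<alpha> d (W \<beta> e f) k = (\<integral>z. ind p \<alpha> d z * W \<beta> e f (merge k z \<alpha>) \<partial>cubeM ((\<alpha> \<inter> \<beta>) \<union> (\<alpha> - \<beta>)))"
      unfolding un W_def[of \<alpha>] ..
    also have "\<dots> = (\<integral>w. \<integral>x. ind p \<alpha> d (merge w x (\<alpha> - \<beta>)) * W \<beta> e f (merge k (merge w x (\<alpha> - \<beta>)) \<alpha>) \<partial>cubeM (\<alpha> - \<beta>) \<partial>cubeM (\<alpha> \<inter> \<beta>))"
      using integrable_ind_mult[OF i2] un fin by (intro integral_merge) auto
    also have "\<dots> = (\<integral>w. \<integral>x. ind p (\<alpha> \<inter> \<beta>) d w * (ind p (\<alpha> - \<beta>) d x * W \<beta> e f (merge k x (\<alpha> - \<beta>))) \<partial>cubeM (\<alpha> - \<beta>) \<partial>cubeM (\<alpha> \<inter> \<beta>))"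
    proof (intro Bochner_Integration.integral_cong refl)
      fix w x
      have "W \<beta> e f (merge k (merge w x (\<alpha> - \<beta>)) \<alpha>) = W \<beta> e f (merge k x (\<alpha> - \<beta>))"
        by (rule W_off_cong) (auto simp: merge_def)
      moreover have "ind p \<alpha> d (merge w x (\<alpha> - \<beta>)) = ind p (\<alpha> \<inter> \<beta>) d w * ind p (\<alpha> - \<beta>) d x"
      proof -
        have "ind p \<alpha> d (merge w x (\<alpha> - \<beta>)) = ind p ((\<alpha> \<inter> \<beta>) \<union> (\<alpha> - \<beta>)) d (merge w x (\<alpha> - \<beta>))"
          by (simp only: un)
        also have "\<dots> = ind p (\<alpha> \<inter> \<beta>) d w * ind p (\<alpha> - \<beta>) d x"
          unfolding ind_def using fin
          by (subst prod.union_disjoint) (auto intro!: arg_cong2[where f = "(*)"] prod.cong simp: merge_def)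
        finally show ?thesis .
      qed
      ultimately show "ind p \<alpha> d (merge w x (\<alpha> - \<beta>)) * W \<beta> e f (merge k (merge w x (\<alpha> - \<beta>)) \<alpha>) =
        ind p (\<alpha> \<inter> \<beta>) d w * (ind p (\<alpha> - \<beta>) d x * W \<beta> e f (merge k x (\<alpha> - \<beta>)))" by simp
    qed
    also have "\<dots> = (\<integral>w. ind p (\<alpha> \<inter> \<beta>) (cres d (\<alpha> \<inter> \<beta>)) w \<partial>cubeM (\<alpha> \<inter> \<beta>)) * Q"
      unfolding Q_def by (simp add: ind_def cres_def)
    also have "\<dots> = h ^ card (\<alpha> \<inter> \<beta>) * Q"
      using integral_ind[OF fin(3) cres_in_cells[OF d]] by simp
    finally show ?thesis using R by simp
  qed
  note comp = this
  show ?thesis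
    using AE_integrable_section[OF ab f] AE_integrable_section[OF \<alpha> integrable_W[OF \<beta> f, of e]]
    by eventually_elim (rule comp)
qed

end

section \<open>Square-integrable functions\<close>

context staircase_algebra
begin

definition sqi :: "(pt \<Rightarrow> complex) \<Rightarrow> bool" where
  "sqi f \<longleftrightarrow> f \<in> borel_measurable \<mu> \<and> integrable \<mu> (\<lambda>k. (cmod (f k))\<^sup>2)"

definition n2 :: "(pt \<Rightarrow> complex) \<Rightarrow> real" where
  "n2 f = (\<integral>k. (cmod (f k))\<^sup>2 \<partial>\<mu>)"

lemma n2_nonneg: "0 \<le> n2 f" by (simp add: n2_def)

lemma L2_sqi: "u \<in> L2 N M \<longleftrightarrow> (\<forall>j<M. sqi (\<lambda>k. u k j))"
  by (auto simp: L2_def sqi_def)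

text \<open>The cube has finite measure, so \<open>1 + t^2\<close> is an integrable majorant of
  \<open>t\<close>.\<close>

lemma sqi_integrable:
  assumes "sqi f" shows "integrable \<mu> f"
proof (rule Bochner_Integration.integrable_bound[of \<mu> "\<lambda>k. 1 + (cmod (f k))\<^sup>2"])
  interpret prob_space \<mu> by (rule prob_space_cubeM)
  show "integrable \<mu> (\<lambda>k. 1 + (cmod (f k))\<^sup>2)" using assms by (simp add: sqi_def)
  show "f \<in> borel_measurable \<mu>" using assms by (simp add: sqi_def)
  have "t \<le> 1 + t\<^sup>2" if "0 \<le> t" for t :: real
    using zero_le_power2[of "t - 1"] that by (simp add: power2_diff)
  then show "AE k in \<mu>. norm (f k) \<le> norm (1 + (cmod (f k))\<^sup>2)"
    by (intro AE_I2) (metis abs_ge_self norm_ge_zero order_trans real_norm_def)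
qed

lemma sqi_sum:
  assumes I: "finite I" and f: "\<And>t. t \<in> I \<Longrightarrow> sqi (f t)"
  shows "sqi (\<lambda>k. \<Sum>t\<in>I. f t k)" and "n2 (\<lambda>k. \<Sum>t\<in>I. f t k) \<le> real (card I) * (\<Sum>t\<in>I. n2 (f t))"
proof -
  have le: "(cmod (\<Sum>t\<in>I. f t k))\<^sup>2 \<le> real (card I) * (\<Sum>t\<in>I. (cmod (f t k))\<^sup>2)" for k
  proof -
    have "(cmod (\<Sum>t\<in>I. f t k))\<^sup>2 \<le> (\<Sum>t\<in>I. cmod (f t k))\<^sup>2"
      by (intro power_mono norm_sum) auto
    also have "\<dots> \<le> (\<Sum>t\<in>I. (cmod (f t k))\<^sup>2) * real (card I)"
      by (rule sum_squared_le_sum_of_squares)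
    finally show ?thesis by (simp add: mult.commute)
  qed
  have meas: "(\<lambda>k. \<Sum>t\<in>I. f t k) \<in> borel_measurable \<mu>"
    using f by (intro borel_measurable_sum) (simp add: sqi_def)
  have int: "integrable \<mu> (\<lambda>k. real (card I) * (\<Sum>t\<in>I. (cmod (f t k))\<^sup>2))"
    using f by (intro integrable_mult_right Bochner_Integration.integrable_sum) (simp add: sqi_def)
  have int2: "integrable \<mu> (\<lambda>k. (cmod (\<Sum>t\<in>I. f t k))\<^sup>2)"
    using meas le by (intro Bochner_Integration.integrable_bound[OF int]) (auto intro!: AE_I2 order_trans[OF _ abs_ge_self])
  then show "sqi (\<lambda>k. \<Sum>t\<in>I. f t k)" using meas by (simp add: sqi_def)
  have "n2 (\<lambda>k. \<Sum>t\<in>I. f t k) \<le> (\<integral>k. real (card I) * (\<Sum>t\<in>I. (cmod (f t k))\<^sup>2) \<partial>\<mu>)"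
    unfolding n2_def by (intro integral_mono int int2 le)
  also have "\<dots> = real (card I) * (\<Sum>t\<in>I. n2 (f t))"
    unfolding n2_def integral_mult_right_zero using f by (subst Bochner_Integration.integral_sum) (simp_all add: sqi_def)
  finally show "n2 (\<lambda>k. \<Sum>t\<in>I. f t k) \<le> real (card I) * (\<Sum>t\<in>I. n2 (f t))" .
qed

lemma sqi_mult:
  assumes f: "sqi f" and g: "g \<in> borel_measurable \<mu>" and B: "\<And>k. k \<in> space \<mu> \<Longrightarrow> cmod (g k) \<le> B"
  shows "sqi (\<lambda>k. g k * f k)" and "n2 (\<lambda>k. g k * f k) \<le> B\<^sup>2 * n2 f"
proof -
  have le: "(cmod (g k * f k))\<^sup>2 \<le> B\<^sup>2 * (cmod (f k))\<^sup>2" if "k \<in> space \<mu>" for k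
    unfolding norm_mult power_mult_distrib using B[OF that] by (intro mult_right_mono power_mono) auto
  have int: "integrable \<mu> (\<lambda>k. B\<^sup>2 * (cmod (f k))\<^sup>2)" using f by (simp add: sqi_def)
  have meas: "(\<lambda>k. g k * f k) \<in> borel_measurable \<mu>" using f g by (auto simp: sqi_def)
  have int2: "integrable \<mu> (\<lambda>k. (cmod (g k * f k))\<^sup>2)"
    using meas le by (intro Bochner_Integration.integrable_bound[OF int]) (auto intro!: AE_I2 order_trans[OF _ abs_ge_self])
  then show "sqi (\<lambda>k. g k * f k)" using meas by (simp add: sqi_def)
  have "n2 (\<lambda>k. g k * f k) \<le> (\<integral>k. B\<^sup>2 * (cmod (f k))\<^sup>2 \<partial>\<mu>)"
    unfolding n2_def by (intro integral_mono int int2 le)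
  then show "n2 (\<lambda>k. g k * f k) \<le> B\<^sup>2 * n2 f" by (simp add: n2_def)
qed

text \<open>\<open>W\<close> is a contraction in mean square: the weight has modulus at most 1, the
  square of an average over a probability space is at most the average of the square, and Fubini
  reassembles the sections into the full integral.\<close>

lemma sqi_W:
  assumes \<alpha>: "\<alpha> \<subseteq> {..<N}" and f: "sqi f"
  shows "sqi (W \<alpha> d f)" and "n2 (W \<alpha> d f) \<le> n2 f"
proof -
  interpret pair_sigma_finite \<mu> "cubeM \<alpha>" by (rule pair_sigma_finite_cubeM)
  interpret A: prob_space "cubeM \<alpha>" by (rule prob_space_cubeM)
  have sq: "integrable \<mu> (\<lambda>k. (cmod (f k))\<^sup>2)" using f by (simp add: sqi_def)
  have i2: "integrable (\<mu> \<Otimes>\<^sub>M cubeM \<alpha>) (\<lambda>(k, x). (cmod (f (merge k x \<alpha>)))\<^sup>2)"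
    using integrable_merge[OF finite_lessThan[of N] finite_subN[OF \<alpha>], of "\<lambda>k. (cmod (f k))\<^sup>2"] sq
    unfolding Un_sub[OF \<alpha>] by blast
  have int: "integrable \<mu> (\<lambda>k. \<integral>x. (cmod (f (merge k x \<alpha>)))\<^sup>2 \<partial>cubeM \<alpha>)"
    by (rule integrable_fst[OF i2])
  have meas: "W \<alpha> d f \<in> borel_measurable \<mu>"
    using integrable_W[OF \<alpha> sqi_integrable[OF f]] by auto
  have le: "AE k in \<mu>. (cmod (W \<alpha> d f k))\<^sup>2 \<le> (\<integral>x. (cmod (f (merge k x \<alpha>)))\<^sup>2 \<partial>cubeM \<alpha>)"
    using AE_integrable_section[OF \<alpha> sqi_integrable[OF f]] AE_integrable_section[OF \<alpha> sq]
  proof eventually_elim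
    case (elim k)
    have "cmod (W \<alpha> d f k) \<le> (\<integral>x. cmod (ind p \<alpha> d x * f (merge k x \<alpha>)) \<partial>cubeM \<alpha>)"
      unfolding W_def by (rule integral_norm_bound)
    also have "\<dots> \<le> (\<integral>x. cmod (f (merge k x \<alpha>)) \<partial>cubeM \<alpha>)"
      using elim(1) integrable_ind_mult[OF elim(1)]
      by (intro integral_mono integrable_norm) (auto simp: norm_mult intro!: mult_left_le_one_le norm_ind_le)
    finally have "(cmod (W \<alpha> d f k))\<^sup>2 \<le> (\<integral>x. cmod (f (merge k x \<alpha>)) \<partial>cubeM \<alpha>)\<^sup>2"
      by (intro power_mono) auto
    also have "\<dots> \<le> (\<integral>x. (cmod (f (merge k x \<alpha>)))\<^sup>2 \<partial>cubeM \<alpha>)"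
      using elim by (intro A.square_expectation_le) auto
    finally show ?case .
  qed
  have int2: "integrable \<mu> (\<lambda>k. (cmod (W \<alpha> d f k))\<^sup>2)"
  proof (rule Bochner_Integration.integrable_bound[OF int])
    show "AE k in \<mu>. norm ((cmod (W \<alpha> d f k))\<^sup>2) \<le> norm (\<integral>x. (cmod (f (merge k x \<alpha>)))\<^sup>2 \<partial>cubeM \<alpha>)"
      using le by eventually_elim auto
  qed (use meas in measurable)
  then show "sqi (W \<alpha> d f)" using meas by (simp add: sqi_def)
  have "n2 (W \<alpha> d f) \<le> (\<integral>k. \<integral>x. (cmod (f (merge k x \<alpha>)))\<^sup>2 \<partial>cubeM \<alpha> \<partial>\<mu>)"
    unfolding n2_def by (intro integral_mono_AE int int2 le)
  also have "\<dots> = n2 f"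
    using integral_merge[OF finite_lessThan[of N] finite_subN[OF \<alpha>], of "\<lambda>k. (cmod (f k))\<^sup>2"] sq
    unfolding Un_sub[OF \<alpha>] n2_def by simp
  finally show "n2 (W \<alpha> d f) \<le> n2 f" .
qed

text \<open>Boundedness of a scalar-valued operator on the vector-valued space. It is stable under
  finite sums and bounded multipliers, so boundedness of an algebra element reduces to that of
  \<open>W\<close>.\<close>

definition good :: "(vfun \<Rightarrow> pt \<Rightarrow> complex) \<Rightarrow> bool" where
  "good T \<longleftrightarrow> (\<exists>C\<ge>0. \<forall>u\<in>L2 N M. sqi (T u) \<and> n2 (T u) \<le> C * (\<Sum>j<M. n2 (\<lambda>k. u k j)))"

lemma good_sum:
  assumes I: "finite I" and T: "\<And>t. t \<in> I \<Longrightarrow> good (T t)"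
  shows "good (\<lambda>u k. \<Sum>t\<in>I. T t u k)"
proof -
  have "\<forall>t\<in>I. \<exists>C\<ge>0. \<forall>u\<in>L2 N M. sqi (T t u) \<and> n2 (T t u) \<le> C * (\<Sum>j<M. n2 (\<lambda>k. u k j))"
    using T by (simp add: good_def)
  then obtain C where C0: "\<And>t. t \<in> I \<Longrightarrow> 0 \<le> C t"
    and C: "\<And>t u. t \<in> I \<Longrightarrow> u \<in> L2 N M \<Longrightarrow> sqi (T t u) \<and> n2 (T t u) \<le> C t * (\<Sum>j<M. n2 (\<lambda>k. u k j))"
    by metis
  show ?thesis
    unfolding good_def
  proof (intro exI[of _ "real (card I) * (\<Sum>t\<in>I. C t)"] conjI ballI)
    show "0 \<le> real (card I) * (\<Sum>t\<in>I. C t)" using C0 by (intro mult_nonneg_nonneg sum_nonneg) auto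
    fix u assume u: "u \<in> L2 N M"
    show "sqi (\<lambda>k. \<Sum>t\<in>I. T t u k)" using C[OF _ u] by (intro sqi_sum I) auto
    have "n2 (\<lambda>k. \<Sum>t\<in>I. T t u k) \<le> real (card I) * (\<Sum>t\<in>I. n2 (T t u))"
      using C[OF _ u] by (intro sqi_sum I) auto
    also have "\<dots> \<le> real (card I) * (\<Sum>t\<in>I. C t * (\<Sum>j<M. n2 (\<lambda>k. u k j)))"
      using C[OF _ u] by (intro mult_left_mono sum_mono) auto
    finally show "n2 (\<lambda>k. \<Sum>t\<in>I. T t u k) \<le> real (card I) * (\<Sum>t\<in>I. C t) * (\<Sum>j<M. n2 (\<lambda>k. u k j))"
      by (simp only: sum_distrib_right[symmetric] mult.assoc)
  qed
qed

lemma good_mult: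
  assumes T: "good T" and g: "g \<in> borel_measurable \<mu>" and B: "\<And>k. k \<in> space \<mu> \<Longrightarrow> cmod (g k) \<le> B"
  shows "good (\<lambda>u k. g k * T u k)"
proof -
  obtain C where C0: "0 \<le> C" and C: "\<And>u. u \<in> L2 N M \<Longrightarrow> sqi (T u) \<and> n2 (T u) \<le> C * (\<Sum>j<M. n2 (\<lambda>k. u k j))"
    using T by (auto simp: good_def)
  show ?thesis
    unfolding good_def
  proof (intro exI[of _ "B\<^sup>2 * C"] conjI ballI)
    show "0 \<le> B\<^sup>2 * C" using C0 by simp
    fix u assume u: "u \<in> L2 N M"
    show "sqi (\<lambda>k. g k * T u k)" using C[OF u] g B by (intro sqi_mult) auto
    have "n2 (\<lambda>k. g k * T u k) \<le> B\<^sup>2 * n2 (T u)" using C[OF u] g B by (intro sqi_mult) auto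
    also have "\<dots> \<le> B\<^sup>2 * (C * (\<Sum>j<M. n2 (\<lambda>k. u k j)))" using C[OF u] by (intro mult_left_mono) auto
    finally show "n2 (\<lambda>k. g k * T u k) \<le> B\<^sup>2 * C * (\<Sum>j<M. n2 (\<lambda>k. u k j))" by (simp only: mult.assoc)
  qed
qed

lemma good_W:
  assumes "\<alpha> \<subseteq> {..<N}" "l < M"
  shows "good (\<lambda>u. W \<alpha> d (\<lambda>k. u k l))"
  unfolding good_def
proof (intro exI[of _ 1] conjI ballI)
  fix u assume "u \<in> L2 N M"
  then have s: "sqi (\<lambda>k. u k l)" using assms by (simp add: L2_sqi)
  show "sqi (W \<alpha> d (\<lambda>k. u k l))" by (rule sqi_W[OF assms(1) s])
  have "n2 (W \<alpha> d (\<lambda>k. u k l)) \<le> n2 (\<lambda>k. u k l)" by (rule sqi_W[OF assms(1) s])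
  also have "\<dots> \<le> (\<Sum>j<M. n2 (\<lambda>k. u k j))" using assms by (intro member_le_sum) (auto simp: n2_nonneg)
  finally show "n2 (W \<alpha> d (\<lambda>k. u k l)) \<le> 1 * (\<Sum>j<M. n2 (\<lambda>k. u k j))" by simp
qed simp

section \<open>Boundedness and measurability of the operators\<close>

lemma Lset_cellpt:
  assumes A: "A \<in> Lset N M p" and "k \<in> cube {..<N}" "x \<in> cube \<alpha>"
  shows "A \<alpha> k x i j = A \<alpha> (cellpt p (cl p {..<N} k)) (cellpt p (cl p \<alpha> x)) i j"
  using assms by (intro Lset_cell[OF A] cellpt_in_cube[OF p_pos cl_in_cells[OF p_pos]])
    (auto simp: cl_cellpt[OF p_pos] cres_cl)

text \<open>Only finitely many values occur, one for each choice of cells and indices; 0 is adjoined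
  to account for arguments outside the domain.\<close>

lemma Lset_bounded:
  assumes A: "A \<in> Lset N M p"
  shows "\<exists>B\<ge>0. \<forall>\<alpha> k x i j. cmod (A \<alpha> k x i j) \<le> B"
proof -
  let ?S = "\<Union>\<alpha>\<in>Pow {..<N}. (\<lambda>(c, d, i, j). cmod (A \<alpha> (cellpt p c) (cellpt p d) i j)) ` (cells p {..<N} \<times> cells p \<alpha> \<times> {..<M} \<times> {..<M})"
  have fin: "finite (insert 0 ?S)"
    unfolding finite_insert by (intro finite_UN_I finite_imageI finite_cartesian_product finite_cells) (auto dest: finite_subN)
  have mem: "cmod (A \<alpha> k x i j) \<in> insert 0 ?S" for \<alpha> k x i j
  proof (cases "\<alpha> \<subseteq> {..<N} \<and> k \<in> cube {..<N} \<and> x \<in> cube \<alpha> \<and> i < M \<and> j < M")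
    case True
    then have "cmod (A \<alpha> k x i j) = (\<lambda>(c, d, i, j). cmod (A \<alpha> (cellpt p c) (cellpt p d) i j)) (cl p {..<N} k, cl p \<alpha> x, i, j)"
      using Lset_cellpt[OF A] by simp
    moreover have "(cl p {..<N} k, cl p \<alpha> x, i, j) \<in> cells p {..<N} \<times> cells p \<alpha> \<times> {..<M} \<times> {..<M}"
      using True by (auto intro!: cl_in_cells p_pos)
    ultimately show ?thesis using True by blast
  next
    case False
    then show ?thesis using Lset_outside[OF A] by simp
  qed
  show ?thesis
    using Max_ge[OF fin mem] Max_ge[OF fin insertI1] by (intro exI[of _ "Max (insert 0 ?S)"]) simp
qed

lemma Lset_expand:
  assumes A: "A \<in> Lset N M p" and \<alpha>: "\<alpha> \<subseteq> {..<N}" and "k \<in> cube {..<N}" "x \<in> cube \<alpha>"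
  shows "A \<alpha> k x i j = (\<Sum>d\<in>cells p \<alpha>. A \<alpha> k (cellpt p d) i j * ind p \<alpha> d x)"
  unfolding sum_ind[OF p_pos finite_subN[OF \<alpha>] assms(4)]
  using assms by (intro Lset_cell[OF A] cellpt_in_cube[OF p_pos cl_in_cells[OF p_pos]])
    (auto simp: cl_cellpt[OF p_pos] cres_cl)

lemma Lset_expand2:
  assumes A: "A \<in> Lset N M p" and \<alpha>: "\<alpha> \<subseteq> {..<N}" and "k \<in> cube {..<N}" "x \<in> cube \<alpha>"
  shows "A \<alpha> k x i j = (\<Sum>c\<in>cells p {..<N}. A \<alpha> (cellpt p c) x i j * ind p {..<N} c k)"
  unfolding sum_ind[OF p_pos finite_lessThan assms(3)]
  using assms by (intro Lset_cell[OF A] cellpt_in_cube[OF p_pos cl_in_cells[OF p_pos]])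
    (auto simp: cl_cellpt[OF p_pos] cres_cl)

lemma Lset_measurable:
  assumes A: "A \<in> Lset N M p" and \<alpha>: "\<alpha> \<subseteq> {..<N}" and x: "x \<in> cube \<alpha>"
  shows "(\<lambda>k. A \<alpha> k x i j) \<in> borel_measurable \<mu>"
proof -
  have "(\<lambda>k. \<Sum>c\<in>cells p {..<N}. A \<alpha> (cellpt p c) x i j * ind p {..<N} c k) \<in> borel_measurable \<mu>"
    by (intro borel_measurable_sum borel_measurable_times ind_measurable) auto
  then show ?thesis
    by (rule measurable_cong[THEN iffD2, rotated]) (auto intro!: Lset_expand2[OF A \<alpha> _ x] cubeM_in_cube)
qed

lemma Lset_measurable_pair:
  assumes A: "A \<in> Lset N M p" and \<alpha>: "\<alpha> \<subseteq> {..<N}"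
  shows "(\<lambda>z. A \<alpha> (fst z) (snd z) i j) \<in> borel_measurable (\<mu> \<Otimes>\<^sub>M cubeM \<alpha>)"
proof -
  have "(\<lambda>z. \<Sum>d\<in>cells p \<alpha>. A \<alpha> (fst z) (cellpt p d) i j * ind p \<alpha> d (snd z)) \<in> borel_measurable (\<mu> \<Otimes>\<^sub>M cubeM \<alpha>)"
    by (intro borel_measurable_sum borel_measurable_times measurable_compose[OF measurable_snd ind_measurable]
        measurable_compose[OF measurable_fst Lset_measurable[OF A \<alpha>]]) (auto intro!: cellpt_in_cube[OF p_pos])
  then show ?thesis
    by (rule measurable_cong[THEN iffD2, rotated]) (auto intro!: Lset_expand[OF A \<alpha>] cubeM_in_cube simp: space_pair_measure)
qed

text \<open>\<open>opapp\<close> with the staircase kernels expanded into finite sums of cell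
  integrals. The two agree wherever the sections of \<open>u\<close> are integrable. Elsewhere the
  integral of a non-integrable function is 0 by convention, and linearity may fail; this is why
  operator identities are stated almost everywhere.\<close>

definition opW :: "opL \<Rightarrow> vfun \<Rightarrow> vfun" where
  "opW A u = (\<lambda>k i. \<Sum>\<alpha>\<in>Pow {..<N}. \<Sum>j<M. \<Sum>d\<in>cells p \<alpha>. A \<alpha> k (cellpt p d) i j * W \<alpha> d (\<lambda>k. u k j) k)"

lemma AE_sections:
  assumes u: "u \<in> L2 N M"
  shows "AE k in \<mu>. \<forall>\<alpha>\<in>Pow {..<N}. \<forall>j\<in>{..<M}. integrable (cubeM \<alpha>) (\<lambda>x. u (merge k x \<alpha>) j)"
  using u by (intro eventually_ball_finite ballI AE_integrable_section) (auto simp: L2_sqi intro: sqi_integrable)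

lemma opapp_AE_opW:
  assumes A: "A \<in> Lset N M p" and u: "u \<in> L2 N M"
  shows "AE k in \<mu>. \<forall>i. opapp N M A u k i = opW A u k i"
  using AE_sections[OF u] AE_space
proof eventually_elim
  case (elim k)
  show ?case
  proof
    fix i
    show "opapp N M A u k i = opW A u k i"
      unfolding opapp_def opW_def
    proof (intro sum.cong refl)
      fix \<alpha> j assume aj: "\<alpha> \<in> Pow {..<N}" "j \<in> {..<M}"
      then have int: "integrable (cubeM \<alpha>) (\<lambda>x. u (merge k x \<alpha>) j)" using elim by blast
      have "(\<integral>x. A \<alpha> k x i j * u (merge k x \<alpha>) j \<partial>cubeM \<alpha>) =
        (\<integral>x. (\<Sum>d\<in>cells p \<alpha>. A \<alpha> k (cellpt p d) i j * (ind p \<alpha> d x * u (merge k x \<alpha>) j)) \<partial>cubeM \<alpha>)"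
      proof (intro Bochner_Integration.integral_cong refl)
        fix x assume "x \<in> space (cubeM \<alpha>)"
        then have "A \<alpha> k x i j = (\<Sum>d\<in>cells p \<alpha>. A \<alpha> k (cellpt p d) i j * ind p \<alpha> d x)"
          using aj elim by (intro Lset_expand[OF A] cubeM_in_cube) auto
        then show "A \<alpha> k x i j * u (merge k x \<alpha>) j = (\<Sum>d\<in>cells p \<alpha>. A \<alpha> k (cellpt p d) i j * (ind p \<alpha> d x * u (merge k x \<alpha>) j))"
          by (simp add: sum_distrib_right mult.assoc)
      qed
      also have "\<dots> = (\<Sum>d\<in>cells p \<alpha>. A \<alpha> k (cellpt p d) i j * W \<alpha> d (\<lambda>k. u k j) k)"
        unfolding W_def using integrable_ind_mult[OF int] by simp
      finally show "(\<integral>x. A \<alpha> k x i j * u (merge k x \<alpha>) j \<partial>cubeM \<alpha>) =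
        (\<Sum>d\<in>cells p \<alpha>. A \<alpha> k (cellpt p d) i j * W \<alpha> d (\<lambda>k. u k j) k)" .
    qed
  qed
qed

text \<open>Almost-everywhere agreement with \<open>opW\<close> does not by itself carry over Borel
  measurability, so it is derived directly from joint measurability of kernel and section.\<close>

lemma opapp_measurable:
  assumes A: "A \<in> Lset N M p" and u: "u \<in> L2 N M"
  shows "(\<lambda>k. opapp N M A u k i) \<in> borel_measurable \<mu>"
  unfolding opapp_def
proof (intro borel_measurable_sum)
  fix \<alpha> j assume aj: "\<alpha> \<in> Pow {..<N}" "j \<in> {..<M}"
  interpret S: sigma_finite_measure "cubeM \<alpha>" by (rule sigma_finite_cubeM)
  have \<alpha>: "\<alpha> \<subseteq> {..<N}" using aj by auto
  have m: "(\<lambda>z. u (merge (fst z) (snd z) \<alpha>) j) \<in> borel_measurable (\<mu> \<Otimes>\<^sub>M cubeM \<alpha>)"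
    using measurable_compose[OF measurable_merge_cubeM[of \<alpha> "{..<N}"], of "\<lambda>k. u k j"] u aj
    unfolding Un_sub[OF \<alpha>] by (auto simp: L2_def)
  show "(\<lambda>k. \<integral>x. A \<alpha> k x i j * u (merge k x \<alpha>) j \<partial>cubeM \<alpha>) \<in> borel_measurable \<mu>"
    using borel_measurable_times[OF Lset_measurable_pair[OF A \<alpha>, of i j] m]
    by (intro S.borel_measurable_lebesgue_integral) (simp add: case_prod_beta')
qed

lemma good_opW:
  assumes A: "A \<in> Lset N M p"
  shows "good (\<lambda>u k. opW A u k i)"
proof -
  obtain B where "\<forall>\<alpha> k x i j. cmod (A \<alpha> k x i j) \<le> B" using Lset_bounded[OF A] by auto
  then show ?thesis
    unfolding opW_def
    by (intro good_sum good_mult[where B = B] good_W Lset_measurable[OF A])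
       (auto intro!: finite_cells cellpt_in_cube[OF p_pos] dest: finite_subN)
qed

lemma L2norm_eq:
  assumes "u \<in> L2 N M" shows "L2norm N M u = sqrt (\<Sum>j<M. n2 (\<lambda>k. u k j))"
  unfolding L2norm_def n2_def using assms by (simp add: L2_sqi sqi_def)

lemma opapp_sqi:
  assumes A: "A \<in> Lset N M p" and u: "u \<in> L2 N M"
  shows "sqi (\<lambda>k. opapp N M A u k i)" and "n2 (\<lambda>k. opapp N M A u k i) = n2 (\<lambda>k. opW A u k i)"
proof -
  have s: "sqi (\<lambda>k. opW A u k i)" using good_opW[OF A] u by (auto simp: good_def)
  have m: "(\<lambda>k. opapp N M A u k i) \<in> borel_measurable \<mu>" by (rule opapp_measurable[OF A u])
  have ae: "AE k in \<mu>. (cmod (opapp N M A u k i))\<^sup>2 = (cmod (opW A u k i))\<^sup>2"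
    using opapp_AE_opW[OF A u] by eventually_elim simp
  have ms: "(\<lambda>k. (cmod (opapp N M A u k i))\<^sup>2) \<in> borel_measurable \<mu>" "(\<lambda>k. (cmod (opW A u k i))\<^sup>2) \<in> borel_measurable \<mu>"
    using borel_measurable_power[OF measurable_compose[OF m borel_measurable_norm]] s
      borel_measurable_integrable[of \<mu> "\<lambda>k. (cmod (opW A u k i))\<^sup>2"] unfolding sqi_def by blast+
  have "integrable \<mu> (\<lambda>k. (cmod (opapp N M A u k i))\<^sup>2)"
    using integrable_cong_AE[OF ms ae] s by (simp add: sqi_def)
  then show "sqi (\<lambda>k. opapp N M A u k i)" using m by (simp add: sqi_def)
  show "n2 (\<lambda>k. opapp N M A u k i) = n2 (\<lambda>k. opW A u k i)"
    unfolding n2_def by (rule integral_cong_AE[OF ms ae])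
qed

lemma opapp_L2: "A \<in> Lset N M p \<Longrightarrow> u \<in> L2 N M \<Longrightarrow> opapp N M A u \<in> L2 N M"
  unfolding L2_sqi[of "opapp N M A u"] using opapp_sqi by blast

lemma opapp_bounded:
  assumes A: "A \<in> Lset N M p"
  shows "\<exists>C. \<forall>u\<in>L2 N M. L2norm N M (opapp N M A u) \<le> C * L2norm N M u"
proof -
  have "\<forall>i. \<exists>C\<ge>0. \<forall>u\<in>L2 N M. sqi (\<lambda>k. opW A u k i) \<and> n2 (\<lambda>k. opW A u k i) \<le> C * (\<Sum>j<M. n2 (\<lambda>k. u k j))"
    using good_opW[OF A] by (simp add: good_def)
  then obtain C where C0: "\<And>i. 0 \<le> C i"
    and C: "\<And>i u. u \<in> L2 N M \<Longrightarrow> n2 (\<lambda>k. opW A u k i) \<le> C i * (\<Sum>j<M. n2 (\<lambda>k. u k j))" by metis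
  have "L2norm N M (opapp N M A u) \<le> sqrt (\<Sum>i<M. C i) * L2norm N M u" if u: "u \<in> L2 N M" for u
  proof -
    have "(\<Sum>i<M. n2 (\<lambda>k. opapp N M A u k i)) \<le> (\<Sum>i<M. C i) * (\<Sum>j<M. n2 (\<lambda>k. u k j))"
      unfolding opapp_sqi(2)[OF A u] sum_distrib_right using C[OF u] by (intro sum_mono) auto
    then show ?thesis
      unfolding L2norm_eq[OF u] L2norm_eq[OF opapp_L2[OF A u]] real_sqrt_mult[symmetric] by simp
  qed
  then show ?thesis by blast
qed

section \<open>Compatibility with almost-everywhere equality and linear combinations\<close>

lemma W_AE_cong:
  assumes \<alpha>: "\<alpha> \<subseteq> {..<N}" and f: "integrable \<mu> f" and g: "integrable \<mu> g" and ae: "AE k in \<mu>. f k = g k"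
  shows "AE k in \<mu>. W \<alpha> d f k = W \<alpha> d g k"
  using AE_section[OF \<alpha> ae] AE_integrable_section[OF \<alpha> f] AE_integrable_section[OF \<alpha> g]
proof eventually_elim
  case (elim k)
  have "(\<lambda>x. ind p \<alpha> d x * f (merge k x \<alpha>)) \<in> borel_measurable (cubeM \<alpha>)"
    "(\<lambda>x. ind p \<alpha> d x * g (merge k x \<alpha>)) \<in> borel_measurable (cubeM \<alpha>)"
    using integrable_ind_mult[OF elim(2)] integrable_ind_mult[OF elim(3)] by auto
  moreover have "AE x in cubeM \<alpha>. ind p \<alpha> d x * f (merge k x \<alpha>) = ind p \<alpha> d x * g (merge k x \<alpha>)"
    using elim(1) by eventually_elim simp
  ultimately show ?case unfolding W_def by (rule integral_cong_AE)
qed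

lemma W_sum:
  assumes \<alpha>: "\<alpha> \<subseteq> {..<N}" and f: "\<And>t. t \<in> I \<Longrightarrow> integrable \<mu> (f t)" and I: "finite I"
  shows "AE k in \<mu>. W \<alpha> d (\<lambda>k. \<Sum>t\<in>I. c t * f t k) k = (\<Sum>t\<in>I. c t * W \<alpha> d (f t) k)"
proof -
  have "AE k in \<mu>. \<forall>t\<in>I. integrable (cubeM \<alpha>) (\<lambda>x. f t (merge k x \<alpha>))"
    using I AE_integrable_section[OF \<alpha> f] by (intro eventually_ball_finite) auto
  then show ?thesis
  proof eventually_elim
    case (elim k)
    have "W \<alpha> d (\<lambda>k. \<Sum>t\<in>I. c t * f t k) k = (\<integral>x. (\<Sum>t\<in>I. c t * (ind p \<alpha> d x * f t (merge k x \<alpha>))) \<partial>cubeM \<alpha>)"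
      unfolding W_def by (simp add: sum_distrib_left mult_ac)
    also have "\<dots> = (\<Sum>t\<in>I. c t * W \<alpha> d (f t) k)"
      unfolding W_def using elim integrable_ind_mult by simp
    finally show ?case .
  qed
qed

lemma L2_sum:
  assumes "finite I" "\<And>t. t \<in> I \<Longrightarrow> u t \<in> L2 N M"
  shows "(\<lambda>k j. \<Sum>t\<in>I. c t * u t k j) \<in> L2 N M"
  unfolding L2_sqi
proof (intro allI impI sqi_sum(1) assms(1))
  fix j t assume "j < M" "t \<in> I"
  then have "sqi (\<lambda>k. u t k j)" using assms(2) by (simp add: L2_sqi)
  then show "sqi (\<lambda>k. c t * u t k j)" by (intro sqi_mult(1)[where B = "cmod (c t)"]) auto
qed

lemma sum_swap3:
  "(\<Sum>t\<in>I. \<Sum>a\<in>S. \<Sum>j\<in>T. \<Sum>d\<in>D a. F t a j d) = (\<Sum>a\<in>S. \<Sum>j\<in>T. \<Sum>d\<in>D a. \<Sum>t\<in>I. F t a j d)"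
  by (subst sum.swap, rule sum.cong[OF refl], subst sum.swap, rule sum.cong[OF refl], subst sum.swap, rule refl)

lemma opapp_sum:
  assumes A: "A \<in> Lset N M p" and I: "finite I" and u: "\<And>t. t \<in> I \<Longrightarrow> u t \<in> L2 N M"
  shows "AE k in \<mu>. \<forall>i. opapp N M A (\<lambda>k j. \<Sum>t\<in>I. c t * u t k j) k i = (\<Sum>t\<in>I. c t * opapp N M A (u t) k i)"
proof -
  have 1: "AE k in \<mu>. \<forall>\<alpha>\<in>Pow {..<N}. \<forall>j\<in>{..<M}. \<forall>d\<in>cells p \<alpha>.
     W \<alpha> d (\<lambda>k. \<Sum>t\<in>I. c t * u t k j) k = (\<Sum>t\<in>I. c t * W \<alpha> d (\<lambda>k. u t k j) k)"
    using I u by (intro eventually_ball_finite ballI W_sum)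
      (auto intro!: finite_cells sqi_integrable simp: L2_sqi dest: finite_subN)
  have 2: "AE k in \<mu>. \<forall>t\<in>I. \<forall>i. opapp N M A (u t) k i = opW A (u t) k i"
    using I u opapp_AE_opW[OF A] by (intro eventually_ball_finite) auto
  have "(\<lambda>k j. \<Sum>t\<in>I. c t * u t k j) \<in> L2 N M" using I u by (rule L2_sum)
  note 3 = opapp_AE_opW[OF A this]
  show ?thesis
    using 1 2 3
  proof eventually_elim
    case (elim k)
    show ?case
    proof
      fix i
      have "opW A (\<lambda>k j. \<Sum>t\<in>I. c t * u t k j) k i = (\<Sum>\<alpha>\<in>Pow {..<N}. \<Sum>j<M. \<Sum>d\<in>cells p \<alpha>. A \<alpha> k (cellpt p d) i j *
         (\<Sum>t\<in>I. c t * W \<alpha> d (\<lambda>k. u t k j) k))"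
        unfolding opW_def using elim(1) by (intro sum.cong refl) simp
      also have "\<dots> = (\<Sum>t\<in>I. c t * opW A (u t) k i)"
        unfolding opW_def sum_distrib_left sum_swap3 by (simp add: mult_ac)
      finally show "opapp N M A (\<lambda>k j. \<Sum>t\<in>I. c t * u t k j) k i = (\<Sum>t\<in>I. c t * opapp N M A (u t) k i)"
        using elim(2,3) by simp
    qed
  qed
qed

lemma opapp_AE_cong:
  assumes A: "A \<in> Lset N M p" and u: "u \<in> L2 N M" and v: "v \<in> L2 N M" and uv: "aeeq N M u v"
  shows "AE k in \<mu>. \<forall>i. opapp N M A u k i = opapp N M A v k i"
proof -
  have "AE k in \<mu>. u k j = v k j" if "j < M" for j
    using uv that unfolding aeeq_def by (auto elim: eventually_mono)
  then have "AE k in \<mu>. \<forall>\<alpha>\<in>Pow {..<N}. \<forall>j\<in>{..<M}. \<forall>d\<in>cells p \<alpha>. W \<alpha> d (\<lambda>k. u k j) k = W \<alpha> d (\<lambda>k. v k j) k"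
    using u v by (intro eventually_ball_finite ballI W_AE_cong)
      (auto intro!: finite_cells sqi_integrable simp: L2_sqi dest: finite_subN)
  then show ?thesis
    using opapp_AE_opW[OF A u] opapp_AE_opW[OF A v]
  proof eventually_elim
    case (elim k)
    have "opW A u k i = opW A v k i" for i
      unfolding opW_def using elim(1) by (intro sum.cong refl) simp
    then show ?case using elim by simp
  qed
qed

end

section \<open>Composition of operators\<close>

context staircase_algebra
begin

lemma integral_sum3:
  fixes F :: "'b \<Rightarrow> 'c \<Rightarrow> 'd \<Rightarrow> 'e \<Rightarrow> complex"
  assumes "\<And>a j d. a \<in> S \<Longrightarrow> j \<in> T \<Longrightarrow> d \<in> D a \<Longrightarrow> integrable \<nu> (F a j d)"
  shows "(\<integral>x. (\<Sum>a\<in>S. \<Sum>j\<in>T. \<Sum>d\<in>D a. c a j d * F a j d x) \<partial>\<nu>) = (\<Sum>a\<in>S. \<Sum>j\<in>T. \<Sum>d\<in>D a. c a j d * (\<integral>x. F a j d x \<partial>\<nu>))"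
proof -
  have i: "integrable \<nu> (\<lambda>x. c a j d * F a j d x)" if "a \<in> S" "j \<in> T" "d \<in> D a" for a j d
    using assms[OF that] by simp
  have "(\<integral>x. (\<Sum>a\<in>S. \<Sum>j\<in>T. \<Sum>d\<in>D a. c a j d * F a j d x) \<partial>\<nu>) = (\<Sum>a\<in>S. \<integral>x. (\<Sum>j\<in>T. \<Sum>d\<in>D a. c a j d * F a j d x) \<partial>\<nu>)"
    by (intro Bochner_Integration.integral_sum Bochner_Integration.integrable_sum i)
  also have "\<dots> = (\<Sum>a\<in>S. \<Sum>j\<in>T. \<integral>x. (\<Sum>d\<in>D a. c a j d * F a j d x) \<partial>\<nu>)"
    by (intro sum.cong refl Bochner_Integration.integral_sum Bochner_Integration.integrable_sum i)
  also have "\<dots> = (\<Sum>a\<in>S. \<Sum>j\<in>T. \<Sum>d\<in>D a. \<integral>x. c a j d * F a j d x \<partial>\<nu>)"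
    by (intro sum.cong refl Bochner_Integration.integral_sum i)
  finally show ?thesis by simp
qed

text \<open>Under the weight \<open>ind p \<alpha> d\<close> the coefficients of \<open>B\<close>
  are constant in the variables of \<alpha>, so they are evaluated at the corner of the cell
  \<open>d\<close> and pulled out of the integral.\<close>

lemma W_opW:
  assumes B: "B \<in> Lset N M p" and u: "u \<in> L2 N M" and \<alpha>: "\<alpha> \<subseteq> {..<N}" and d: "d \<in> cells p \<alpha>"
  shows "AE k in \<mu>. W \<alpha> d (\<lambda>k. opW B u k j) k =
    (\<Sum>\<beta>\<in>Pow {..<N}. \<Sum>l<M. \<Sum>e\<in>cells p \<beta>. B \<beta> (merge k (cellpt p d) \<alpha>) (cellpt p e) j l * W \<alpha> d (W \<beta> e (\<lambda>k. u k l)) k)"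
proof -
  have "AE k in \<mu>. \<forall>\<beta>\<in>Pow {..<N}. \<forall>l\<in>{..<M}. \<forall>e\<in>cells p \<beta>. integrable (cubeM \<alpha>) (\<lambda>x. W \<beta> e (\<lambda>k. u k l) (merge k x \<alpha>))"
    using u by (intro eventually_ball_finite ballI AE_integrable_section[OF \<alpha>] integrable_W)
      (auto intro!: finite_cells sqi_integrable simp: L2_sqi dest: finite_subN)
  then show ?thesis
    using AE_space
  proof eventually_elim
    case (elim k)
    have kc: "k \<in> cube {..<N}" using elim by (intro cubeM_in_cube)
    have "W \<alpha> d (\<lambda>k. opW B u k j) k = (\<integral>x. (\<Sum>\<beta>\<in>Pow {..<N}. \<Sum>l<M. \<Sum>e\<in>cells p \<beta>.
        B \<beta> (merge k (cellpt p d) \<alpha>) (cellpt p e) j l * (ind p \<alpha> d x * W \<beta> e (\<lambda>k. u k l) (merge k x \<alpha>))) \<partial>cubeM \<alpha>)"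
      unfolding W_def[of \<alpha>]
    proof (intro Bochner_Integration.integral_cong refl)
      fix x assume x: "x \<in> space (cubeM \<alpha>)"
      have xc: "x \<in> cube \<alpha>" using x by (rule cubeM_in_cube)
      \<comment> \<open>Inside the cell \<open>d\<close> the two coefficients coincide; outside it
        the weight is 0.\<close>
      have eq: "ind p \<alpha> d x * B \<beta> (merge k x \<alpha>) (cellpt p e) j l = ind p \<alpha> d x * B \<beta> (merge k (cellpt p d) \<alpha>) (cellpt p e) j l"
        if e: "e \<in> cells p \<beta>" for \<beta> e l
      proof (cases "cl p \<alpha> x = d")
        case True
        have "B \<beta> (merge k x \<alpha>) (cellpt p e) j l = B \<beta> (merge k (cellpt p d) \<alpha>) (cellpt p e) j l"
        proof (rule Lset_cell[OF B])
          have k': "k \<in> cube ({..<N} - \<alpha>)" using kc by (auto simp: cube_def)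
          show "merge k x \<alpha> \<in> cube {..<N}" using k' xc by (rule merge_cube)
          show "merge k (cellpt p d) \<alpha> \<in> cube {..<N}" using k' cellpt_in_cube[OF p_pos d] by (rule merge_cube)
          have "{..<N} \<inter> \<alpha> = \<alpha>" using \<alpha> by auto
          then show "cl p {..<N} (merge k x \<alpha>) = cl p {..<N} (merge k (cellpt p d) \<alpha>)"
            using True d by (intro cl_merge_cong) (simp_all add: cl_cellpt[OF p_pos])
        qed (auto intro: cellpt_in_cube[OF p_pos e])
        then show ?thesis by simp
      next
        case False
        then show ?thesis using ind_eq[OF p_pos finite_subN[OF \<alpha>] xc d] by simp
      qed
      show "ind p \<alpha> d x * opW B u (merge k x \<alpha>) j = (\<Sum>\<beta>\<in>Pow {..<N}. \<Sum>l<M. \<Sum>e\<in>cells p \<beta>.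
        B \<beta> (merge k (cellpt p d) \<alpha>) (cellpt p e) j l * (ind p \<alpha> d x * W \<beta> e (\<lambda>k. u k l) (merge k x \<alpha>)))"
        unfolding opW_def sum_distrib_left
      proof (intro sum.cong refl)
        fix \<beta> l e assume e: "e \<in> cells p \<beta>"
        let ?w = "W \<beta> e (\<lambda>k. u k l) (merge k x \<alpha>)"
        have "ind p \<alpha> d x * (B \<beta> (merge k x \<alpha>) (cellpt p e) j l * ?w) = ind p \<alpha> d x * B \<beta> (merge k x \<alpha>) (cellpt p e) j l * ?w"
          by (simp only: mult.assoc)
        also have "\<dots> = B \<beta> (merge k (cellpt p d) \<alpha>) (cellpt p e) j l * (ind p \<alpha> d x * ?w)"
          unfolding eq[OF e] by (simp only: mult_ac)
        finally show "ind p \<alpha> d x * (B \<beta> (merge k x \<alpha>) (cellpt p e) j l * ?w) =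
          B \<beta> (merge k (cellpt p d) \<alpha>) (cellpt p e) j l * (ind p \<alpha> d x * ?w)" .
      qed
    qed
    also have "\<dots> = (\<Sum>\<beta>\<in>Pow {..<N}. \<Sum>l<M. \<Sum>e\<in>cells p \<beta>. B \<beta> (merge k (cellpt p d) \<alpha>) (cellpt p e) j l * W \<alpha> d (W \<beta> e (\<lambda>k. u k l)) k)"
      unfolding W_def[of \<alpha>] using elim(1) by (intro integral_sum3 integrable_ind_mult) blast
    finally show ?case .
  qed
qed

text \<open>Displays a composite as a finite sum of cell integrals over unions \<alpha> \<union>
  \<beta>. The coefficients depend on \<open>k\<close> only through its cell, so the composite is
  again given by staircase kernels.\<close>

lemma opapp_opapp:
  assumes A: "A \<in> Lset N M p" and B: "B \<in> Lset N M p" and u: "u \<in> L2 N M"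
  shows "AE k in \<mu>. \<forall>i. opapp N M A (opapp N M B u) k i =
    (\<Sum>\<alpha>\<in>Pow {..<N}. \<Sum>j<M. \<Sum>d\<in>cells p \<alpha>. \<Sum>\<beta>\<in>Pow {..<N}. \<Sum>l<M. \<Sum>e\<in>cells p \<beta>.
      A \<alpha> k (cellpt p d) i j * B \<beta> (merge k (cellpt p d) \<alpha>) (cellpt p e) j l * h ^ card (\<alpha> \<inter> \<beta>) *
      W (\<alpha> \<union> \<beta>) (cmerge (cres d (\<alpha> - \<beta>)) e \<beta>) (\<lambda>k. u k l) k)"
proof -
  let ?v = "opapp N M B u"
  have v: "?v \<in> L2 N M" by (rule opapp_L2[OF B u])
  have iu: "integrable \<mu> (\<lambda>k. u k l)" if "l < M" for l using u that by (auto simp: L2_sqi intro: sqi_integrable)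
  have a1: "AE k in \<mu>. \<forall>\<alpha>\<in>Pow {..<N}. \<forall>j\<in>{..<M}. \<forall>d\<in>cells p \<alpha>. W \<alpha> d (\<lambda>k. ?v k j) k = W \<alpha> d (\<lambda>k. opW B u k j) k"
  proof (intro eventually_ball_finite ballI W_AE_cong)
    fix j
    show "integrable \<mu> (\<lambda>k. ?v k j)" using opapp_sqi(1)[OF B u] by (rule sqi_integrable)
    show "integrable \<mu> (\<lambda>k. opW B u k j)" using good_opW[OF B] u by (auto simp: good_def intro: sqi_integrable)
    show "AE k in \<mu>. ?v k j = opW B u k j" using opapp_AE_opW[OF B u] by eventually_elim simp
  qed (auto intro!: finite_cells dest: finite_subN)
  have a2: "AE k in \<mu>. \<forall>\<alpha>\<in>Pow {..<N}. \<forall>j\<in>{..<M}. \<forall>d\<in>cells p \<alpha>. W \<alpha> d (\<lambda>k. opW B u k j) k =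
     (\<Sum>\<beta>\<in>Pow {..<N}. \<Sum>l<M. \<Sum>e\<in>cells p \<beta>. B \<beta> (merge k (cellpt p d) \<alpha>) (cellpt p e) j l * W \<alpha> d (W \<beta> e (\<lambda>k. u k l)) k)"
    by (intro eventually_ball_finite ballI W_opW[OF B u]) (auto intro!: finite_cells dest: finite_subN)
  have a3: "AE k in \<mu>. \<forall>\<alpha>\<in>Pow {..<N}. \<forall>d\<in>cells p \<alpha>. \<forall>\<beta>\<in>Pow {..<N}. \<forall>l\<in>{..<M}. \<forall>e\<in>cells p \<beta>.
     W \<alpha> d (W \<beta> e (\<lambda>k. u k l)) k = h ^ card (\<alpha> \<inter> \<beta>) * W (\<alpha> \<union> \<beta>) (cmerge (cres d (\<alpha> - \<beta>)) e \<beta>) (\<lambda>k. u k l) k"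
    by (intro eventually_ball_finite ballI W_comp iu) (auto intro!: finite_cells dest: finite_subN)
  show ?thesis
    using a1 a2 a3 opapp_AE_opW[OF A v]
  proof eventually_elim
    case (elim k)
    show ?case
    proof
      fix i
      have "opapp N M A ?v k i = opW A ?v k i" using elim(4) by simp
      also have "\<dots> = (\<Sum>\<alpha>\<in>Pow {..<N}. \<Sum>j<M. \<Sum>d\<in>cells p \<alpha>. \<Sum>\<beta>\<in>Pow {..<N}. \<Sum>l<M. \<Sum>e\<in>cells p \<beta>.
        A \<alpha> k (cellpt p d) i j * B \<beta> (merge k (cellpt p d) \<alpha>) (cellpt p e) j l * h ^ card (\<alpha> \<inter> \<beta>) *
        W (\<alpha> \<union> \<beta>) (cmerge (cres d (\<alpha> - \<beta>)) e \<beta>) (\<lambda>k. u k l) k)"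
        unfolding opW_def[of A]
      proof (intro sum.cong refl)
        fix \<alpha> j d assume a: "\<alpha> \<in> Pow {..<N}" "j \<in> {..<M}" "d \<in> cells p \<alpha>"
        have "W \<alpha> d (\<lambda>k. ?v k j) k = W \<alpha> d (\<lambda>k. opW B u k j) k" using elim(1) a by blast
        also have "\<dots> = (\<Sum>\<beta>\<in>Pow {..<N}. \<Sum>l<M. \<Sum>e\<in>cells p \<beta>. B \<beta> (merge k (cellpt p d) \<alpha>) (cellpt p e) j l * W \<alpha> d (W \<beta> e (\<lambda>k. u k l)) k)"
          using elim(2) a by blast
        also have "\<dots> = (\<Sum>\<beta>\<in>Pow {..<N}. \<Sum>l<M. \<Sum>e\<in>cells p \<beta>. B \<beta> (merge k (cellpt p d) \<alpha>) (cellpt p e) j l *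
          (h ^ card (\<alpha> \<inter> \<beta>) * W (\<alpha> \<union> \<beta>) (cmerge (cres d (\<alpha> - \<beta>)) e \<beta>) (\<lambda>k. u k l) k))"
          using elim(3) a by (intro sum.cong refl arg_cong2[where f = "(*)"]) blast
        finally show "A \<alpha> k (cellpt p d) i j * W \<alpha> d (\<lambda>k. ?v k j) k = (\<Sum>\<beta>\<in>Pow {..<N}. \<Sum>l<M. \<Sum>e\<in>cells p \<beta>.
           A \<alpha> k (cellpt p d) i j * B \<beta> (merge k (cellpt p d) \<alpha>) (cellpt p e) j l * h ^ card (\<alpha> \<inter> \<beta>) *
           W (\<alpha> \<union> \<beta>) (cmerge (cres d (\<alpha> - \<beta>)) e \<beta>) (\<lambda>k. u k l) k)"
          by (simp only: sum_distrib_left mult.assoc)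
      qed
      finally show "opapp N M A ?v k i = (\<Sum>\<alpha>\<in>Pow {..<N}. \<Sum>j<M. \<Sum>d\<in>cells p \<alpha>. \<Sum>\<beta>\<in>Pow {..<N}. \<Sum>l<M. \<Sum>e\<in>cells p \<beta>.
        A \<alpha> k (cellpt p d) i j * B \<beta> (merge k (cellpt p d) \<alpha>) (cellpt p e) j l * h ^ card (\<alpha> \<inter> \<beta>) *
        W (\<alpha> \<union> \<beta>) (cmerge (cres d (\<alpha> - \<beta>)) e \<beta>) (\<lambda>k. u k l) k)" .
    qed
  qed
qed

text \<open>Isolates the pointwise side of the existence of products: the expansion of a composite
  is treated term by term, and almost-everywhere arguments enter only when \<open>opW\<close> is
  replaced by \<open>opapp\<close>.\<close>

definition representable :: "(vfun \<Rightarrow> vfun) \<Rightarrow> bool" where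
  "representable T \<longleftrightarrow> (\<exists>C\<in>Lset N M p. \<forall>u\<in>L2 N M. \<forall>k\<in>space \<mu>. \<forall>i<M. opW C u k i = T u k i)"

lemma zero_Lset: "(\<lambda>\<alpha> k x i j. 0) \<in> Lset N M p"
  by (rule LsetI) auto

lemma opW_linL: "opW (linL c A d B) u k i = c * opW A u k i + d * opW B u k i"
  unfolding opW_def linL_def sum_distrib_left sum.distrib[symmetric]
  by (intro sum.cong refl) (simp only: distrib_right mult.assoc)

lemma representable_sum:
  assumes "finite I" "\<And>t. t \<in> I \<Longrightarrow> representable (T t)"
  shows "representable (\<lambda>u k i. \<Sum>t\<in>I. T t u k i)"
  using assms
proof (induction I rule: finite_induct)
  case empty
  then show ?case unfolding representable_def by (intro bexI[OF _ zero_Lset]) (simp add: opW_def)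
next
  case (insert t I)
  then have "representable (\<lambda>u k i. \<Sum>t\<in>I. T t u k i)" "representable (T t)" by auto
  then obtain C D where C: "C \<in> Lset N M p" "\<forall>u\<in>L2 N M. \<forall>k\<in>space \<mu>. \<forall>i<M. opW C u k i = T t u k i"
    and D: "D \<in> Lset N M p" "\<forall>u\<in>L2 N M. \<forall>k\<in>space \<mu>. \<forall>i<M. opW D u k i = (\<Sum>t\<in>I. T t u k i)"
    unfolding representable_def by auto
  show ?case
    unfolding representable_def
    by (rule bexI[OF _ linL_Lset[OF C(1) D(1), of 1 1]]) (use C(2) D(2) insert(1,2) in \<open>simp add: opW_linL\<close>)
qed

lemma representable_basic:
  assumes \<gamma>: "\<gamma> \<subseteq> {..<N}" and g: "g \<in> cells p \<gamma>" and l: "l < M"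
    and s: "\<And>k k' i. k \<in> cube {..<N} \<Longrightarrow> k' \<in> cube {..<N} \<Longrightarrow> cl p {..<N} k = cl p {..<N} k' \<Longrightarrow> s k i = s k' i"
  shows "representable (\<lambda>u k i. s k i * W \<gamma> g (\<lambda>k. u k l) k)"
proof -
  define C :: opL where "C = (\<lambda>\<alpha> k x i j. if \<alpha> = \<gamma> \<and> k \<in> cube {..<N} \<and> x \<in> cube \<gamma> \<and> i < M \<and> j = l \<and> cl p \<gamma> x = g then s k i else 0)"
  have C: "C \<in> Lset N M p"
  proof (rule LsetI)
    fix \<alpha> k x k' x' i j
    assume a: "k \<in> cube {..<N}" "k' \<in> cube {..<N}" "x \<in> cube \<alpha>" "x' \<in> cube \<alpha>"
      "cl p {..<N} k = cl p {..<N} k'" "cl p \<alpha> x = cl p \<alpha> x'"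
    then show "C \<alpha> k x i j = C \<alpha> k' x' i j" using s[OF a(1,2,5)] by (auto simp: C_def)
  qed (use \<gamma> l in \<open>auto simp: C_def\<close>)
  have "opW C u k i = s k i * W \<gamma> g (\<lambda>k. u k l) k" if k: "k \<in> space \<mu>" and i: "i < M" for u k i
  proof -
    let ?F = "\<lambda>\<alpha> j d. C \<alpha> k (cellpt p d) i j * W \<alpha> d (\<lambda>k. u k j) k"
    have kc: "k \<in> cube {..<N}" using k by (rule cubeM_in_cube)
    have "opW C u k i = (\<Sum>\<alpha>\<in>{\<gamma>}. \<Sum>j<M. \<Sum>d\<in>cells p \<alpha>. ?F \<alpha> j d)"
      unfolding opW_def using \<gamma> by (intro sum.mono_neutral_right) (auto simp: C_def)
    also have "\<dots> = (\<Sum>j<M. \<Sum>d\<in>cells p \<gamma>. ?F \<gamma> j d)" by simp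
    also have "\<dots> = (\<Sum>j\<in>{l}. \<Sum>d\<in>cells p \<gamma>. ?F \<gamma> j d)"
      using l by (intro sum.mono_neutral_right) (auto simp: C_def)
    also have "\<dots> = (\<Sum>d\<in>cells p \<gamma>. ?F \<gamma> l d)" by simp
    also have "\<dots> = (\<Sum>d\<in>{g}. ?F \<gamma> l d)"
      using g finite_cells[OF finite_subN[OF \<gamma>]]
      by (intro sum.mono_neutral_right) (auto simp: C_def cl_cellpt[OF p_pos])
    also have "\<dots> = s k i * W \<gamma> g (\<lambda>k. u k l) k"
      using kc i g cellpt_in_cube[OF p_pos g] by (simp add: C_def cl_cellpt[OF p_pos])
    finally show ?thesis .
  qed
  then show ?thesis unfolding representable_def using C by blast
qed

lemma product_exists:
  assumes A: "A \<in> Lset N M p" and B: "B \<in> Lset N M p"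
  shows "\<exists>C\<in>Lset N M p. \<forall>u\<in>L2 N M. aeeq N M (opapp N M C u) (opapp N M A (opapp N M B u))"
proof -
  have "representable (\<lambda>u k i. \<Sum>\<alpha>\<in>Pow {..<N}. \<Sum>j<M. \<Sum>d\<in>cells p \<alpha>. \<Sum>\<beta>\<in>Pow {..<N}. \<Sum>l<M. \<Sum>e\<in>cells p \<beta>.
      A \<alpha> k (cellpt p d) i j * B \<beta> (merge k (cellpt p d) \<alpha>) (cellpt p e) j l * h ^ card (\<alpha> \<inter> \<beta>) *
      W (\<alpha> \<union> \<beta>) (cmerge (cres d (\<alpha> - \<beta>)) e \<beta>) (\<lambda>k. u k l) k)"
  proof (intro representable_sum representable_basic)
    fix \<alpha> j d \<beta> l e
    assume a: "\<alpha> \<in> Pow {..<N}" "d \<in> cells p \<alpha>" "\<beta> \<in> Pow {..<N}" "e \<in> cells p \<beta>" "l \<in> {..<M}"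
    show "\<alpha> \<union> \<beta> \<subseteq> {..<N}" "l < M" using a by auto
    have "cmerge (cres d (\<alpha> - \<beta>)) e \<beta> \<in> cells p ((\<alpha> - \<beta>) \<union> \<beta>)"
      using cres_in_cells[OF a(2), of "\<alpha> - \<beta>"] a(4) by (intro cmerge_in_cells) (auto simp: Un_Diff)
    then show "cmerge (cres d (\<alpha> - \<beta>)) e \<beta> \<in> cells p (\<alpha> \<union> \<beta>)" by simp
    fix k k' i assume k: "k \<in> cube {..<N}" "k' \<in> cube {..<N}" "cl p {..<N} k = cl p {..<N} k'"
    have c: "cl p ({..<N} - \<alpha>) k = cl p ({..<N} - \<alpha>) k'"
      using k(3) by (auto simp: cl_eq_iff)
    have k0: "k \<in> cube ({..<N} - \<alpha>)" "k' \<in> cube ({..<N} - \<alpha>)" using k by (auto simp: cube_def)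
    have m: "merge k (cellpt p d) \<alpha> \<in> cube {..<N}" "merge k' (cellpt p d) \<alpha> \<in> cube {..<N}"
      using k0 cellpt_in_cube[OF p_pos a(2)] by (auto intro: merge_cube)
    have "A \<alpha> k (cellpt p d) i j = A \<alpha> k' (cellpt p d) i j"
      by (rule Lset_cell[OF A k(1,2) _ _ k(3)]) (auto intro: cellpt_in_cube[OF p_pos a(2)])
    moreover have "B \<beta> (merge k (cellpt p d) \<alpha>) (cellpt p e) j l = B \<beta> (merge k' (cellpt p d) \<alpha>) (cellpt p e) j l"
      by (rule Lset_cell[OF B m _ _ cl_merge_cong[OF c]]) (auto intro: cellpt_in_cube[OF p_pos a(4)])
    ultimately show "A \<alpha> k (cellpt p d) i j * B \<beta> (merge k (cellpt p d) \<alpha>) (cellpt p e) j l * h ^ card (\<alpha> \<inter> \<beta>) =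
        A \<alpha> k' (cellpt p d) i j * B \<beta> (merge k' (cellpt p d) \<alpha>) (cellpt p e) j l * h ^ card (\<alpha> \<inter> \<beta>)" by simp
  qed (auto intro!: finite_cells dest: finite_subN)
  then obtain C where C: "C \<in> Lset N M p"
    and CT: "\<forall>u\<in>L2 N M. \<forall>k\<in>space \<mu>. \<forall>i<M. opW C u k i = (\<Sum>\<alpha>\<in>Pow {..<N}. \<Sum>j<M. \<Sum>d\<in>cells p \<alpha>. \<Sum>\<beta>\<in>Pow {..<N}. \<Sum>l<M. \<Sum>e\<in>cells p \<beta>.
      A \<alpha> k (cellpt p d) i j * B \<beta> (merge k (cellpt p d) \<alpha>) (cellpt p e) j l * h ^ card (\<alpha> \<inter> \<beta>) *
      W (\<alpha> \<union> \<beta>) (cmerge (cres d (\<alpha> - \<beta>)) e \<beta>) (\<lambda>k. u k l) k)"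
    unfolding representable_def by blast
  have "aeeq N M (opapp N M C u) (opapp N M A (opapp N M B u))" if u: "u \<in> L2 N M" for u
    unfolding aeeq_def using opapp_AE_opW[OF C u] opapp_opapp[OF A B u] AE_space
    by eventually_elim (use CT u in simp)
  then show ?thesis using C by blast
qed

end

section \<open>Test functions and block matrices\<close>

context staircase_algebra
begin

text \<open>Plus one on the left half of the cell \<open>c\<close> and minus one on its right half, so that the
  integral against every cell indicator vanishes.\<close>
definition rz :: "nat \<Rightarrow> real \<Rightarrow> complex" where
  "rz c t = chi (2 * p) (2 * c) t - chi (2 * p) (2 * c + 1) t"

text \<open>On its cell \<open>rz\<close> takes the values 1 and -1 only, so test functions have no
  zeros on their supporting cells although they have mean zero.\<close>

lemma rz_nonzero_iff: "rz c t \<noteq> 0 \<longleftrightarrow> chi p c t = 1"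
proof -
  have e: "real (2 * c) / real (2 * p) = real c / real p"
    "real (Suc (2 * c + 1)) / real (2 * p) = real (Suc c) / real p"
    "real (Suc (2 * c)) / real (2 * p) = real (2 * c + 1) / real (2 * p)"
    using p_pos by (simp_all add: divide_simps)
  have l: "real c / real p < real (2 * c + 1) / real (2 * p)" "real (2 * c + 1) / real (2 * p) < real (Suc c) / real p"
    using p_pos by (simp_all add: divide_simps)
  show ?thesis unfolding rz_def chi_def e using l by auto
qed

lemma chi_mult_chi:
  assumes "0 \<le> t" shows "chi p e t * chi p c t = (if e = c then chi p c t else 0)"
  using chi_eq[OF p_pos assms] by simp

lemma chi_mult_rz:
  assumes "0 \<le> t" shows "chi p e t * rz c t = (if e = c then rz c t else 0)"
proof (cases "rz c t = 0")
  case False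
  then have "chi p c t = 1" by (simp add: rz_nonzero_iff)
  then show ?thesis using chi_eq[OF p_pos assms] by (auto split: if_splits)
qed auto

lemma rz_measurable [measurable]: "rz c \<in> borel_measurable borel"
  unfolding rz_def[abs_def] by measurable

lemma norm_rz_le: "cmod (rz c t) \<le> 1"
  by (simp add: rz_def chi_def)

lemma integral_rz: "c < p \<Longrightarrow> integrable unitI (rz c) \<and> (\<integral>t. rz c t \<partial>unitI) = 0"
  using integral_chi[of "2 * c" "2 * p"] integral_chi[of "2 * c + 1" "2 * p"] by (simp add: rz_def[abs_def])

definition tfac :: "nat set \<Rightarrow> (nat \<Rightarrow> nat) \<Rightarrow> (nat \<Rightarrow> nat) \<Rightarrow> nat \<Rightarrow> real \<Rightarrow> complex" where
  "tfac \<alpha> c d i = (if i \<in> \<alpha> then chi p (d i) else rz (c i))"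

definition tfun :: "nat set \<Rightarrow> (nat \<Rightarrow> nat) \<Rightarrow> (nat \<Rightarrow> nat) \<Rightarrow> pt \<Rightarrow> complex" where
  "tfun \<alpha> c d k = (\<Prod>i<N. tfac \<alpha> c d i (k i))"

text \<open>The basis in which \<open>phi \<alpha> k0\<close> is the matrix of the action. The point
  \<open>k0\<close> matters only through its cell in the variables outside \<alpha>, on which the
  zero-mean factors live.\<close>

definition test :: "nat set \<Rightarrow> pt \<Rightarrow> (nat \<Rightarrow> nat) \<times> nat \<Rightarrow> vfun" where
  "test \<alpha> k0 = (\<lambda>(d, m) k j. if j = m then tfun \<alpha> (cl p ({..<N} - \<alpha>) k0) d k else 0)"

lemma tfac_measurable: "tfac \<alpha> c d i \<in> borel_measurable borel"
  unfolding tfac_def by (cases "i \<in> \<alpha>") (simp_all only: if_True if_False chi_measurable rz_measurable)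

lemma norm_tfac_le: "cmod (tfac \<alpha> c d i t) \<le> 1"
  by (simp add: tfac_def norm_rz_le norm_chi_le)

lemma sqi_tfun: "sqi (tfun \<alpha> c d)"
proof -
  interpret prob_space \<mu> by (rule prob_space_cubeM)
  have "sqi (\<lambda>k. tfun \<alpha> c d k * (\<lambda>_. 1) k)"
  proof (rule sqi_mult(1)[where B = 1])
    show "sqi (\<lambda>_. 1)" by (simp add: sqi_def)
    show "tfun \<alpha> c d \<in> borel_measurable \<mu>"
      unfolding tfun_def[abs_def] by (intro borel_measurable_prod measurable_cubeM_coord tfac_measurable)
    show "cmod (tfun \<alpha> c d k) \<le> 1" for k
      unfolding tfun_def prod_norm[symmetric] by (intro prod_le_1) (auto simp: norm_tfac_le)
  qed
  then show ?thesis by simp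
qed

lemma test_L2: "test \<alpha> k0 a \<in> L2 N M"
proof -
  obtain d m where a: "a = (d, m)" by (cases a)
  have "sqi (\<lambda>k. test \<alpha> k0 a k j)" for j
    by (cases "j = m") (simp_all add: a test_def sqi_tfun, simp add: sqi_def)
  then show ?thesis by (simp add: L2_sqi)
qed

lemma integral_chi_tfac:
  assumes "e < p" "c i < p" "i \<in> \<alpha> \<Longrightarrow> d i < p"
  shows "integrable unitI (\<lambda>t. chi p e t * tfac \<alpha> c d i t)"
    "(\<integral>t. chi p e t * tfac \<alpha> c d i t \<partial>unitI) = (if i \<in> \<alpha> \<and> e = d i then h else 0)"
proof -
  let ?g = "\<lambda>t. if i \<in> \<alpha> then if e = d i then chi p (d i) t else 0 else if e = c i then rz (c i) t else 0"
  have eq: "chi p e t * tfac \<alpha> c d i t = ?g t" if "t \<in> space unitI" for t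
    using that chi_mult_chi[of t e "d i"] chi_mult_rz[of t e "c i"] by (simp add: tfac_def)
  have g: "integrable unitI ?g" "(\<integral>t. ?g t \<partial>unitI) = (if i \<in> \<alpha> \<and> e = d i then h else 0)"
    using assms integral_chi[of "d i" p] integral_rz[of "c i"]
    by (cases "i \<in> \<alpha>"; cases "e = d i"; cases "e = c i"; simp add: h_def)+
  show "integrable unitI (\<lambda>t. chi p e t * tfac \<alpha> c d i t)"
    using Bochner_Integration.integrable_cong[where M = unitI, OF refl eq] g(1) by simp
  have "(\<integral>t. chi p e t * tfac \<alpha> c d i t \<partial>unitI) = (\<integral>t. ?g t \<partial>unitI)"
    by (intro Bochner_Integration.integral_cong refl eq)
  also note g(2)
  finally show "(\<integral>t. chi p e t * tfac \<alpha> c d i t \<partial>unitI) = (if i \<in> \<alpha> \<and> e = d i then h else 0)" .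
qed

text \<open>The integral factorizes over the coordinates of \<beta>. A single coordinate outside
  \<alpha> contributes a factor of mean zero, and a single mismatch between \<open>e\<close> and
  \<open>d\<close> a product of disjoint indicators; either one annihilates the whole.\<close>

lemma W_tfun:
  assumes \<beta>: "\<beta> \<subseteq> {..<N}" and e: "e \<in> cells p \<beta>" and \<alpha>: "\<alpha> \<subseteq> {..<N}" and d: "d \<in> cells p \<alpha>" and c: "c \<in> cells p ({..<N} - \<alpha>)"
  shows "W \<beta> e (tfun \<alpha> c d) k = (if \<beta> \<subseteq> \<alpha> \<and> (\<forall>i\<in>\<beta>. e i = d i) then h ^ card \<beta> * (\<Prod>i\<in>{..<N} - \<beta>. tfac \<alpha> c d i (k i)) else 0)"
proof -
  let ?q = "tfac \<alpha> c d"
  have cp: "c i < p" for i using c p_pos by (cases "i \<in> {..<N} - \<alpha>") (auto simp: cells_def)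
  have dp: "d i < p" for i using d p_pos by (cases "i \<in> \<alpha>") (auto simp: cells_def)
  have ep: "e i < p" if "i \<in> \<beta>" for i using e that by (auto simp: cells_def)
  have fin: "finite \<beta>" using \<beta> by (rule finite_subN)
  have "W \<beta> e (tfun \<alpha> c d) k = (\<integral>x. (\<Prod>i\<in>{..<N} - \<beta>. ?q i (k i)) * (\<Prod>i\<in>\<beta>. chi p (e i) (x i) * ?q i (x i)) \<partial>cubeM \<beta>)"
    unfolding W_def
  proof (intro Bochner_Integration.integral_cong refl)
    fix x
    have "tfun \<alpha> c d (merge k x \<beta>) = (\<Prod>i\<in>({..<N} - \<beta>) \<union> \<beta>. ?q i (merge k x \<beta> i))"
      unfolding tfun_def using \<beta> by (intro prod.cong) auto
    also have "\<dots> = (\<Prod>i\<in>{..<N} - \<beta>. ?q i (merge k x \<beta> i)) * (\<Prod>i\<in>\<beta>. ?q i (merge k x \<beta> i))"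
      using fin by (intro prod.union_disjoint) auto
    also have "\<dots> = (\<Prod>i\<in>{..<N} - \<beta>. ?q i (k i)) * (\<Prod>i\<in>\<beta>. ?q i (x i))"
      by (intro arg_cong2[where f = "(*)"] prod.cong) (auto simp: merge_def)
    finally show "ind p \<beta> e x * tfun \<alpha> c d (merge k x \<beta>) = (\<Prod>i\<in>{..<N} - \<beta>. ?q i (k i)) * (\<Prod>i\<in>\<beta>. chi p (e i) (x i) * ?q i (x i))"
      by (simp add: ind_def prod.distrib)
  qed
  also have "\<dots> = (\<Prod>i\<in>{..<N} - \<beta>. ?q i (k i)) * (\<integral>x. (\<Prod>i\<in>\<beta>. chi p (e i) (x i) * ?q i (x i)) \<partial>cubeM \<beta>)"
    by simp
  also have "(\<integral>x. (\<Prod>i\<in>\<beta>. chi p (e i) (x i) * ?q i (x i)) \<partial>cubeM \<beta>) = (\<Prod>i\<in>\<beta>. \<integral>t. chi p (e i) t * ?q i t \<partial>unitI)"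
    unfolding cubeM_def
    by (rule cub.product_integral_prod[OF fin, of "\<lambda>i t. chi p (e i) t * ?q i t"]) (intro integral_chi_tfac(1) ep cp dp)
  also have "\<dots> = (\<Prod>i\<in>\<beta>. if i \<in> \<alpha> \<and> e i = d i then h else 0)"
    by (intro prod.cong refl integral_chi_tfac(2) ep cp dp)
  also have "\<dots> = (if \<beta> \<subseteq> \<alpha> \<and> (\<forall>i\<in>\<beta>. e i = d i) then h ^ card \<beta> else 0)"
  proof (cases "\<beta> \<subseteq> \<alpha> \<and> (\<forall>i\<in>\<beta>. e i = d i)")
    case True
    then have "(\<Prod>i\<in>\<beta>. if i \<in> \<alpha> \<and> e i = d i then h else 0) = (\<Prod>i\<in>\<beta>. h)"
      by (intro prod.cong) auto
    then show ?thesis using True by simp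
  next
    case False
    then have "\<exists>i\<in>\<beta>. (if i \<in> \<alpha> \<and> e i = d i then h else 0) = 0" by auto
    then have "(\<Prod>i\<in>\<beta>. if i \<in> \<alpha> \<and> e i = d i then h else 0) = 0" using fin by (simp add: prod_zero_iff)
    then show ?thesis unfolding if_not_P[OF False] .
  qed
  finally show ?thesis by (simp add: mult.commute)
qed

lemma prod_chi_eq:
  assumes "S \<subseteq> {..<N}" "k \<in> cube S"
  shows "(\<Prod>i\<in>S. chi p (d i) (k i)) = (if \<forall>i\<in>S. cl p S k i = d i then 1 else 0)"
proof -
  have "chi p (d i) (k i) = (if cl p S k i = d i then 1 else 0)" if "i \<in> S" for i
    using that assms(2) chi_eq[OF p_pos, of "k i"] by (simp add: cube_def cl_def)
  then have "(\<Prod>i\<in>S. chi p (d i) (k i)) = (\<Prod>i\<in>S. if cl p S k i = d i then 1 else 0)"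
    by (intro prod.cong) auto
  also have "\<dots> = (if \<forall>i\<in>S. cl p S k i = d i then 1 else 0)"
    using finite_subN[OF assms(1)] by (auto simp: prod_zero_iff)
  finally show ?thesis .
qed

text \<open>The identity holds at every point of the cube. Where the variables outside \<alpha>
  leave the cell of \<open>k0\<close>, both sides carry the vanishing factor \<open>R\<close>; where
  \<open>R\<close> is nonzero, the kernel at \<open>k\<close> equals the one at \<open>k0\<close>
  used by \<open>phi\<close>.\<close>

lemma opW_test:
  assumes A: "A \<in> Lset N M p" and \<alpha>: "\<alpha> \<subseteq> {..<N}" and k0: "k0 \<in> cube ({..<N} - \<alpha>)" and b: "b \<in> J \<alpha>"
    and k: "k \<in> cube {..<N}" and i: "i < M"
  shows "opW A (test \<alpha> k0 b) k i = (\<Sum>a\<in>J \<alpha>. phi \<alpha> k0 A a b * test \<alpha> k0 a k i)"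
proof -
  obtain d m where b_eq [simp]: "b = (d, m)" by (cases b)
  have d: "d \<in> cells p \<alpha>" and m: "m < M" using b by (auto simp: J_def)
  define c where "c = cl p ({..<N} - \<alpha>) k0"
  have c: "c \<in> cells p ({..<N} - \<alpha>)" unfolding c_def using k0 by (rule cl_in_cells[OF p_pos])
  have fin: "finite \<alpha>" using \<alpha> by (rule finite_subN)
  define R where "R = (\<Prod>i\<in>{..<N} - \<alpha>. rz (c i) (k i))"
  let ?d' = "cl p \<alpha> k"
  have ka: "k \<in> cube \<alpha>" using k \<alpha> by (auto simp: cube_def)
  have d': "?d' \<in> cells p \<alpha>" using ka by (rule cl_in_cells[OF p_pos])
  have split: "(\<Prod>i\<in>{..<N} - \<beta>. tfac \<alpha> c dd i (k i)) = R * (if \<forall>i\<in>\<alpha> - \<beta>. ?d' i = dd i then 1 else 0)"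
    if "\<beta> \<subseteq> \<alpha>" for \<beta> dd
  proof -
    have "{..<N} - \<beta> = ({..<N} - \<alpha>) \<union> (\<alpha> - \<beta>)" using that \<alpha> by auto
    then have "(\<Prod>i\<in>{..<N} - \<beta>. tfac \<alpha> c dd i (k i)) = (\<Prod>i\<in>({..<N} - \<alpha>) \<union> (\<alpha> - \<beta>). tfac \<alpha> c dd i (k i))" by simp
    also have "\<dots> = (\<Prod>i\<in>{..<N} - \<alpha>. tfac \<alpha> c dd i (k i)) * (\<Prod>i\<in>\<alpha> - \<beta>. tfac \<alpha> c dd i (k i))"
      using fin by (intro prod.union_disjoint) auto
    also have "(\<Prod>i\<in>{..<N} - \<alpha>. tfac \<alpha> c dd i (k i)) = R"
      unfolding R_def by (intro prod.cong) (auto simp: tfac_def)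
    also have "(\<Prod>i\<in>\<alpha> - \<beta>. tfac \<alpha> c dd i (k i)) = (\<Prod>i\<in>\<alpha> - \<beta>. chi p (dd i) (k i))"
      by (intro prod.cong) (auto simp: tfac_def)
    also have "\<dots> = (if \<forall>i\<in>\<alpha> - \<beta>. cl p (\<alpha> - \<beta>) k i = dd i then 1 else 0)"
      using \<alpha> ka by (intro prod_chi_eq) (auto simp: cube_def)
    also have "(\<forall>i\<in>\<alpha> - \<beta>. cl p (\<alpha> - \<beta>) k i = dd i) \<longleftrightarrow> (\<forall>i\<in>\<alpha> - \<beta>. ?d' i = dd i)"
      by (simp add: cl_def)
    finally show ?thesis .
  qed
  have tf: "tfun \<alpha> c dd k = R * (if ?d' = dd then 1 else 0)" if "dd \<in> cells p \<alpha>" for dd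
    using split[of "{}" dd] cells_eq_iff[OF d' that] by (simp add: tfun_def)
  have L: "opW A (test \<alpha> k0 b) k i = (\<Sum>\<beta>\<in>Pow \<alpha>. A \<beta> k (cellpt p d) i m * (h ^ card \<beta> * (R * (if \<forall>i\<in>\<alpha> - \<beta>. ?d' i = d i then 1 else 0))))"
  proof -
    have "opW A (test \<alpha> k0 b) k i = (\<Sum>\<beta>\<in>Pow {..<N}. \<Sum>e\<in>cells p \<beta>. A \<beta> k (cellpt p e) i m * W \<beta> e (tfun \<alpha> c d) k)"
      unfolding opW_def
    proof (rule sum.cong[OF refl])
      fix \<beta>
      have "(\<Sum>j<M. \<Sum>e\<in>cells p \<beta>. A \<beta> k (cellpt p e) i j * W \<beta> e (\<lambda>k. test \<alpha> k0 b k j) k)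
        = (\<Sum>j\<in>{m}. \<Sum>e\<in>cells p \<beta>. A \<beta> k (cellpt p e) i j * W \<beta> e (\<lambda>k. test \<alpha> k0 b k j) k)"
        using m by (intro sum.mono_neutral_right) (auto simp: test_def W_def)
      then show "(\<Sum>j<M. \<Sum>e\<in>cells p \<beta>. A \<beta> k (cellpt p e) i j * W \<beta> e (\<lambda>k. test \<alpha> k0 b k j) k)
        = (\<Sum>e\<in>cells p \<beta>. A \<beta> k (cellpt p e) i m * W \<beta> e (tfun \<alpha> c d) k)"
        by (simp add: test_def c_def)
    qed
    also have "\<dots> = (\<Sum>\<beta>\<in>Pow {..<N}. if \<beta> \<subseteq> \<alpha> then A \<beta> k (cellpt p d) i m * (h ^ card \<beta> * (R * (if \<forall>i\<in>\<alpha> - \<beta>. ?d' i = d i then 1 else 0))) else 0)"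
    proof (rule sum.cong[OF refl])
      fix \<beta> assume "\<beta> \<in> Pow {..<N}"
      then have \<beta>: "\<beta> \<subseteq> {..<N}" by simp
      show "(\<Sum>e\<in>cells p \<beta>. A \<beta> k (cellpt p e) i m * W \<beta> e (tfun \<alpha> c d) k) =
        (if \<beta> \<subseteq> \<alpha> then A \<beta> k (cellpt p d) i m * (h ^ card \<beta> * (R * (if \<forall>i\<in>\<alpha> - \<beta>. ?d' i = d i then 1 else 0))) else 0)"
      proof (cases "\<beta> \<subseteq> \<alpha>")
        case False
        then show ?thesis using W_tfun[OF \<beta> _ \<alpha> d c] by simp
      next
        case True
        let ?r = "cres d \<beta>"
        have r: "?r \<in> cells p \<beta>" using cres_in_cells[OF d True] .
        have "(\<forall>i\<in>\<beta>. e i = d i) \<longleftrightarrow> e = ?r" if "e \<in> cells p \<beta>" for e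
          using cells_eq_iff[OF that r] by (simp add: cres_def)
        then have "(\<Sum>e\<in>cells p \<beta>. A \<beta> k (cellpt p e) i m * W \<beta> e (tfun \<alpha> c d) k) =
          (\<Sum>e\<in>cells p \<beta>. if e = ?r then A \<beta> k (cellpt p e) i m * (h ^ card \<beta> * (\<Prod>i\<in>{..<N} - \<beta>. tfac \<alpha> c d i (k i))) else 0)"
          using W_tfun[OF \<beta> _ \<alpha> d c] True by (intro sum.cong refl) simp
        also have "\<dots> = A \<beta> k (cellpt p ?r) i m * (h ^ card \<beta> * (\<Prod>i\<in>{..<N} - \<beta>. tfac \<alpha> c d i (k i)))"
          using r finite_cells[OF finite_subN[OF \<beta>], of p] by simp
        also have "A \<beta> k (cellpt p ?r) i m = A \<beta> k (cellpt p d) i m"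
          by (rule Lset_cell[OF A k k cellpt_in_cube[OF p_pos r] cellpt_in_cube[OF p_pos d] refl])
             (auto simp: cl_cellpt[OF p_pos] cres_def)
        finally show ?thesis using True split[OF True, of d] by simp
      qed
    qed
    also have "\<dots> = (\<Sum>\<beta>\<in>Pow \<alpha>. A \<beta> k (cellpt p d) i m * (h ^ card \<beta> * (R * (if \<forall>i\<in>\<alpha> - \<beta>. ?d' i = d i then 1 else 0))))"
      using \<alpha> by (intro sum.mono_neutral_cong_right) auto
    finally show ?thesis .
  qed
  \<comment> \<open>Indicators of different cells in the variables of \<alpha> are disjoint, so only
    the test function of the cell of \<open>k\<close> and the component \<open>i\<close> survives,
    with value \<open>R\<close>.\<close>
  have "(\<Sum>a\<in>J \<alpha>. phi \<alpha> k0 A a b * test \<alpha> k0 a k i) = (\<Sum>a\<in>{(?d', i)}. phi \<alpha> k0 A a b * test \<alpha> k0 a k i)"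
  proof (rule sum.mono_neutral_right)
    show "\<forall>a\<in>J \<alpha> - {(?d', i)}. phi \<alpha> k0 A a b * test \<alpha> k0 a k i = 0"
    proof
      fix a assume a: "a \<in> J \<alpha> - {(?d', i)}"
      obtain e m' where ae: "a = (e, m')" by (cases a)
      have "test \<alpha> k0 a k i = 0" using a tf[of e] unfolding ae by (auto simp: test_def J_def c_def[symmetric])
      then show "phi \<alpha> k0 A a b * test \<alpha> k0 a k i = 0" by simp
    qed
  qed (use finite_J[OF \<alpha>] d' i in \<open>auto simp: J_def\<close>)
  also have "\<dots> = phi \<alpha> k0 A (?d', i) b * R"
    using tf[OF d'] by (simp add: test_def c_def[symmetric])
  also have "\<dots> = opW A (test \<alpha> k0 b) k i"
  proof (cases "R = 0")
    case True
    then show ?thesis unfolding L by simp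
  next
    case False
    \<comment> \<open>A nonzero product has nonzero factors, and \<open>rz\<close> is nonzero only
      on its own cell, which locates \<open>k\<close> in the cell of \<open>k0\<close>.\<close>
    then have "chi p (c l) (k l) = 1" if "l \<in> {..<N} - \<alpha>" for l
      using that by (auto simp: R_def prod_zero_iff rz_nonzero_iff[symmetric])
    then have "nat \<lfloor>real p * k l\<rfloor> = c l" if "l \<in> {..<N} - \<alpha>" for l
      using that k chi_eq[OF p_pos, of "k l" "c l"] by (auto simp: cube_def split: if_splits)
    then have ck: "cl p ({..<N} - \<alpha>) k = cl p ({..<N} - \<alpha>) k0"
      using c unfolding c_def[symmetric] by (auto simp: cl_def cells_def)
    have "A \<beta> (merge k0 (cellpt p ?d') \<alpha>) (cellpt p d) i m = A \<beta> k (cellpt p d) i m" for \<beta>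
    proof (rule Lset_cell[OF A _ k])
      show "merge k0 (cellpt p ?d') \<alpha> \<in> cube {..<N}" using k0 cellpt_in_cube[OF p_pos d'] by (rule merge_cube)
      have "cl p {..<N} (merge k0 (cellpt p ?d') \<alpha>) = cl p {..<N} (merge k k \<alpha>)"
        using ck \<alpha> by (intro cl_merge_cong) (auto simp: cl_cellpt[OF p_pos] cres_cl)
      then show "cl p {..<N} (merge k0 (cellpt p ?d') \<alpha>) = cl p {..<N} k" by (simp add: merge_def)
    qed (auto intro: cellpt_in_cube[OF p_pos d])
    then show ?thesis unfolding L phi_def by (auto simp: sum_distrib_right intro!: sum.cong)
  qed
  finally show ?thesis by simp
qed

lemma opapp_test:
  assumes A: "A \<in> Lset N M p" and \<alpha>: "\<alpha> \<subseteq> {..<N}" and k0: "k0 \<in> cube ({..<N} - \<alpha>)" and b: "b \<in> J \<alpha>"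
  shows "aeeq N M (opapp N M A (test \<alpha> k0 b)) (\<lambda>k i. \<Sum>a\<in>J \<alpha>. phi \<alpha> k0 A a b * test \<alpha> k0 a k i)"
  unfolding aeeq_def using opapp_AE_opW[OF A test_L2[of \<alpha> k0 b]] AE_space
  by eventually_elim (simp add: opW_test[OF A \<alpha> k0 b] cubeM_in_cube)

text \<open>On the cell \<open>?C\<close> of the whole cube, the test function of \<open>a\<close>
  has no zero, while the others vanish in component \<open>m\<close>. The cell has positive measure,
  so a relation that holds almost everywhere forces the coefficient to vanish.\<close>

lemma test_independent:
  assumes \<alpha>: "\<alpha> \<subseteq> {..<N}" and k0: "k0 \<in> cube ({..<N} - \<alpha>)"
    and z: "aeeq N M (\<lambda>k i. \<Sum>a\<in>J \<alpha>. x a * test \<alpha> k0 a k i) (\<lambda>k i. 0)" and a: "a \<in> J \<alpha>"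
  shows "x a = 0"
proof -
  obtain d m where ae [simp]: "a = (d, m)" by (cases a)
  have d: "d \<in> cells p \<alpha>" and m: "m < M" using a by (auto simp: J_def)
  define c where "c = cl p ({..<N} - \<alpha>) k0"
  have c: "c \<in> cells p ({..<N} - \<alpha>)" unfolding c_def using k0 by (rule cl_in_cells[OF p_pos])
  let ?C = "cmerge c d \<alpha>"
  have C: "?C \<in> cells p {..<N}" using c d \<alpha> by (rule cmerge_in_cells)
  \<comment> \<open>Multiplying by the indicator of the cell and integrating replaces the choice of
    a point outside a null set.\<close>
  have "AE k in \<mu>. ind p {..<N} ?C k * x a = 0"
    using z[unfolded aeeq_def] AE_space
  proof eventually_elim
    case (elim k)
    have kc: "k \<in> cube {..<N}" using elim(2) by (rule cubeM_in_cube)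
    show ?case
    proof (cases "cl p {..<N} k = ?C")
      case False
      then show ?thesis using ind_eq[OF p_pos finite_lessThan kc C] by simp
    next
      case True
      have chi: "chi p e (k l) = (if ?C l = e then 1 else 0)" if "l < N" for l e
      proof -
        have "nat \<lfloor>real p * k l\<rfloor> = ?C l" using fun_cong[OF True, of l] that by (simp add: cl_def)
        then show ?thesis using chi_eq[OF p_pos, of "k l" e] kc that by (simp add: cube_def)
      qed
      have nz: "tfun \<alpha> c d k \<noteq> 0"
        unfolding tfun_def using chi \<alpha> by (auto simp: prod_zero_iff tfac_def rz_nonzero_iff cmerge_def)
      have zz: "tfun \<alpha> c e k = 0" if e: "e \<in> cells p \<alpha>" "e \<noteq> d" for e
      proof -
        have "\<exists>l\<in>\<alpha>. e l \<noteq> d l" using cells_eq_iff[OF e(1) d] e(2) by blast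
        then obtain l where "l \<in> \<alpha>" "e l \<noteq> d l" by blast
        then have "tfac \<alpha> c e l (k l) = 0" "l < N" using chi[of l "e l"] \<alpha> by (auto simp: tfac_def cmerge_def)
        then show ?thesis unfolding tfun_def by (auto simp: prod_zero_iff)
      qed
      have "0 = (\<Sum>a\<in>J \<alpha>. x a * test \<alpha> k0 a k m)" using elim(1) m by simp
      also have "\<dots> = (\<Sum>a\<in>{a}. x a * test \<alpha> k0 a k m)"
      proof (rule sum.mono_neutral_right[OF finite_J[OF \<alpha>]])
        show "\<forall>b\<in>J \<alpha> - {a}. x b * test \<alpha> k0 b k m = 0"
        proof
          fix b assume b: "b \<in> J \<alpha> - {a}"
          obtain e m' where be: "b = (e, m')" by (cases b)
          have "test \<alpha> k0 b k m = 0"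
            using b zz[of e] unfolding be by (auto simp: test_def J_def c_def[symmetric])
          then show "x b * test \<alpha> k0 b k m = 0" by simp
        qed
      qed (use a in auto)
      also have "\<dots> = x a * tfun \<alpha> c d k" by (simp add: test_def c_def)
      finally show ?thesis using nz by simp
    qed
  qed
  then have "(\<integral>k. ind p {..<N} ?C k * x a \<partial>\<mu>) = (\<integral>k. 0 \<partial>\<mu>)"
    by (intro integral_cong_AE) (auto intro!: borel_measurable_times ind_measurable)
  then have "h ^ N * x a = 0" using integral_ind[OF finite_lessThan C] by simp
  then show ?thesis using h_nonzero by simp
qed

lemma aeeq_sym: assumes "aeeq N M u v" shows "aeeq N M v u"
  using assms unfolding aeeq_def by eventually_elim simp

lemma aeeq_trans: assumes "aeeq N M u v" "aeeq N M v w" shows "aeeq N M u w"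
  using assms unfolding aeeq_def by eventually_elim simp

lemma test_coeffs_unique:
  assumes \<alpha>: "\<alpha> \<subseteq> {..<N}" and k0: "k0 \<in> cube ({..<N} - \<alpha>)"
    and z: "aeeq N M (\<lambda>k i. \<Sum>a\<in>J \<alpha>. x a * test \<alpha> k0 a k i) (\<lambda>k i. \<Sum>a\<in>J \<alpha>. y a * test \<alpha> k0 a k i)" and a: "a \<in> J \<alpha>"
  shows "x a = y a"
proof -
  have "aeeq N M (\<lambda>k i. \<Sum>a\<in>J \<alpha>. (x a - y a) * test \<alpha> k0 a k i) (\<lambda>k i. 0)"
    using z unfolding aeeq_def by eventually_elim (simp add: left_diff_distrib sum_subtractf)
  from test_independent[OF \<alpha> k0 this a] show ?thesis by simp
qed

lemma opapp_test_sum: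
  assumes A: "A \<in> Lset N M p" and \<alpha>: "\<alpha> \<subseteq> {..<N}" and k0: "k0 \<in> cube ({..<N} - \<alpha>)"
  shows "aeeq N M (opapp N M A (\<lambda>k i. \<Sum>b\<in>J \<alpha>. v b * test \<alpha> k0 b k i))
     (\<lambda>k i. \<Sum>a\<in>J \<alpha>. (\<Sum>b\<in>J \<alpha>. phi \<alpha> k0 A a b * v b) * test \<alpha> k0 a k i)"
proof -
  have "AE k in \<mu>. \<forall>b\<in>J \<alpha>. \<forall>i<M. opapp N M A (test \<alpha> k0 b) k i = (\<Sum>a\<in>J \<alpha>. phi \<alpha> k0 A a b * test \<alpha> k0 a k i)"
    using finite_J[OF \<alpha>] opapp_test[OF A \<alpha> k0] unfolding aeeq_def by (intro eventually_ball_finite) auto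
  then show ?thesis
    unfolding aeeq_def using opapp_sum[OF A finite_J[OF \<alpha>], where u = "test \<alpha> k0" and c = v, OF test_L2]
  proof eventually_elim
    case (elim k)
    show ?case
    proof (intro allI impI)
      fix i assume i: "i < M"
      have "opapp N M A (\<lambda>k i. \<Sum>b\<in>J \<alpha>. v b * test \<alpha> k0 b k i) k i = (\<Sum>b\<in>J \<alpha>. v b * (\<Sum>a\<in>J \<alpha>. phi \<alpha> k0 A a b * test \<alpha> k0 a k i))"
        using elim i by simp
      also have "\<dots> = (\<Sum>b\<in>J \<alpha>. \<Sum>a\<in>J \<alpha>. phi \<alpha> k0 A a b * v b * test \<alpha> k0 a k i)"
        by (simp only: sum_distrib_left mult_ac)
      also have "\<dots> = (\<Sum>a\<in>J \<alpha>. \<Sum>b\<in>J \<alpha>. phi \<alpha> k0 A a b * v b * test \<alpha> k0 a k i)" by (rule sum.swap)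
      finally show "opapp N M A (\<lambda>k i. \<Sum>b\<in>J \<alpha>. v b * test \<alpha> k0 b k i) k i = (\<Sum>a\<in>J \<alpha>. (\<Sum>b\<in>J \<alpha>. phi \<alpha> k0 A a b * v b) * test \<alpha> k0 a k i)"
        by (simp only: sum_distrib_right)
    qed
  qed
qed

text \<open>Blocks multiply because they are matrices of the action on test functions, whose
  coefficients are unique. The argument uses only that \<open>C\<close> acts as the composite and
  not how it was built, so it also shows that two candidates for the product have equal blocks and
  hence are equal.\<close>

lemma phi_of_product:
  assumes A: "A \<in> Lset N M p" and B: "B \<in> Lset N M p" and C: "C \<in> Lset N M p"
    and op: "\<And>u. u \<in> L2 N M \<Longrightarrow> aeeq N M (opapp N M C u) (opapp N M A (opapp N M B u))"
    and \<alpha>: "\<alpha> \<subseteq> {..<N}" and k0: "k0 \<in> cube ({..<N} - \<alpha>)" and ab: "a \<in> J \<alpha>" "b \<in> J \<alpha>"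
  shows "phi \<alpha> k0 C a b = (\<Sum>c\<in>J \<alpha>. phi \<alpha> k0 A a c * phi \<alpha> k0 B c b)"
proof -
  let ?w = "\<lambda>k i. \<Sum>c\<in>J \<alpha>. phi \<alpha> k0 B c b * test \<alpha> k0 c k i"
  have w: "?w \<in> L2 N M" using finite_J[OF \<alpha>] test_L2 by (intro L2_sum)
  have "aeeq N M (opapp N M A (opapp N M B (test \<alpha> k0 b))) (opapp N M A ?w)"
    using opapp_AE_cong[OF A opapp_L2[OF B test_L2] w opapp_test[OF B \<alpha> k0 ab(2)]]
    unfolding aeeq_def by eventually_elim simp
  then have "aeeq N M (\<lambda>k i. \<Sum>a\<in>J \<alpha>. phi \<alpha> k0 C a b * test \<alpha> k0 a k i)
     (\<lambda>k i. \<Sum>a\<in>J \<alpha>. (\<Sum>c\<in>J \<alpha>. phi \<alpha> k0 A a c * phi \<alpha> k0 B c b) * test \<alpha> k0 a k i)"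
    using aeeq_trans[OF aeeq_trans[OF aeeq_sym[OF opapp_test[OF C \<alpha> k0 ab(2)]] op[OF test_L2]]]
      aeeq_trans[OF _ opapp_test_sum[OF A \<alpha> k0, of "\<lambda>c. phi \<alpha> k0 B c b"]] by blast
  from test_coeffs_unique[OF \<alpha> k0 this ab(1)] show ?thesis .
qed

lemma product_unique:
  assumes A: "A \<in> Lset N M p" and B: "B \<in> Lset N M p"
  shows "\<exists>!C. C \<in> Lset N M p \<and> (\<forall>u\<in>L2 N M. aeeq N M (opapp N M C u) (opapp N M A (opapp N M B u)))"
proof (rule ex_ex1I)
  show "\<exists>C. C \<in> Lset N M p \<and> (\<forall>u\<in>L2 N M. aeeq N M (opapp N M C u) (opapp N M A (opapp N M B u)))"
    using product_exists[OF A B] by blast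
  fix C D
  assume "C \<in> Lset N M p \<and> (\<forall>u\<in>L2 N M. aeeq N M (opapp N M C u) (opapp N M A (opapp N M B u)))"
    and "D \<in> Lset N M p \<and> (\<forall>u\<in>L2 N M. aeeq N M (opapp N M D u) (opapp N M A (opapp N M B u)))"
  then show "C = D"
    using phi_of_product[OF A B] by (intro phi_injective) auto
qed

lemma mulL_spec:
  assumes "A \<in> Lset N M p" "B \<in> Lset N M p"
  shows "mulL N M p A B \<in> Lset N M p \<and>
    (\<forall>u\<in>L2 N M. aeeq N M (opapp N M (mulL N M p A B) u) (opapp N M A (opapp N M B u)))"
  unfolding mulL_def by (rule theI'[OF product_unique[OF assms]])

lemma mulL_Lset: "A \<in> Lset N M p \<Longrightarrow> B \<in> Lset N M p \<Longrightarrow> mulL N M p A B \<in> Lset N M p"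
  by (rule conjunct1[OF mulL_spec])

lemma opapp_mulL:
  "A \<in> Lset N M p \<Longrightarrow> B \<in> Lset N M p \<Longrightarrow> u \<in> L2 N M \<Longrightarrow>
   aeeq N M (opapp N M (mulL N M p A B) u) (opapp N M A (opapp N M B u))"
  by (rule bspec[OF conjunct2[OF mulL_spec]])

lemma phi_mulL:
  assumes "A \<in> Lset N M p" "B \<in> Lset N M p" "\<alpha> \<subseteq> {..<N}" "k \<in> cube ({..<N} - \<alpha>)" "a \<in> J \<alpha>" "b \<in> J \<alpha>"
  shows "phi \<alpha> k (mulL N M p A B) a b = (\<Sum>c\<in>J \<alpha>. phi \<alpha> k A a c * phi \<alpha> k B c b)"
  by (rule phi_of_product[OF assms(1,2) mulL_Lset[OF assms(1,2)] opapp_mulL[OF assms(1,2)] assms(3-6)])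

text \<open>An arbitrary but fixed enumeration, which lets blocks be handled as matrices;
  determinants are unaffected by the choice.\<close>

definition eJ :: "nat set \<Rightarrow> nat \<Rightarrow> (nat \<Rightarrow> nat) \<times> nat" where
  "eJ \<alpha> = (SOME f. bij_betw f {0..<card (J \<alpha>)} (J \<alpha>))"

abbreviation nJ :: "nat set \<Rightarrow> nat" where "nJ \<alpha> \<equiv> card (J \<alpha>)"

definition Phi :: "nat set \<Rightarrow> pt \<Rightarrow> opL \<Rightarrow> complex mat" where
  "Phi \<alpha> k A = mat (nJ \<alpha>) (nJ \<alpha>) (\<lambda>(i, j). phi \<alpha> k A (eJ \<alpha> i) (eJ \<alpha> j))"

lemma eJ_bij: "\<alpha> \<subseteq> {..<N} \<Longrightarrow> bij_betw (eJ \<alpha>) {0..<nJ \<alpha>} (J \<alpha>)"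
  unfolding eJ_def by (rule someI_ex[OF ex_bij_betw_nat_finite[OF finite_J]])

lemma eJ_J: "\<alpha> \<subseteq> {..<N} \<Longrightarrow> i < nJ \<alpha> \<Longrightarrow> eJ \<alpha> i \<in> J \<alpha>"
  using bij_betw_apply[OF eJ_bij, of \<alpha> i] by simp

lemma Phi_carrier [simp]: "Phi \<alpha> k A \<in> carrier_mat (nJ \<alpha>) (nJ \<alpha>)"
  by (simp add: Phi_def)

lemma eJ_surj:
  assumes "\<alpha> \<subseteq> {..<N}" "a \<in> J \<alpha>" obtains i where "i < nJ \<alpha>" "a = eJ \<alpha> i"
proof -
  have "a \<in> eJ \<alpha> ` {0..<nJ \<alpha>}" using assms(2) by (simp only: bij_betw_imp_surj_on[OF eJ_bij[OF assms(1)]])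
  then obtain i where "i \<in> {0..<nJ \<alpha>}" "a = eJ \<alpha> i" by blast
  then show thesis by (intro that[of i]) simp_all
qed

lemma Phi_eq_iff:
  assumes "\<alpha> \<subseteq> {..<N}"
  shows "Phi \<alpha> k A = Phi \<alpha> k' B \<longleftrightarrow> (\<forall>a\<in>J \<alpha>. \<forall>b\<in>J \<alpha>. phi \<alpha> k A a b = phi \<alpha> k' B a b)"
proof
  assume eq: "Phi \<alpha> k A = Phi \<alpha> k' B"
  have "phi \<alpha> k A (eJ \<alpha> i) (eJ \<alpha> j) = phi \<alpha> k' B (eJ \<alpha> i) (eJ \<alpha> j)" if "i < nJ \<alpha>" "j < nJ \<alpha>" for i j
    using arg_cong[OF eq, of "\<lambda>m. m $$ (i, j)"] that by (simp add: Phi_def)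
  moreover have "\<forall>a\<in>J \<alpha>. \<exists>i<nJ \<alpha>. a = eJ \<alpha> i"
    using eJ_surj[OF assms] by blast
  ultimately show "\<forall>a\<in>J \<alpha>. \<forall>b\<in>J \<alpha>. phi \<alpha> k A a b = phi \<alpha> k' B a b" by metis
next
  assume "\<forall>a\<in>J \<alpha>. \<forall>b\<in>J \<alpha>. phi \<alpha> k A a b = phi \<alpha> k' B a b"
  then show "Phi \<alpha> k A = Phi \<alpha> k' B"
    unfolding Phi_def using eJ_J[OF assms] by (intro cong_mat) auto
qed

lemma Phi_mulL:
  assumes "A \<in> Lset N M p" "B \<in> Lset N M p" "\<alpha> \<subseteq> {..<N}" "k \<in> cube ({..<N} - \<alpha>)"
  shows "Phi \<alpha> k (mulL N M p A B) = Phi \<alpha> k A * Phi \<alpha> k B"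
proof (rule eq_matI)
  fix i j assume "i < dim_row (Phi \<alpha> k A * Phi \<alpha> k B)" "j < dim_col (Phi \<alpha> k A * Phi \<alpha> k B)"
  then have ij: "i < nJ \<alpha>" "j < nJ \<alpha>" by (auto simp: Phi_def)
  show "Phi \<alpha> k (mulL N M p A B) $$ (i, j) = (Phi \<alpha> k A * Phi \<alpha> k B) $$ (i, j)"
    using ij phi_mulL[OF assms eJ_J[OF assms(3) ij(1)] eJ_J[OF assms(3) ij(2)]]
    by (simp add: Phi_def scalar_prod_def sum.reindex_bij_betw[OF eJ_bij[OF assms(3)], symmetric])
qed (auto simp: Phi_def)

lemma Phi_id:
  assumes "\<alpha> \<subseteq> {..<N}" "k \<in> cube ({..<N} - \<alpha>)"
  shows "Phi \<alpha> k (idL N M) = 1\<^sub>m (nJ \<alpha>)"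
proof (rule eq_matI)
  fix i j assume "i < dim_row (1\<^sub>m (nJ \<alpha>) :: complex mat)" "j < dim_col (1\<^sub>m (nJ \<alpha>) :: complex mat)"
  then have ij: "i < nJ \<alpha>" "j < nJ \<alpha>" by auto
  have "eJ \<alpha> i = eJ \<alpha> j \<longleftrightarrow> i = j"
    using bij_betw_imp_inj_on[OF eJ_bij[OF assms(1)]] ij by (auto simp: inj_on_def)
  then show "Phi \<alpha> k (idL N M) $$ (i, j) = (1\<^sub>m (nJ \<alpha>)) $$ (i, j)"
    using ij phi_id[OF assms eJ_J[OF assms(1) ij(1)] eJ_J[OF assms(1) ij(2)]] by (simp add: Phi_def)
qed (auto simp: Phi_def)

lemma det_Phi: "\<alpha> \<subseteq> {..<N} \<Longrightarrow> det (Phi \<alpha> k A) = det_on (J \<alpha>) (phi \<alpha> k A)"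
  unfolding Phi_def by (rule det_mat_reindex[OF eJ_bij])

text \<open>Invertibility expressed in finite linear algebra: every block is nonsingular.
  Factorization and determinant are developed from this condition.\<close>

definition regular :: "opL \<Rightarrow> bool" where
  "regular A \<longleftrightarrow> A \<in> Lset N M p \<and> (\<forall>\<alpha> k. \<alpha> \<subseteq> {..<N} \<longrightarrow> k \<in> cube ({..<N} - \<alpha>) \<longrightarrow> det (Phi \<alpha> k A) \<noteq> 0)"

text \<open>A kernel vector of a block gives a combination of test functions that the operator
  annihilates. Applying the inverse shows that the combination is 0 almost everywhere, against the
  independence of the test functions.\<close>

lemma InvL_regular:
  assumes "A \<in> InvL N M p" shows "regular A"
proof -
  have A: "A \<in> Lset N M p" using assms by (simp add: InvL_def)
  obtain T where T2: "\<And>u v. u \<in> L2 N M \<Longrightarrow> v \<in> L2 N M \<Longrightarrow> aeeq N M u v \<Longrightarrow> aeeq N M (T u) (T v)"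
    and T3: "\<And>u v c d. u \<in> L2 N M \<Longrightarrow> v \<in> L2 N M \<Longrightarrow> aeeq N M (T (\<lambda>k j. c * u k j + d * v k j)) (\<lambda>k j. c * T u k j + d * T v k j)"
    and T4: "\<And>u. u \<in> L2 N M \<Longrightarrow> aeeq N M (T (opapp N M A u)) u"
    using assms unfolding InvL_def by blast
  have "det (Phi \<alpha> k A) \<noteq> 0" if \<alpha>: "\<alpha> \<subseteq> {..<N}" and k: "k \<in> cube ({..<N} - \<alpha>)" for \<alpha> k
  proof
    assume "det (Phi \<alpha> k A) = 0"
    then obtain v where v: "v \<in> carrier_vec (nJ \<alpha>)" "v \<noteq> 0\<^sub>v (nJ \<alpha>)" "Phi \<alpha> k A *\<^sub>v v = 0\<^sub>v (nJ \<alpha>)"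
      using det_0_iff_vec_prod_zero_field[OF Phi_carrier] by blast
    define y where "y a = v $ (inv_into {0..<nJ \<alpha>} (eJ \<alpha>) a)" for a
    have y: "y (eJ \<alpha> i) = v $ i" if "i < nJ \<alpha>" for i
      unfolding y_def using bij_betw_imp_inj_on[OF eJ_bij[OF \<alpha>]] that by simp
    have ker: "(\<Sum>b\<in>J \<alpha>. phi \<alpha> k A a b * y b) = 0" if a: "a \<in> J \<alpha>" for a
    proof -
      obtain i where i: "i < nJ \<alpha>" "a = eJ \<alpha> i" by (rule eJ_surj[OF \<alpha> a])
      have "(\<Sum>b\<in>J \<alpha>. phi \<alpha> k A a b * y b) = (\<Sum>j = 0..<nJ \<alpha>. phi \<alpha> k A (eJ \<alpha> i) (eJ \<alpha> j) * v $ j)"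
        unfolding sum.reindex_bij_betw[OF eJ_bij[OF \<alpha>], symmetric] i using y by simp
      also have "\<dots> = (Phi \<alpha> k A *\<^sub>v v) $ i" using i v(1) by (simp add: Phi_def scalar_prod_def)
      finally show ?thesis using v(3) i by simp
    qed
    let ?u = "\<lambda>j i. \<Sum>b\<in>J \<alpha>. y b * test \<alpha> k b j i"
    let ?z = "\<lambda>(k::pt) (i::nat). 0 :: complex"
    have u: "?u \<in> L2 N M" using finite_J[OF \<alpha>] test_L2 by (intro L2_sum)
    have z: "?z \<in> L2 N M" by (simp add: L2_def)
    have "aeeq N M (opapp N M A ?u) ?z"
      using opapp_test_sum[OF A \<alpha> k, of y] unfolding aeeq_def by eventually_elim (simp add: ker)
    then have "aeeq N M (T (opapp N M A ?u)) (T ?z)" by (intro T2 opapp_L2 A u z)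
    \<comment> \<open>Linearity with both scalars equal to 0 yields \<open>T 0 = 0\<close>.\<close>
    moreover have "aeeq N M (T ?z) ?z" using T3[OF z z, of 0 0] by simp
    ultimately have "aeeq N M ?u ?z" using T4[OF u] aeeq_sym aeeq_trans by blast
    then have "y b = 0" if "b \<in> J \<alpha>" for b using test_independent[OF \<alpha> k _ that] by blast
    then have "v $ i = 0" if "i < nJ \<alpha>" for i using y[OF that] eJ_J[OF \<alpha> that] by simp
    then have "v = 0\<^sub>v (nJ \<alpha>)" using v(1) by (intro eq_vecI) auto
    then show False using v(2) by simp
  qed
  then show ?thesis using A by (simp add: regular_def)
qed

section \<open>The identity and two-sided inverses in the algebra\<close>

lemma opapp_id: "k \<in> space \<mu> \<Longrightarrow> i < M \<Longrightarrow> opapp N M (idL N M) u k i = u k i"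
proof -
  assume k: "k \<in> space \<mu>" and i: "i < M"
  have kc: "k \<in> cube {..<N}" using k by (rule cubeM_in_cube)
  interpret prob_space "cubeM {}" by (rule prob_space_cubeM)
  have "opapp N M (idL N M) u k i = (\<Sum>\<alpha>\<in>{{}}. \<Sum>j<M. \<integral>x. idL N M \<alpha> k x i j * u (merge k x \<alpha>) j \<partial>cubeM \<alpha>)"
    unfolding opapp_def by (intro sum.mono_neutral_right) (auto simp: idL_def)
  also have "\<dots> = (\<Sum>j<M. \<integral>x. idL N M {} k x i j * u (merge k x {}) j \<partial>cubeM {})" by simp
  also have "\<dots> = (\<Sum>j<M. if j = i then u k i else 0)"
    using kc i by (intro sum.cong refl) (simp add: idL_def prob_space)
  also have "\<dots> = u k i" using i by simp
  finally show ?thesis .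
qed

lemma InvL_I:
  assumes A: "A \<in> Lset N M p" and H: "H \<in> Lset N M p"
    and AH: "mulL N M p A H = idL N M" and HA: "mulL N M p H A = idL N M"
  shows "A \<in> InvL N M p"
proof -
  have id: "aeeq N M (opapp N M (idL N M) u) u" for u
    unfolding aeeq_def using AE_space by eventually_elim (simp add: opapp_id)
  show ?thesis
    unfolding InvL_def
  proof (intro CollectI conjI A exI[of _ "opapp N M H"] ballI impI allI)
    show "opapp N M H u \<in> L2 N M" if "u \<in> L2 N M" for u by (rule opapp_L2[OF H that])
    show "aeeq N M (opapp N M H u) (opapp N M H v)" if "u \<in> L2 N M" "v \<in> L2 N M" "aeeq N M u v" for u v
      using opapp_AE_cong[OF H that] unfolding aeeq_def by eventually_elim simp
    show "\<exists>C. \<forall>u\<in>L2 N M. L2norm N M (opapp N M H u) \<le> C * L2norm N M u" by (rule opapp_bounded[OF H])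
    show "aeeq N M (opapp N M A (opapp N M H u)) u" if "u \<in> L2 N M" for u
      using opapp_mulL[OF A H that] id[of u] aeeq_sym aeeq_trans unfolding AH by blast
    show "aeeq N M (opapp N M H (opapp N M A u)) u" if "u \<in> L2 N M" for u
      using opapp_mulL[OF H A that] id[of u] aeeq_sym aeeq_trans unfolding HA by blast
    fix u v c d assume uv: "u \<in> L2 N M" "v \<in> L2 N M"
    \<comment> \<open>A sum over \<open>bool\<close> casts a two-term linear combination in the form
      of \<open>opapp_sum\<close>.\<close>
    have "(\<lambda>t. if t then u else v) t \<in> L2 N M" for t using uv by simp
    note opapp_sum[OF H finite_class.finite_UNIV[where 'a = bool], where u = "\<lambda>t. if t then u else v" and c = "\<lambda>t. if t then c else d", OF this]
    then show "aeeq N M (opapp N M H (\<lambda>k j. c * u k j + d * v k j)) (\<lambda>k j. c * opapp N M H u k j + d * opapp N M H v k j)"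
      unfolding aeeq_def by eventually_elim (simp add: UNIV_bool add.commute)
  qed
qed

end

section \<open>Factorization\<close>

lemma mat_inverse_exists:
  fixes X :: "complex mat"
  assumes "X \<in> carrier_mat n n" "det X \<noteq> 0"
  shows "\<exists>Y. Y \<in> carrier_mat n n \<and> Y * X = 1\<^sub>m n \<and> X * Y = 1\<^sub>m n"
proof -
  have "X \<in> Units (ring_mat TYPE(complex) n ())" by (rule det_non_zero_imp_unit[OF assms])
  then show ?thesis by (auto simp: Units_def ring_mat_def)
qed

definition minv :: "complex mat \<Rightarrow> complex mat" where
  "minv X = (SOME Y. Y \<in> carrier_mat (dim_row X) (dim_row X) \<and> Y * X = 1\<^sub>m (dim_row X) \<and> X * Y = 1\<^sub>m (dim_row X))"

lemma minv:
  assumes "X \<in> carrier_mat n n" "det X \<noteq> 0"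
  shows "minv X \<in> carrier_mat n n" "minv X * X = 1\<^sub>m n" "X * minv X = 1\<^sub>m n" "det (minv X) \<noteq> 0"
proof -
  have n: "dim_row X = n" using assms by simp
  have *: "minv X \<in> carrier_mat n n \<and> minv X * X = 1\<^sub>m n \<and> X * minv X = 1\<^sub>m n"
    unfolding minv_def n by (rule someI_ex[OF mat_inverse_exists[OF assms]])
  then show "minv X \<in> carrier_mat n n" "minv X * X = 1\<^sub>m n" "X * minv X = 1\<^sub>m n" by auto
  have "det (minv X) * det X = det (minv X * X)"
    using * assms(1) by (intro det_mult[symmetric]) auto
  also have "\<dots> = 1" using * by simp
  finally show "det (minv X) \<noteq> 0" by auto
qed

text \<open>In the block at \<gamma> the factor at \<gamma> stands between the factors that precede
  it and those that follow it. Cancelling invertible outer matrices gives its uniqueness, and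
  \<open>mat_solve\<close> gives its existence.\<close>

lemma mat_cancel:
  fixes X Y P Q :: "complex mat"
  assumes c: "X \<in> carrier_mat n n" "Y \<in> carrier_mat n n" "P \<in> carrier_mat n n" "Q \<in> carrier_mat n n"
    and d: "det X \<noteq> 0" "det Y \<noteq> 0" and eq: "X * (P * Y) = X * (Q * Y)"
  shows "P = Q"
proof -
  have "minv X * (X * (R * Y)) * minv Y = R" if R: "R \<in> carrier_mat n n" for R
  proof -
    have "minv X * (X * (R * Y)) = (minv X * X) * (R * Y)"
      using minv(1)[OF c(1) d(1)] c R by (intro assoc_mult_mat[symmetric]) auto
    also have "\<dots> = R * Y" unfolding minv(2)[OF c(1) d(1)] using c R by (intro left_mult_one_mat) auto
    finally have "minv X * (X * (R * Y)) * minv Y = R * Y * minv Y" by simp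
    also have "\<dots> = R * (Y * minv Y)"
      using minv(1)[OF c(2) d(2)] c R by (intro assoc_mult_mat) auto
    also have "\<dots> = R" unfolding minv(3)[OF c(2) d(2)] using R by simp
    finally show ?thesis .
  qed
  then show ?thesis using eq c by metis
qed

lemma mat_solve:
  fixes X Y P :: "complex mat"
  assumes c: "X \<in> carrier_mat n n" "Y \<in> carrier_mat n n" "P \<in> carrier_mat n n"
    and d: "det X \<noteq> 0" "det Y \<noteq> 0"
  shows "X * ((minv X * P * minv Y) * Y) = P"
proof -
  note mX = minv[OF c(1) d(1)] and mY = minv[OF c(2) d(2)]
  have "(minv X * P * minv Y) * Y = minv X * P * (minv Y * Y)"
    using mX(1) mY(1) c by (intro assoc_mult_mat) auto
  also have "\<dots> = minv X * P" unfolding mY(2) using mX(1) c by (intro right_mult_one_mat) auto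
  finally have "X * ((minv X * P * minv Y) * Y) = X * (minv X * P)" by simp
  also have "\<dots> = X * minv X * P" using mX(1) c by (intro assoc_mult_mat[symmetric]) auto
  also have "\<dots> = P" unfolding mX(3) using c by simp
  finally show ?thesis .
qed

context staircase_algebra
begin

lemma Phi_elementary_not_subset:
  assumes "elementary \<alpha> A" "\<gamma> \<subseteq> {..<N}" "\<not> \<alpha> \<subseteq> \<gamma>" "k \<in> cube ({..<N} - \<gamma>)"
  shows "Phi \<gamma> k A = 1\<^sub>m (nJ \<gamma>)"
  unfolding Phi_id[OF assms(2,4), symmetric] Phi_eq_iff[OF assms(2)]
  using phi_elementary_not_subset[OF assms(1-3)] by blast

lemma Phi_cell_cong:
  assumes "A \<in> Lset N M p" "\<alpha> \<subseteq> {..<N}" "k \<in> cube ({..<N} - \<alpha>)" "k' \<in> cube ({..<N} - \<alpha>)"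
    "cl p ({..<N} - \<alpha>) k = cl p ({..<N} - \<alpha>) k'"
  shows "Phi \<alpha> k A = Phi \<alpha> k' A"
  unfolding Phi_eq_iff[OF assms(2)] using phi_cell_cong[OF assms] by blast

lemma Phi_injective:
  assumes "A \<in> Lset N M p" "B \<in> Lset N M p"
    "\<And>\<gamma> k. \<gamma> \<subseteq> {..<N} \<Longrightarrow> k \<in> cube ({..<N} - \<gamma>) \<Longrightarrow> Phi \<gamma> k A = Phi \<gamma> k B"
  shows "A = B"
proof (rule phi_injective[OF assms(1,2)])
  fix \<gamma> k a b assume "\<gamma> \<subseteq> {..<N}" "k \<in> cube ({..<N} - \<gamma>)" "a \<in> J \<gamma>" "b \<in> J \<gamma>"
  then show "phi \<gamma> k A a b = phi \<gamma> k B a b" using assms(3)[of \<gamma> k] Phi_eq_iff[of \<gamma> k A k B] by blast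
qed

definition elemM :: "nat set \<Rightarrow> (pt \<Rightarrow> complex mat) \<Rightarrow> opL" where
  "elemM \<alpha> X = elemL \<alpha> (\<lambda>k a b. X k $$ (inv_into {0..<nJ \<alpha>} (eJ \<alpha>) a, inv_into {0..<nJ \<alpha>} (eJ \<alpha>) b))"

lemma elemM:
  assumes \<alpha>: "\<alpha> \<subseteq> {..<N}"
    and X: "\<And>k k'. k \<in> cube ({..<N} - \<alpha>) \<Longrightarrow> k' \<in> cube ({..<N} - \<alpha>) \<Longrightarrow>
       cl p ({..<N} - \<alpha>) k = cl p ({..<N} - \<alpha>) k' \<Longrightarrow> X k = X k'"
  shows "elementary \<alpha> (elemM \<alpha> X)"
    and "k \<in> cube ({..<N} - \<alpha>) \<Longrightarrow> X k \<in> carrier_mat (nJ \<alpha>) (nJ \<alpha>) \<Longrightarrow> Phi \<alpha> k (elemM \<alpha> X) = X k"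
proof -
  let ?i = "inv_into {0..<nJ \<alpha>} (eJ \<alpha>)"
  have XX: "X k $$ (?i a, ?i b) = X k' $$ (?i a, ?i b)"
    if "k \<in> cube ({..<N} - \<alpha>)" "k' \<in> cube ({..<N} - \<alpha>)" "cl p ({..<N} - \<alpha>) k = cl p ({..<N} - \<alpha>) k'" for k k' a b
    using X[OF that] by simp
  show "elementary \<alpha> (elemM \<alpha> X)" unfolding elemM_def by (rule elem_elementary[OF \<alpha> XX])
  assume k: "k \<in> cube ({..<N} - \<alpha>)" and c: "X k \<in> carrier_mat (nJ \<alpha>) (nJ \<alpha>)"
  show "Phi \<alpha> k (elemM \<alpha> X) = X k"
  proof (rule eq_matI)
    fix i j assume "i < dim_row (X k)" "j < dim_col (X k)"
    then have ij: "i < nJ \<alpha>" "j < nJ \<alpha>" using c by auto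
    have inv: "?i (eJ \<alpha> l) = l" if "l < nJ \<alpha>" for l
      using bij_betw_imp_inj_on[OF eJ_bij[OF \<alpha>]] that by simp
    have "Phi \<alpha> k (elemM \<alpha> X) $$ (i, j) = phi \<alpha> k (elemM \<alpha> X) (eJ \<alpha> i) (eJ \<alpha> j)"
      using ij by (simp add: Phi_def)
    also have "\<dots> = X k $$ (?i (eJ \<alpha> i), ?i (eJ \<alpha> j))"
      unfolding elemM_def
      by (rule phi_elem[OF \<alpha>, where X = "\<lambda>k a b. X k $$ (?i a, ?i b)", OF XX k eJ_J[OF \<alpha> ij(1)] eJ_J[OF \<alpha> ij(2)]])
    also have "\<dots> = X k $$ (i, j)" using inv ij by simp
    finally show "Phi \<alpha> k (elemM \<alpha> X) $$ (i, j) = X k $$ (i, j)" .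
  qed (use c in \<open>auto simp: Phi_def\<close>)
qed

text \<open>Both matrices are diagonal in the spectator cells, so their product in a large block
  reduces to the product in the block at \<alpha> with the same frozen parameters.\<close>

lemma phi_elementary_mult:
  assumes A: "elementary \<alpha> A" and B: "elementary \<alpha> B" and \<gamma>: "\<gamma> \<subseteq> {..<N}" and n: "\<alpha> \<subseteq> \<gamma>"
    and k: "k \<in> cube ({..<N} - \<gamma>)" and d: "d' \<in> cells p \<gamma>" "d \<in> cells p \<gamma>"
  shows "(\<Sum>c\<in>J \<gamma>. phi \<gamma> k A (d', i) c * phi \<gamma> k B c (d, j)) = (if \<forall>l\<in>\<gamma> - \<alpha>. d' l = d l
     then \<Sum>c\<in>J \<alpha>. phi \<alpha> (merge k (cellpt p d') (\<gamma> - \<alpha>)) A (cres d' \<alpha>, i) c *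
                  phi \<alpha> (merge k (cellpt p d') (\<gamma> - \<alpha>)) B c (cres d \<alpha>, j) else 0)"
proof -
  let ?K = "merge k (cellpt p d') (\<gamma> - \<alpha>)"
  let ?r = "cres d' (\<gamma> - \<alpha>)"
  have r: "?r \<in> cells p (\<gamma> - \<alpha>)" using d(1) by (rule cres_in_cells) auto
  have fin: "finite (cells p (\<gamma> - \<alpha>))" using finite_subN[OF \<gamma>] by (intro finite_cells) auto
  have "(\<Sum>c\<in>J \<gamma>. phi \<gamma> k A (d', i) c * phi \<gamma> k B c (d, j)) =
     (\<Sum>e\<in>cells p \<gamma>. \<Sum>m<M. phi \<gamma> k A (d', i) (e, m) * phi \<gamma> k B (e, m) (d, j))"
    unfolding J_def sum.cartesian_product by (simp add: case_prod_unfold)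
  also have "\<dots> = (\<Sum>e1\<in>cells p (\<gamma> - \<alpha>). \<Sum>e2\<in>cells p \<alpha>. \<Sum>m<M.
      phi \<gamma> k A (d', i) (cmerge e1 e2 \<alpha>, m) * phi \<gamma> k B (cmerge e1 e2 \<alpha>, m) (d, j))"
    by (rule sum_cells_split[OF n])
  \<comment> \<open>The first factor forces the intermediate spectator cell to be that of
    \<open>d'\<close>, so the sum over \<open>e1\<close> collapses to \<open>?r\<close>.\<close>
  also have "\<dots> = (\<Sum>e1\<in>cells p (\<gamma> - \<alpha>). if e1 = ?r then (\<Sum>e2\<in>cells p \<alpha>. \<Sum>m<M.
      if \<forall>l\<in>\<gamma> - \<alpha>. d' l = d l then phi \<alpha> ?K A (cres d' \<alpha>, i) (e2, m) * phi \<alpha> ?K B (e2, m) (cres d \<alpha>, j) else 0) else 0)"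
  proof (rule sum.cong[OF refl])
    fix e1 assume e1: "e1 \<in> cells p (\<gamma> - \<alpha>)"
    have e1r: "(\<forall>l\<in>\<gamma> - \<alpha>. d' l = e1 l) \<longleftrightarrow> e1 = ?r"
      using cells_eq_iff[OF e1 r] by (auto simp: cres_def)
    have term_eq: "phi \<gamma> k A (d', i) (cmerge e1 e2 \<alpha>, m) * phi \<gamma> k B (cmerge e1 e2 \<alpha>, m) (d, j) =
       (if e1 = ?r then if \<forall>l\<in>\<gamma> - \<alpha>. d' l = d l then phi \<alpha> ?K A (cres d' \<alpha>, i) (e2, m) * phi \<alpha> ?K B (e2, m) (cres d \<alpha>, j) else 0 else 0)"
      if e2: "e2 \<in> cells p \<alpha>" for e2 m
    proof -
      have c: "cmerge e1 e2 \<alpha> \<in> cells p \<gamma>" using e1 e2 n by (rule cmerge_in_cells)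
      have a1: "(\<forall>l\<in>\<gamma> - \<alpha>. d' l = cmerge e1 e2 \<alpha> l) \<longleftrightarrow> e1 = ?r" using e1r by (simp add: cmerge_def)
      have a2: "cres (cmerge e1 e2 \<alpha>) \<alpha> = e2" by (rule cres_cmerge[OF e2])
      have a3: "merge k (cellpt p (cmerge ?r e2 \<alpha>)) (\<gamma> - \<alpha>) = ?K"
        by (auto simp: merge_def cellpt_def cmerge_def cres_def fun_eq_iff)
      have a4: "(\<forall>l\<in>\<gamma> - \<alpha>. cmerge ?r e2 \<alpha> l = d l) \<longleftrightarrow> (\<forall>l\<in>\<gamma> - \<alpha>. d' l = d l)" by (simp add: cmerge_def cres_def)
      have pA: "phi \<gamma> k A (d', i) (cmerge e1 e2 \<alpha>, m) = (if e1 = ?r then phi \<alpha> ?K A (cres d' \<alpha>, i) (e2, m) else 0)"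
        using phi_elementary_subset[OF A \<gamma> n k d(1) c] unfolding a1 a2 .
      show ?thesis
      proof (cases "e1 = ?r")
        case True
        have "phi \<gamma> k B (cmerge e1 e2 \<alpha>, m) (d, j) = (if \<forall>l\<in>\<gamma> - \<alpha>. d' l = d l then phi \<alpha> ?K B (e2, m) (cres d \<alpha>, j) else 0)"
          using phi_elementary_subset[OF B \<gamma> n k c d(2), of m j] a2 unfolding True a3 a4 by simp
        then show ?thesis using pA True by simp
      next
        case False
        then show ?thesis using pA by simp
      qed
    qed
    show "(\<Sum>e2\<in>cells p \<alpha>. \<Sum>m<M. phi \<gamma> k A (d', i) (cmerge e1 e2 \<alpha>, m) * phi \<gamma> k B (cmerge e1 e2 \<alpha>, m) (d, j)) =
      (if e1 = ?r then (\<Sum>e2\<in>cells p \<alpha>. \<Sum>m<M.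
        if \<forall>l\<in>\<gamma> - \<alpha>. d' l = d l then phi \<alpha> ?K A (cres d' \<alpha>, i) (e2, m) * phi \<alpha> ?K B (e2, m) (cres d \<alpha>, j) else 0) else 0)"
    proof -
      have "(\<Sum>e2\<in>cells p \<alpha>. \<Sum>m<M. phi \<gamma> k A (d', i) (cmerge e1 e2 \<alpha>, m) * phi \<gamma> k B (cmerge e1 e2 \<alpha>, m) (d, j)) =
        (\<Sum>e2\<in>cells p \<alpha>. \<Sum>m<M. if e1 = ?r then if \<forall>l\<in>\<gamma> - \<alpha>. d' l = d l
          then phi \<alpha> ?K A (cres d' \<alpha>, i) (e2, m) * phi \<alpha> ?K B (e2, m) (cres d \<alpha>, j) else 0 else 0)"
        by (intro sum.cong refl term_eq)
      also have "\<dots> = (if e1 = ?r then (\<Sum>e2\<in>cells p \<alpha>. \<Sum>m<M.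
        if \<forall>l\<in>\<gamma> - \<alpha>. d' l = d l then phi \<alpha> ?K A (cres d' \<alpha>, i) (e2, m) * phi \<alpha> ?K B (e2, m) (cres d \<alpha>, j) else 0) else 0)"
      proof (cases "e1 = ?r")
        case True
        show ?thesis unfolding if_P[OF True] ..
      next
        case False
        show ?thesis unfolding if_not_P[OF False] by simp
      qed
      finally show ?thesis .
    qed
  qed
  also have "\<dots> = (\<Sum>e2\<in>cells p \<alpha>. \<Sum>m<M.
      if \<forall>l\<in>\<gamma> - \<alpha>. d' l = d l then phi \<alpha> ?K A (cres d' \<alpha>, i) (e2, m) * phi \<alpha> ?K B (e2, m) (cres d \<alpha>, j) else 0)"
    using fin r by (simp only: sum.delta if_True)
  also have "\<dots> = (if \<forall>l\<in>\<gamma> - \<alpha>. d' l = d l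
     then \<Sum>c\<in>J \<alpha>. phi \<alpha> ?K A (cres d' \<alpha>, i) c * phi \<alpha> ?K B c (cres d \<alpha>, j) else 0)"
  proof (cases "\<forall>l\<in>\<gamma> - \<alpha>. d' l = d l")
    case True
    show ?thesis unfolding if_P[OF True] J_def sum.cartesian_product by (simp add: case_prod_unfold)
  next
    case False
    show ?thesis unfolding if_not_P[OF False] by simp
  qed
  finally show ?thesis .
qed

lemma merge_cell_cube:
  assumes "\<gamma> \<subseteq> {..<N}" "\<alpha> \<subseteq> \<gamma>" "k \<in> cube ({..<N} - \<gamma>)" "d \<in> cells p S"
  shows "merge k (cellpt p d) (\<gamma> - \<alpha>) \<in> cube ({..<N} - \<alpha>)"
  using assms(3) cellpt_in_cube[OF p_pos assms(4), of UNIV] by (auto simp: cube_def merge_def)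

text \<open>The block at \<alpha> decides everything: blocks that are not above \<alpha> are the
  identity for both factors, and those above it reduce to the block at \<alpha> for each spectator
  cell.\<close>

lemma elementary_mult_id:
  assumes A: "elementary \<alpha> A" and B: "elementary \<alpha> B" and \<alpha>: "\<alpha> \<subseteq> {..<N}"
    and one: "\<And>k. k \<in> cube ({..<N} - \<alpha>) \<Longrightarrow> Phi \<alpha> k A * Phi \<alpha> k B = 1\<^sub>m (nJ \<alpha>)"
  shows "mulL N M p A B = idL N M"
proof (rule phi_injective)
  have AL: "A \<in> Lset N M p" and BL: "B \<in> Lset N M p" using A B by (auto simp: elementary_def)
  show "mulL N M p A B \<in> Lset N M p" by (rule mulL_Lset[OF AL BL])
  have one': "(\<Sum>c\<in>J \<alpha>. phi \<alpha> k A a c * phi \<alpha> k B c b) = (if a = b then 1 else 0)"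
    if k: "k \<in> cube ({..<N} - \<alpha>)" and ab: "a \<in> J \<alpha>" "b \<in> J \<alpha>" for k a b
  proof -
    have "Phi \<alpha> k (mulL N M p A B) = Phi \<alpha> k (idL N M)"
      unfolding Phi_mulL[OF AL BL \<alpha> k] one[OF k] Phi_id[OF \<alpha> k] ..
    then have "phi \<alpha> k (mulL N M p A B) a b = phi \<alpha> k (idL N M) a b"
      using Phi_eq_iff[OF \<alpha>] ab by blast
    then show ?thesis using phi_mulL[OF AL BL \<alpha> k ab] phi_id[OF \<alpha> k ab] by simp
  qed
  fix \<gamma> k a b assume \<gamma>: "\<gamma> \<subseteq> {..<N}" and k: "k \<in> cube ({..<N} - \<gamma>)" and ab: "a \<in> J \<gamma>" "b \<in> J \<gamma>"
  show "phi \<gamma> k (mulL N M p A B) a b = phi \<gamma> k (idL N M) a b"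
  proof (cases "\<alpha> \<subseteq> \<gamma>")
    case False
    have "Phi \<gamma> k (mulL N M p A B) = Phi \<gamma> k (idL N M)"
      unfolding Phi_mulL[OF AL BL \<gamma> k] Phi_id[OF \<gamma> k] Phi_elementary_not_subset[OF A \<gamma> False k]
        Phi_elementary_not_subset[OF B \<gamma> False k] by simp
    then show ?thesis using Phi_eq_iff[OF \<gamma>] ab by blast
  next
    case n: True
    obtain d' i d j where ab_eq: "a = (d', i)" "b = (d, j)" by (cases a, cases b)
    have d: "d' \<in> cells p \<gamma>" "d \<in> cells p \<gamma>" and ij: "i < M" "j < M" using ab by (auto simp: ab_eq J_def)
    let ?K = "merge k (cellpt p d') (\<gamma> - \<alpha>)"
    have K: "?K \<in> cube ({..<N} - \<alpha>)" by (rule merge_cell_cube[OF \<gamma> n k d(1)])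
    have J: "(cres d' \<alpha>, i) \<in> J \<alpha>" "(cres d \<alpha>, j) \<in> J \<alpha>" using d ij cres_in_cells[OF _ n] by (auto simp: J_def)
    have "phi \<gamma> k (mulL N M p A B) a b = (if \<forall>l\<in>\<gamma> - \<alpha>. d' l = d l then if (cres d' \<alpha>, i) = (cres d \<alpha>, j) then 1 else 0 else 0)"
      unfolding phi_mulL[OF AL BL \<gamma> k ab] unfolding ab_eq phi_elementary_mult[OF A B \<gamma> n k d] one'[OF K J] ..
    also have "\<dots> = (if a = b then 1 else 0)"
    proof -
      have "(\<forall>l\<in>\<gamma>. d' l = d l) \<longleftrightarrow> (\<forall>l\<in>\<gamma> - \<alpha>. d' l = d l) \<and> (\<forall>l\<in>\<alpha>. d' l = d l)" using n by auto
      moreover have "(\<forall>l\<in>\<alpha>. d' l = d l) \<longleftrightarrow> cres d' \<alpha> = cres d \<alpha>"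
        using cells_eq_iff[OF cres_in_cells[OF d(1) n] cres_in_cells[OF d(2) n]] by (simp add: cres_def)
      ultimately have "d' = d \<longleftrightarrow> (\<forall>l\<in>\<gamma> - \<alpha>. d' l = d l) \<and> cres d' \<alpha> = cres d \<alpha>"
        using cells_eq_iff[OF d] by blast
      then show ?thesis unfolding ab_eq by simp
    qed
    finally show ?thesis using phi_id[OF \<gamma> k ab] by simp
  qed
qed (rule idL_Lset)

text \<open>The inverse is the elementary element whose block at \<alpha> is the inverse matrix.
  This prescription is constant on cells because equal blocks receive the same chosen inverse, so it
  defines staircase coefficients.\<close>

lemma elementary_InvL:
  assumes A: "elementary \<alpha> A" and \<alpha>: "\<alpha> \<subseteq> {..<N}"
    and nz: "\<And>k. k \<in> cube ({..<N} - \<alpha>) \<Longrightarrow> det (Phi \<alpha> k A) \<noteq> 0"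
  shows "A \<in> InvL N M p"
proof -
  have AL: "A \<in> Lset N M p" using A by (simp add: elementary_def)
  let ?X = "\<lambda>k. minv (Phi \<alpha> k A)"
  have X: "?X k = ?X k'" if "k \<in> cube ({..<N} - \<alpha>)" "k' \<in> cube ({..<N} - \<alpha>)" "cl p ({..<N} - \<alpha>) k = cl p ({..<N} - \<alpha>) k'" for k k'
    using Phi_cell_cong[OF AL \<alpha> that] by simp
  have H: "elementary \<alpha> (elemM \<alpha> ?X)" by (rule elemM(1)[OF \<alpha> X])
  have P: "Phi \<alpha> k (elemM \<alpha> ?X) = minv (Phi \<alpha> k A)" if k: "k \<in> cube ({..<N} - \<alpha>)" for k
    by (rule elemM(2)[where X = ?X, OF \<alpha> X k minv(1)[OF Phi_carrier nz[OF k]]])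
  have HL: "elemM \<alpha> ?X \<in> Lset N M p" using H by (simp add: elementary_def)
  show ?thesis
  proof (rule InvL_I[OF AL HL])
    show "mulL N M p A (elemM \<alpha> ?X) = idL N M"
      by (rule elementary_mult_id[OF A H \<alpha>]) (simp_all add: P minv(3)[OF Phi_carrier nz])
    show "mulL N M p (elemM \<alpha> ?X) A = idL N M"
      by (rule elementary_mult_id[OF H A \<alpha>]) (simp_all add: P minv(2)[OF Phi_carrier nz])
  qed
qed

section \<open>Ordered products of factors and their blocks\<close>

definition PP :: "nat set \<Rightarrow> pt \<Rightarrow> nat set list \<Rightarrow> (nat set \<Rightarrow> opL) \<Rightarrow> complex mat" where
  "PP \<gamma> k xs G = foldr (\<lambda>\<alpha> X. Phi \<gamma> k (G \<alpha>) * X) xs (1\<^sub>m (nJ \<gamma>))"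

lemma PP_Nil [simp]: "PP \<gamma> k [] G = 1\<^sub>m (nJ \<gamma>)" by (simp add: PP_def)
lemma PP_Cons [simp]: "PP \<gamma> k (\<alpha> # xs) G = Phi \<gamma> k (G \<alpha>) * PP \<gamma> k xs G" by (simp add: PP_def)

lemma PP_carrier [simp]: "PP \<gamma> k xs G \<in> carrier_mat (nJ \<gamma>) (nJ \<gamma>)"
  by (induction xs) (auto intro!: mult_carrier_mat[where n = "nJ \<gamma>"])

lemma PP_append: "PP \<gamma> k (xs @ ys) G = PP \<gamma> k xs G * PP \<gamma> k ys G"
proof (induction xs)
  case Nil
  then show ?case using left_mult_one_mat[OF PP_carrier] by simp
next
  case (Cons \<alpha> xs)
  then show ?case using assoc_mult_mat[OF Phi_carrier PP_carrier PP_carrier, of \<gamma> k "G \<alpha>" k xs G k ys G] by simp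
qed

lemma PP_cong: "(\<And>\<alpha>. \<alpha> \<in> set xs \<Longrightarrow> Phi \<gamma> k (G \<alpha>) = Phi \<gamma> k' (G' \<alpha>)) \<Longrightarrow> PP \<gamma> k xs G = PP \<gamma> k' xs G'"
  by (induction xs) auto

lemma det_PP: "distinct xs \<Longrightarrow> det (PP \<gamma> k xs G) = (\<Prod>\<alpha>\<in>set xs. det (Phi \<gamma> k (G \<alpha>)))"
proof (induction xs)
  case (Cons \<alpha> xs)
  have "det (PP \<gamma> k (\<alpha> # xs) G) = det (Phi \<gamma> k (G \<alpha>)) * det (PP \<gamma> k xs G)"
    unfolding PP_Cons by (rule det_mult[OF Phi_carrier PP_carrier])
  then show ?case using Cons by simp
qed simp

lemma prodL_Lset: "(\<And>\<alpha>. \<alpha> \<in> set xs \<Longrightarrow> G \<alpha> \<in> Lset N M p) \<Longrightarrow> prodL N M p xs G \<in> Lset N M p"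
  unfolding prodL_def by (induction xs) (auto intro: idL_Lset mulL_Lset)

lemma Phi_prodL:
  assumes "\<gamma> \<subseteq> {..<N}" "k \<in> cube ({..<N} - \<gamma>)"
  shows "(\<And>\<alpha>. \<alpha> \<in> set xs \<Longrightarrow> G \<alpha> \<in> Lset N M p) \<Longrightarrow> Phi \<gamma> k (prodL N M p xs G) = PP \<gamma> k xs G"
proof (induction xs)
  case Nil
  then show ?case using Phi_id[OF assms] by (simp add: prodL_def)
next
  case (Cons \<alpha> xs)
  then have "Phi \<gamma> k (mulL N M p (G \<alpha>) (prodL N M p xs G)) = Phi \<gamma> k (G \<alpha>) * Phi \<gamma> k (prodL N M p xs G)"
    using assms by (intro Phi_mulL prodL_Lset) auto
  then show ?case using Cons by (simp add: prodL_def)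
qed

lemma regular_elementary:
  assumes A: "elementary \<alpha> A" and \<alpha>: "\<alpha> \<subseteq> {..<N}"
    and nz: "\<And>k. k \<in> cube ({..<N} - \<alpha>) \<Longrightarrow> det (Phi \<alpha> k A) \<noteq> 0"
  shows "regular A"
  by (rule InvL_regular[OF elementary_InvL[OF assms]])

text \<open>Restates \<open>factorization\<close> uniformly in \<alpha>: the pointwise determinant
  condition at {} and operator invertibility at the other sets both become nonsingularity of
  blocks.\<close>

definition factors :: "(nat set \<Rightarrow> opL) \<Rightarrow> bool" where
  "factors G \<longleftrightarrow> (\<forall>\<alpha>. \<not> \<alpha> \<subseteq> {..<N} \<longrightarrow> G \<alpha> = idL N M) \<and> (\<forall>\<alpha>. \<alpha> \<subseteq> {..<N} \<longrightarrow> elementary \<alpha> (G \<alpha>) \<and> regular (G \<alpha>))"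

lemma det_on_M_phi:
  "det_on {..<M} (\<lambda>i j. A {} k (\<lambda>_. 0) i j) = det_on (J {}) (phi {} k A)"
proof -
  have "bij_betw (\<lambda>m. (\<lambda>_. 0, m)) {..<M} (J {})"
    by (auto simp: bij_betw_def inj_on_def J_def)
  then have "det_on (J {}) (phi {} k A) = det_on {..<M} (\<lambda>i j. phi {} k A (\<lambda>_. 0, i) (\<lambda>_. 0, j))"
    by (rule det_on_reindex) simp
  then show ?thesis by (simp add: phi_def cellpt_def)
qed

text \<open>For an elementary element only the components at {} and \<alpha> enter its own block.
  The former contributes the identity matrix and the latter the finite-rank kernel with weight
  \<open>h ^ card \<alpha>\<close>, which is the matrix of the Fredholm determinant.\<close>

lemma fdet_phi:
  assumes A: "elementary \<alpha> A" and \<alpha>: "\<alpha> \<subseteq> {..<N}" "\<alpha> \<noteq> {}" and k: "k \<in> cube ({..<N} - \<alpha>)"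
  shows "fdet M p \<alpha> k (A \<alpha>) = det_on (J \<alpha>) (phi \<alpha> k A)"
  unfolding fdet_def J_def[symmetric]
proof (rule det_on_cong)
  fix a b assume ab: "a \<in> J \<alpha>" "b \<in> J \<alpha>"
  obtain d' i d j where ab_eq: "a = (d', i)" "b = (d, j)" by (cases a, cases b)
  have d: "d' \<in> cells p \<alpha>" "d \<in> cells p \<alpha>" and ij: "i < M" "j < M" using ab by (auto simp: ab_eq J_def)
  let ?K = "merge k (cellpt p d') \<alpha>"
  let ?t = "\<lambda>\<beta>. if \<forall>l\<in>\<alpha> - \<beta>. d' l = d l then h ^ card \<beta> * A \<beta> ?K (cellpt p d) i j else 0"
  have K: "?K \<in> cube {..<N}" using k cellpt_in_cube[OF p_pos d(1)] by (rule merge_cube)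
  have "phi \<alpha> k A a b = (\<Sum>\<beta>\<in>Pow \<alpha>. ?t \<beta>)" by (simp add: phi_def ab_eq)
  also have "\<dots> = (\<Sum>\<beta>\<in>{{}, \<alpha>}. ?t \<beta>)"
  proof (rule sum.mono_neutral_right)
    show "\<forall>\<beta>\<in>Pow \<alpha> - {{}, \<alpha>}. ?t \<beta> = 0"
      using A by (simp add: elementary_def zeroL_def)
  qed (use finite_subN[OF \<alpha>(1)] in auto)
  also have "\<dots> = (if a = b then 1 else 0) + h ^ card \<alpha> * A \<alpha> ?K (cellpt p d) i j"
    using A \<alpha>(2) K ij cells_eq_iff[OF d] by (auto simp: elementary_def idL_def ab_eq)
  finally show "(case a of (d', m') \<Rightarrow> \<lambda>(d, m). (if (d', m') = (d, m) then 1 else 0) +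
      of_real ((1 / real p) ^ card \<alpha>) * A \<alpha> (merge k (cellpt p d') \<alpha>) (cellpt p d) m' m) b = phi \<alpha> k A a b"
    by (simp add: ab_eq h_def)
qed

lemma factorization_factors: "factorization N M p G \<longleftrightarrow> factors G"
proof
  assume F: "factorization N M p G"
  have "elementary \<alpha> (G \<alpha>) \<and> regular (G \<alpha>)" if \<alpha>: "\<alpha> \<subseteq> {..<N}" for \<alpha>
  proof (cases "\<alpha> = {}")
    case True
    have e: "elementary {} (G {})" using F by (simp add: factorization_def elementary_def)
    have "det (Phi {} k (G {})) \<noteq> 0" if "k \<in> cube ({..<N} - {})" for k
    proof -
      have "det_on {..<M} (\<lambda>i j. G {} {} k (\<lambda>_. 0) i j) \<noteq> 0" using F that by (simp add: factorization_def)
      then show ?thesis unfolding det_on_M_phi det_Phi[OF empty_subsetI] .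
    qed
    then show ?thesis using e regular_elementary[OF e] True by simp
  next
    case False
    then have "G \<alpha> \<in> InvL N M p" using F \<alpha> by (simp add: factorization_def)
    moreover from this have "G \<alpha> \<in> Lset N M p" by (simp add: InvL_def)
    ultimately show ?thesis using F \<alpha> False by (simp add: factorization_def elementary_def InvL_regular)
  qed
  then show "factors G" using F by (simp add: factors_def factorization_def)
next
  assume F: "factors G"
  have e: "elementary {} (G {})" "regular (G {})" using F by (auto simp: factors_def)
  have L: "G {} \<in> Lset N M p" using e by (simp add: elementary_def)
  have d1: "det_on {..<M} (\<lambda>i j. G {} {} k (\<lambda>_. 0) i j) \<noteq> 0" if "k \<in> cube {..<N}" for k
    unfolding det_on_M_phi det_Phi[OF empty_subsetI, symmetric]
    using e(2)[unfolded regular_def, THEN conjunct2, rule_format, of "{}" k] that by simp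
  have d2: "G \<alpha> \<in> InvL N M p \<and> G \<alpha> {} = idL N M {} \<and> (\<forall>\<beta>. \<beta> \<noteq> {} \<and> \<beta> \<noteq> \<alpha> \<longrightarrow> G \<alpha> \<beta> = zeroL)"
    if "\<alpha> \<subseteq> {..<N}" "\<alpha> \<noteq> {}" for \<alpha>
  proof -
    have "elementary \<alpha> (G \<alpha>)" "regular (G \<alpha>)" using F that by (auto simp: factors_def)
    then show ?thesis using elementary_InvL[of \<alpha> "G \<alpha>"] that by (auto simp: elementary_def regular_def)
  qed
  have a: "\<forall>\<alpha>. \<not> \<alpha> \<subseteq> {..<N} \<longrightarrow> G \<alpha> = idL N M" using F by (simp add: factors_def)
  have c: "\<forall>\<beta>. \<beta> \<noteq> {} \<longrightarrow> G {} \<beta> = zeroL" using e(1) by (simp add: elementary_def)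
  show "factorization N M p G"
    unfolding factorization_def using d1 d2 by (intro conjI a L c ballI allI impI) simp_all
qed

lemma factors_Lset: "factors G \<Longrightarrow> G \<alpha> \<in> Lset N M p"
  using idL_Lset by (cases "\<alpha> \<subseteq> {..<N}") (auto simp: factors_def regular_def)

lemma Phi_factors_det:
  assumes F: "factors G" and "\<gamma> \<subseteq> {..<N}" "k \<in> cube ({..<N} - \<gamma>)"
  shows "det (Phi \<gamma> k (G \<alpha>)) \<noteq> 0"
proof (cases "\<alpha> \<subseteq> {..<N}")
  case True
  then show ?thesis using assms by (simp add: factors_def regular_def)
next
  case False
  then have "G \<alpha> = idL N M" using F by (simp add: factors_def)
  then show ?thesis using Phi_id[OF assms(2,3)] by simp
qed

lemma det_PP_factors:
  assumes F: "factors G" and "\<gamma> \<subseteq> {..<N}" "k \<in> cube ({..<N} - \<gamma>)" "distinct xs"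
  shows "det (PP \<gamma> k xs G) \<noteq> 0"
  unfolding det_PP[OF assms(4)] using Phi_factors_det[OF assms(1-3)] by (simp add: prod_zero_iff)

text \<open>The block at \<open>\<gamma>\<close> sees only the factors below \<open>\<gamma>\<close>, so the factor at \<open>\<gamma>\<close> is obtained
  from the smaller ones by cancellation, whatever the order of the product.\<close>
lemma factors_unique:
  assumes F: "factors G" "factors G'" and ord: "set ord = Pow {..<N}" "distinct ord"
    and eq: "prodL N M p ord G = prodL N M p ord G'"
  shows "G = G'"
proof -
  have "G \<gamma> = G' \<gamma>" if "\<gamma> \<subseteq> {..<N}" for \<gamma>
    using that
  proof (induction "card \<gamma>" arbitrary: \<gamma> rule: less_induct)
    case less
    note \<gamma> = less.prems
    have e: "elementary \<gamma> (G \<gamma>)" "elementary \<gamma> (G' \<gamma>)" using F \<gamma> by (auto simp: factors_def)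
    have "\<gamma> \<in> set ord" using \<gamma> ord by auto
    then obtain xs ys where o: "ord = xs @ \<gamma> # ys" by (meson split_list)
    have P: "Phi \<gamma> k (G \<gamma>) = Phi \<gamma> k (G' \<gamma>)" if k: "k \<in> cube ({..<N} - \<gamma>)" for k
    proof -
      have same: "Phi \<gamma> k (G \<alpha>) = Phi \<gamma> k (G' \<alpha>)" if \<alpha>: "\<alpha> \<in> set xs \<union> set ys" for \<alpha>
      proof -
        have \<alpha>N: "\<alpha> \<subseteq> {..<N}" "\<alpha> \<noteq> \<gamma>" using \<alpha> o ord by auto
        have ea: "elementary \<alpha> (G \<alpha>)" "elementary \<alpha> (G' \<alpha>)" using F \<alpha>N by (auto simp: factors_def)
        show ?thesis
        proof (cases "\<alpha> \<subseteq> \<gamma>")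
          case True
          then have "card \<alpha> < card \<gamma>" using \<alpha>N finite_subN[OF \<gamma>] by (intro psubset_card_mono) auto
          then show ?thesis using less.hyps \<alpha>N by simp
        next
          case False
          then show ?thesis
            using Phi_elementary_not_subset[OF ea(1) \<gamma> False k] Phi_elementary_not_subset[OF ea(2) \<gamma> False k] by simp
        qed
      qed
      have X: "PP \<gamma> k xs G = PP \<gamma> k xs G'" "PP \<gamma> k ys G = PP \<gamma> k ys G'"
        using same by (auto intro!: PP_cong)
      have "PP \<gamma> k ord G = PP \<gamma> k ord G'"
        using arg_cong[OF eq, of "Phi \<gamma> k"] Phi_prodL[OF \<gamma> k, of ord G] Phi_prodL[OF \<gamma> k, of ord G'] factors_Lset F by simp
      then have "PP \<gamma> k xs G * (Phi \<gamma> k (G \<gamma>) * PP \<gamma> k ys G) = PP \<gamma> k xs G * (Phi \<gamma> k (G' \<gamma>) * PP \<gamma> k ys G)"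
        unfolding o PP_append PP_Cons using X by simp
      then show ?thesis
        using det_PP_factors[OF F(1) \<gamma> k] ord(2) unfolding o by (intro mat_cancel[OF PP_carrier PP_carrier Phi_carrier Phi_carrier]) auto
    qed
    have "G \<gamma> \<gamma> = G' \<gamma> \<gamma>"
    proof (rule phi_determines_component[OF factors_Lset[OF F(1)] factors_Lset[OF F(2)] \<gamma>])
      show "G \<gamma> \<beta> = G' \<gamma> \<beta>" if "\<beta> \<subset> \<gamma>" for \<beta>
        using e that by (cases "\<beta> = {}") (auto simp: elementary_def)
      show "phi \<gamma> k (G \<gamma>) a b = phi \<gamma> k (G' \<gamma>) a b" if "k \<in> cube ({..<N} - \<gamma>)" "a \<in> J \<gamma>" "b \<in> J \<gamma>" for k a b
        using P[OF that(1)] Phi_eq_iff[OF \<gamma>] that by blast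
    qed
    then have "G \<gamma> \<beta> = G' \<gamma> \<beta>" for \<beta>
      using e by (cases "\<beta> = \<gamma>"; cases "\<beta> = {}") (auto simp: elementary_def)
    then show ?case by blast
  qed
  moreover have "G \<gamma> = G' \<gamma>" if "\<not> \<gamma> \<subseteq> {..<N}" for \<gamma> using F that by (simp add: factors_def)
  ultimately show ?thesis by blast
qed

text \<open>Factors are corrected level by level. At level \<open>n\<close> all factors at sets of
  size \<open>n\<close> are replaced simultaneously so that the blocks of that size match those of
  \<open>A\<close>. Smaller blocks and the other blocks of size \<open>n\<close> contain none of the
  sets concerned, so they do not see the change.\<close>

lemma factors_exist:
  assumes A: "regular A" and ord: "set ord = Pow {..<N}" "distinct ord"
  shows "\<exists>G. factors G \<and> prodL N M p ord G = A"
proof -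
  have AL: "A \<in> Lset N M p" using A by (simp add: regular_def)
  have "\<exists>G. factors G \<and> (\<forall>\<gamma> k. \<gamma> \<subseteq> {..<N} \<longrightarrow> card \<gamma> < n \<longrightarrow> k \<in> cube ({..<N} - \<gamma>) \<longrightarrow> PP \<gamma> k ord G = Phi \<gamma> k A)" for n
  proof (induction n)
    case 0
    have "regular (idL N M)" using idL_Lset Phi_id by (simp add: regular_def)
    moreover have "elementary \<alpha> (idL N M)" for \<alpha>
      using idL_Lset by (auto simp: elementary_def idL_def zeroL_def fun_eq_iff)
    ultimately have "factors (\<lambda>_. idL N M)" by (simp add: factors_def)
    then show ?case by auto
  next
    case (Suc n)
    then obtain G where G: "factors G"
      and GA: "\<And>\<gamma> k. \<gamma> \<subseteq> {..<N} \<Longrightarrow> card \<gamma> < n \<Longrightarrow> k \<in> cube ({..<N} - \<gamma>) \<Longrightarrow> PP \<gamma> k ord G = Phi \<gamma> k A" by blast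
    have "\<exists>xs ys. ord = xs @ \<alpha> # ys" if "\<alpha> \<subseteq> {..<N}" for \<alpha> using that ord split_list[of \<alpha> ord] by auto
    then obtain xs ys where o: "\<And>\<alpha>. \<alpha> \<subseteq> {..<N} \<Longrightarrow> ord = xs \<alpha> @ \<alpha> # ys \<alpha>" by metis
    \<comment> \<open>The block that the factor at \<alpha> must have, given the factors before and
      after it in the list.\<close>
    define X where "X \<alpha> k = minv (PP \<alpha> k (xs \<alpha>) G) * Phi \<alpha> k A * minv (PP \<alpha> k (ys \<alpha>) G)" for \<alpha> k
    define G' where "G' \<alpha> = (if \<alpha> \<subseteq> {..<N} \<and> card \<alpha> = n then elemM \<alpha> (X \<alpha>) else G \<alpha>)" for \<alpha>
    have dist: "distinct (xs \<alpha>)" "distinct (ys \<alpha>)" "\<alpha> \<notin> set (xs \<alpha>)" "\<alpha> \<notin> set (ys \<alpha>)"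
      "set (xs \<alpha>) \<subseteq> Pow {..<N}" "set (ys \<alpha>) \<subseteq> Pow {..<N}" if "\<alpha> \<subseteq> {..<N}" for \<alpha>
    proof -
      have "distinct (xs \<alpha> @ \<alpha> # ys \<alpha>)" "set (xs \<alpha> @ \<alpha> # ys \<alpha>) = Pow {..<N}" using ord o[OF that] by simp_all
      then show "distinct (xs \<alpha>)" "distinct (ys \<alpha>)" "\<alpha> \<notin> set (xs \<alpha>)" "\<alpha> \<notin> set (ys \<alpha>)"
        "set (xs \<alpha>) \<subseteq> Pow {..<N}" "set (ys \<alpha>) \<subseteq> Pow {..<N}" by auto
    qed
    \<comment> \<open>Constancy on cells is what makes the element with block
      \<open>X \<alpha>\<close> a member of the algebra.\<close>
    have Xc: "X \<alpha> k = X \<alpha> k'" if "\<alpha> \<subseteq> {..<N}" "k \<in> cube ({..<N} - \<alpha>)" "k' \<in> cube ({..<N} - \<alpha>)"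
      "cl p ({..<N} - \<alpha>) k = cl p ({..<N} - \<alpha>) k'" for \<alpha> k k'
    proof -
      have "PP \<alpha> k zs G = PP \<alpha> k' zs G" for zs
        by (rule PP_cong) (rule Phi_cell_cong[OF factors_Lset[OF G] that])
      then show ?thesis unfolding X_def using Phi_cell_cong[OF AL that] by simp
    qed
    have Xd: "X \<alpha> k \<in> carrier_mat (nJ \<alpha>) (nJ \<alpha>)" "det (X \<alpha> k) \<noteq> 0"
      "PP \<alpha> k (xs \<alpha>) G * (X \<alpha> k * PP \<alpha> k (ys \<alpha>) G) = Phi \<alpha> k A"
      if \<alpha>: "\<alpha> \<subseteq> {..<N}" and k: "k \<in> cube ({..<N} - \<alpha>)" for \<alpha> k
    proof -
      note dx = det_PP_factors[OF G \<alpha> k dist(1)[OF \<alpha>]] and dy = det_PP_factors[OF G \<alpha> k dist(2)[OF \<alpha>]]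
      note mx = minv[OF PP_carrier dx] and my = minv[OF PP_carrier dy]
      have dA: "det (Phi \<alpha> k A) \<noteq> 0" using A \<alpha> k by (simp add: regular_def)
      have c: "minv (PP \<alpha> k (xs \<alpha>) G) * Phi \<alpha> k A \<in> carrier_mat (nJ \<alpha>) (nJ \<alpha>)"
        by (rule mult_carrier_mat[OF mx(1) Phi_carrier])
      show "X \<alpha> k \<in> carrier_mat (nJ \<alpha>) (nJ \<alpha>)" unfolding X_def by (rule mult_carrier_mat[OF c my(1)])
      show "det (X \<alpha> k) \<noteq> 0"
        unfolding X_def det_mult[OF c my(1)] det_mult[OF mx(1) Phi_carrier] using mx(4) my(4) dA by simp
      show "PP \<alpha> k (xs \<alpha>) G * (X \<alpha> k * PP \<alpha> k (ys \<alpha>) G) = Phi \<alpha> k A"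
        unfolding X_def by (rule mat_solve[OF PP_carrier PP_carrier Phi_carrier dx dy])
    qed
    have el: "elementary \<alpha> (elemM \<alpha> (X \<alpha>))" if "\<alpha> \<subseteq> {..<N}" for \<alpha>
      by (rule elemM(1)[OF that Xc[OF that]])
    have PX: "Phi \<alpha> k (elemM \<alpha> (X \<alpha>)) = X \<alpha> k" if "\<alpha> \<subseteq> {..<N}" "k \<in> cube ({..<N} - \<alpha>)" for \<alpha> k
      by (rule elemM(2)[where X = "X \<alpha>", OF that(1) Xc[OF that(1)] that(2) Xd(1)[OF that]])
    have G': "factors G'"
      unfolding factors_def
    proof (intro conjI allI impI)
      fix \<alpha> show "\<not> \<alpha> \<subseteq> {..<N} \<Longrightarrow> G' \<alpha> = idL N M" using G by (simp add: G'_def factors_def)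
      assume \<alpha>: "\<alpha> \<subseteq> {..<N}"
      have g: "elementary \<alpha> (G \<alpha>)" "regular (G \<alpha>)" using G \<alpha> by (auto simp: factors_def)
      have "regular (elemM \<alpha> (X \<alpha>))"
        by (rule regular_elementary[OF el[OF \<alpha>] \<alpha>]) (simp add: PX[OF \<alpha>] Xd(2)[OF \<alpha>])
      then show "elementary \<alpha> (G' \<alpha>)" "regular (G' \<alpha>)" using el[OF \<alpha>] g by (auto simp: G'_def)
    qed
    have same: "Phi \<gamma> k (G' \<alpha>) = Phi \<gamma> k (G \<alpha>)"
      if \<gamma>: "\<gamma> \<subseteq> {..<N}" "card \<gamma> \<le> n" and k: "k \<in> cube ({..<N} - \<gamma>)" and \<alpha>: "\<alpha> \<subseteq> {..<N}" "card \<gamma> = n \<Longrightarrow> \<alpha> \<noteq> \<gamma>" for \<gamma> k \<alpha>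
    proof (cases "card \<alpha> = n")
      case True
      have n: "\<not> \<alpha> \<subseteq> \<gamma>"
      proof
        assume "\<alpha> \<subseteq> \<gamma>"
        then have "\<alpha> = \<gamma>" using True \<gamma>(2) finite_subN[OF \<gamma>(1)] by (intro card_seteq) auto
        then show False using True \<alpha>(2) by simp
      qed
      have "elementary \<alpha> (G \<alpha>)" using G \<alpha> by (simp add: factors_def)
      then show ?thesis
        using Phi_elementary_not_subset[OF _ \<gamma>(1) n k] el[OF \<alpha>(1)] by (simp add: G'_def)
    next
      case False
      then show ?thesis by (simp add: G'_def)
    qed
    have "PP \<gamma> k ord G' = Phi \<gamma> k A" if \<gamma>: "\<gamma> \<subseteq> {..<N}" "card \<gamma> < Suc n" and k: "k \<in> cube ({..<N} - \<gamma>)" for \<gamma> k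
    proof (cases "card \<gamma> = n")
      case False
      then have c: "card \<gamma> < n" using \<gamma> by simp
      have "PP \<gamma> k ord G' = PP \<gamma> k ord G"
        using ord c by (intro PP_cong same \<gamma> k) auto
      then show ?thesis using GA[OF \<gamma>(1) c k] by simp
    next
      case True
      have pp: "PP \<gamma> k zs G' = PP \<gamma> k zs G" if "\<gamma> \<notin> set zs" "set zs \<subseteq> Pow {..<N}" for zs
        using that True by (intro PP_cong same \<gamma>(1) k) auto
      have "PP \<gamma> k ord G' = PP \<gamma> k (xs \<gamma>) G' * (Phi \<gamma> k (G' \<gamma>) * PP \<gamma> k (ys \<gamma>) G')"
        using o[OF \<gamma>(1)] by (simp only: PP_append PP_Cons)
      also have "\<dots> = PP \<gamma> k (xs \<gamma>) G * (X \<gamma> k * PP \<gamma> k (ys \<gamma>) G)"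
        using pp dist[OF \<gamma>(1)] PX[OF \<gamma>(1) k] \<gamma>(1) True by (simp add: G'_def)
      also have "\<dots> = Phi \<gamma> k A" by (rule Xd(3)[OF \<gamma>(1) k])
      finally show ?thesis .
    qed
    then show ?case using G' by blast
  qed
  \<comment> \<open>Every subset of \<open>{..<N}\<close> has fewer than \<open>Suc N\<close>
    elements, so at this stage all blocks agree.\<close>
  from this[of "Suc N"] obtain G where G: "factors G"
    and GA: "\<And>\<gamma> k. \<gamma> \<subseteq> {..<N} \<Longrightarrow> card \<gamma> < Suc N \<Longrightarrow> k \<in> cube ({..<N} - \<gamma>) \<Longrightarrow> PP \<gamma> k ord G = Phi \<gamma> k A" by blast
  have "prodL N M p ord G = A"
  proof (rule Phi_injective[OF prodL_Lset AL])
    fix \<gamma> k assume \<gamma>: "\<gamma> \<subseteq> {..<N}" and k: "k \<in> cube ({..<N} - \<gamma>)"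
    have "card \<gamma> < Suc N" using card_mono[OF finite_lessThan \<gamma>] by simp
    then show "Phi \<gamma> k (prodL N M p ord G) = Phi \<gamma> k A"
      using GA[OF \<gamma> _ k] Phi_prodL[OF \<gamma> k factors_Lset[OF G]] by simp
  qed (rule factors_Lset[OF G])
  then show ?thesis using G by blast
qed

text \<open>Existence and uniqueness of the factors give meaning to the description inside
  \<open>piL\<close>; the two cases of its definition then become one formula, the determinant of
  the factor's own block.\<close>

lemma piL_factors:
  assumes A: "regular A" and ord: "set ord = Pow {..<N}" "distinct ord"
  shows "\<exists>G. factors G \<and> prodL N M p ord G = A \<and>
    (\<forall>\<alpha> k. \<alpha> \<subseteq> {..<N} \<longrightarrow> k \<in> cube ({..<N} - \<alpha>) \<longrightarrow> piL N M p ord A \<alpha> k = det (Phi \<alpha> k (G \<alpha>)))"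
proof -
  obtain G where G: "factors G" "prodL N M p ord G = A" using factors_exist[OF assms] by blast
  have "(THE G. factorization N M p G \<and> prodL N M p ord G = A) = G"
  proof (rule the_equality)
    show "factorization N M p G \<and> prodL N M p ord G = A" using G by (simp add: factorization_factors)
    show "G' = G" if "factorization N M p G' \<and> prodL N M p ord G' = A" for G'
      using factors_unique[OF _ G(1) ord, of G'] that G(2) by (simp add: factorization_factors)
  qed
  then have pi: "piL N M p ord A \<alpha> k = (if \<alpha> = {} then det_on {..<M} (\<lambda>i j. G {} {} k (\<lambda>_. 0) i j)
               else fdet M p \<alpha> k (G \<alpha> \<alpha>))" for \<alpha> k
    by (simp add: piL_def)
  have "piL N M p ord A \<alpha> k = det (Phi \<alpha> k (G \<alpha>))" if \<alpha>: "\<alpha> \<subseteq> {..<N}" and k: "k \<in> cube ({..<N} - \<alpha>)" for \<alpha> k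
  proof (cases "\<alpha> = {}")
    case True
    then show ?thesis using det_on_M_phi[of "G {}" k] by (simp add: pi det_Phi)
  next
    case False
    have "elementary \<alpha> (G \<alpha>)" using G \<alpha> by (simp add: factors_def)
    then show ?thesis using fdet_phi[OF _ \<alpha> False k] False by (simp add: pi det_Phi[OF \<alpha>])
  qed
  then show ?thesis using G by blast
qed

text \<open>These relations determine the components \<open>piL\<close> recursively from block determinants,
  which are multiplicative, continuous and compatible with exponentials.\<close>
lemma det_Phi_piL:
  assumes A: "regular A" and ord: "set ord = Pow {..<N}" "distinct ord" and \<gamma>: "\<gamma> \<subseteq> {..<N}" and k: "k \<in> cube ({..<N} - \<gamma>)"
  shows "det (Phi \<gamma> k A) = (\<Prod>\<alpha>\<in>Pow \<gamma>. \<Prod>d\<in>cells p (\<gamma> - \<alpha>). piL N M p ord A \<alpha> (merge k (cellpt p d) (\<gamma> - \<alpha>)))"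
proof -
  obtain G where G: "factors G" "prodL N M p ord G = A"
    and pi: "\<And>\<alpha> k. \<alpha> \<subseteq> {..<N} \<Longrightarrow> k \<in> cube ({..<N} - \<alpha>) \<Longrightarrow> piL N M p ord A \<alpha> k = det (Phi \<alpha> k (G \<alpha>))"
    using piL_factors[OF A ord] by blast
  have "det (Phi \<gamma> k A) = (\<Prod>\<alpha>\<in>Pow {..<N}. det (Phi \<gamma> k (G \<alpha>)))"
    unfolding G(2)[symmetric] Phi_prodL[OF \<gamma> k factors_Lset[OF G(1)]] det_PP[OF ord(2)] ord(1) ..
  also have "\<dots> = (\<Prod>\<alpha>\<in>Pow \<gamma>. det (Phi \<gamma> k (G \<alpha>)))"
  proof (rule prod.mono_neutral_right)
    show "\<forall>\<alpha>\<in>Pow {..<N} - Pow \<gamma>. det (Phi \<gamma> k (G \<alpha>)) = 1"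
    proof
      fix \<alpha> assume a: "\<alpha> \<in> Pow {..<N} - Pow \<gamma>"
      then have "elementary \<alpha> (G \<alpha>)" using G(1) by (simp add: factors_def)
      from Phi_elementary_not_subset[OF this \<gamma> _ k] a show "det (Phi \<gamma> k (G \<alpha>)) = 1" by simp
    qed
  qed (use \<gamma> in auto)
  also have "\<dots> = (\<Prod>\<alpha>\<in>Pow \<gamma>. \<Prod>d\<in>cells p (\<gamma> - \<alpha>). piL N M p ord A \<alpha> (merge k (cellpt p d) (\<gamma> - \<alpha>)))"
  proof (rule prod.cong[OF refl])
    fix \<alpha> assume "\<alpha> \<in> Pow \<gamma>"
    then have a: "\<alpha> \<subseteq> \<gamma>" and aN: "\<alpha> \<subseteq> {..<N}" using \<gamma> by auto
    have e: "elementary \<alpha> (G \<alpha>)" using G(1) aN by (simp add: factors_def)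
    show "det (Phi \<gamma> k (G \<alpha>)) = (\<Prod>d\<in>cells p (\<gamma> - \<alpha>). piL N M p ord A \<alpha> (merge k (cellpt p d) (\<gamma> - \<alpha>)))"
      unfolding det_Phi[OF \<gamma>] det_phi_elementary[OF e \<gamma> a k]
      using pi[OF aN merge_cell_cube[OF \<gamma> a k]] by (intro prod.cong refl) (simp add: det_Phi[OF aN])
  qed
  finally show ?thesis .
qed

end

section \<open>Block determinants and traces\<close>

lemma pow_mat_Suc_left:
  assumes "X \<in> carrier_mat n n"
  shows "X ^\<^sub>m Suc m = X * X ^\<^sub>m m"
proof (induction m)
  case 0
  then show ?case using assms by simp
next
  case (Suc m)
  have "X ^\<^sub>m Suc (Suc m) = X * X ^\<^sub>m m * X" using Suc by simp
  also have "\<dots> = X * (X ^\<^sub>m m * X)" using assms by (intro assoc_mult_mat[of _ n n _ n _ n]) auto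
  finally show ?case by simp
qed

lemma pow_mat_entry_bound:
  fixes X :: "complex mat"
  assumes X: "X \<in> carrier_mat n n" and b: "\<And>i j. i < n \<Longrightarrow> j < n \<Longrightarrow> cmod (X $$ (i, j)) \<le> b"
  shows "i < n \<Longrightarrow> j < n \<Longrightarrow> cmod ((X ^\<^sub>m m) $$ (i, j)) \<le> (real n * b) ^ m"
proof (induction m arbitrary: i j)
  case 0
  then show ?case using X by simp
next
  case (Suc m)
  have b0: "0 \<le> b" using b[OF Suc.prems] norm_ge_zero order_trans by blast
  have "(X ^\<^sub>m Suc m) $$ (i, j) = (\<Sum>l = 0..<n. (X ^\<^sub>m m) $$ (i, l) * X $$ (l, j))"
    using Suc.prems X by (simp add: scalar_prod_def)
  also have "cmod \<dots> \<le> (\<Sum>l = 0..<n. (real n * b) ^ m * b)"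
    using Suc b b0 by (intro sum_norm_le) (auto simp: norm_mult intro!: mult_mono)
  also have "\<dots> = (real n * b) ^ Suc m" by (simp add: mult_ac)
  finally show ?case .
qed

text \<open>Comparison with a scalar exponential series: the sum \<open>?b\<close> of the moduli of
  all entries bounds each entry, and the entries of the m-th power are at most
  \<open>(real n * ?b) ^ m\<close>.\<close>

lemma summable_pow_mat:
  fixes X :: "complex mat"
  assumes X: "X \<in> carrier_mat n n" and ij: "i < n" "j < n"
  shows "summable (\<lambda>m. (X ^\<^sub>m m) $$ (i, j) / of_nat (fact m))"
proof -
  let ?b = "\<Sum>i<n. \<Sum>j<n. cmod (X $$ (i, j))"
  have b: "cmod (X $$ (i, j)) \<le> ?b" if "i < n" "j < n" for i j
  proof -
    have "cmod (X $$ (i, j)) \<le> (\<Sum>j<n. cmod (X $$ (i, j)))"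
      using that by (intro member_le_sum) auto
    also have "\<dots> \<le> ?b" using that by (intro member_le_sum[where f = "\<lambda>i. \<Sum>j<n. cmod (X $$ (i, j))"]) (auto intro!: sum_nonneg)
    finally show ?thesis .
  qed
  have "summable (\<lambda>m. (real n * ?b) ^ m / fact m)"
    using summable_exp[of "real n * ?b"] by (simp add: divide_inverse mult.commute)
  then show ?thesis
  proof (rule summable_comparison_test[rotated])
    show "\<exists>N. \<forall>m\<ge>N. norm ((X ^\<^sub>m m) $$ (i, j) / of_nat (fact m)) \<le> (real n * ?b) ^ m / fact m"
      using pow_mat_entry_bound[OF X b ij] by (intro exI[of _ 0]) (simp add: norm_divide divide_right_mono)
  qed
qed

context staircase_algebra
begin

text \<open>The part of the block determinant at \<gamma> that comes from proper subsets. Dividing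
  by it turns the product formula into a recursion for \<open>piL\<close> at \<gamma>.\<close>

abbreviation below :: "nat set list \<Rightarrow> opL \<Rightarrow> nat set \<Rightarrow> pt \<Rightarrow> complex" where
  "below ord A \<gamma> k \<equiv> (\<Prod>\<alpha>\<in>Pow \<gamma> - {\<gamma>}. \<Prod>d\<in>cells p (\<gamma> - \<alpha>). piL N M p ord A \<alpha> (merge k (cellpt p d) (\<gamma> - \<alpha>)))"

lemma prod_Pow_split:
  assumes "finite \<gamma>"
  shows "(\<Prod>\<alpha>\<in>Pow \<gamma>. \<Prod>d\<in>cells p (\<gamma> - \<alpha>). f \<alpha> (merge k (cellpt p d) (\<gamma> - \<alpha>))) =
    (\<Prod>\<alpha>\<in>Pow \<gamma> - {\<gamma>}. \<Prod>d\<in>cells p (\<gamma> - \<alpha>). f \<alpha> (merge k (cellpt p d) (\<gamma> - \<alpha>))) * (f \<gamma> k :: complex)"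
  using assms by (subst prod.remove[of _ \<gamma>]) (auto simp: mult.commute)

lemma sum_Pow_split:
  assumes "finite \<gamma>"
  shows "(\<Sum>\<alpha>\<in>Pow \<gamma>. \<Sum>d\<in>cells p (\<gamma> - \<alpha>). f \<alpha> (merge k (cellpt p d) (\<gamma> - \<alpha>))) =
    (\<Sum>\<alpha>\<in>Pow \<gamma> - {\<gamma>}. \<Sum>d\<in>cells p (\<gamma> - \<alpha>). f \<alpha> (merge k (cellpt p d) (\<gamma> - \<alpha>))) + (f \<gamma> k :: complex)"
  using assms by (subst sum.remove[of _ \<gamma>]) (auto simp: add.commute)

context
  fixes ord :: "nat set list"
  assumes ord: "set ord = Pow {..<N}" "distinct ord"
begin

lemma piL_recursion:
  assumes A: "regular A" and \<gamma>: "\<gamma> \<subseteq> {..<N}" and k: "k \<in> cube ({..<N} - \<gamma>)"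
  shows "det_on (J \<gamma>) (phi \<gamma> k A) = below ord A \<gamma> k * piL N M p ord A \<gamma> k" and "below ord A \<gamma> k \<noteq> 0"
proof -
  show "det_on (J \<gamma>) (phi \<gamma> k A) = below ord A \<gamma> k * piL N M p ord A \<gamma> k"
    unfolding det_Phi[OF \<gamma>, symmetric] det_Phi_piL[OF A ord \<gamma> k] by (rule prod_Pow_split[OF finite_subN[OF \<gamma>]])
  have "det_on (J \<gamma>) (phi \<gamma> k A) \<noteq> 0" using A \<gamma> k det_Phi[OF \<gamma>, of k A] by (auto simp: regular_def)
  then show "below ord A \<gamma> k \<noteq> 0"
    using \<open>det_on (J \<gamma>) (phi \<gamma> k A) = below ord A \<gamma> k * piL N M p ord A \<gamma> k\<close> by auto
qed

text \<open>The uniqueness principle behind multiplicativity and the exponential formula: a family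
  whose products reproduce all block determinants must be \<open>piL\<close>. By induction the
  nonzero contributions of the proper subsets agree and cancel.\<close>

lemma piL_determined:
  assumes A: "regular A"
    and f: "\<And>\<gamma> k. \<gamma> \<subseteq> {..<N} \<Longrightarrow> k \<in> cube ({..<N} - \<gamma>) \<Longrightarrow>
       det_on (J \<gamma>) (phi \<gamma> k A) = (\<Prod>\<alpha>\<in>Pow \<gamma>. \<Prod>d\<in>cells p (\<gamma> - \<alpha>). f \<alpha> (merge k (cellpt p d) (\<gamma> - \<alpha>)))"
  shows "\<gamma> \<subseteq> {..<N} \<Longrightarrow> k \<in> cube ({..<N} - \<gamma>) \<Longrightarrow> piL N M p ord A \<gamma> k = f \<gamma> k"
proof (induction "card \<gamma>" arbitrary: \<gamma> k rule: less_induct)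
  case less
  note \<gamma> = less.prems(1) and k = less.prems(2)
  have fin: "finite \<gamma>" using \<gamma> by (rule finite_subN)
  have b: "below ord A \<gamma> k = (\<Prod>\<alpha>\<in>Pow \<gamma> - {\<gamma>}. \<Prod>d\<in>cells p (\<gamma> - \<alpha>). f \<alpha> (merge k (cellpt p d) (\<gamma> - \<alpha>)))"
  proof (intro prod.cong refl)
    fix \<alpha> d assume a: "\<alpha> \<in> Pow \<gamma> - {\<gamma>}" and d: "d \<in> cells p (\<gamma> - \<alpha>)"
    then have "card \<alpha> < card \<gamma>" using fin by (intro psubset_card_mono) auto
    then show "piL N M p ord A \<alpha> (merge k (cellpt p d) (\<gamma> - \<alpha>)) = f \<alpha> (merge k (cellpt p d) (\<gamma> - \<alpha>))"
      using a \<gamma> by (intro less.hyps merge_cell_cube[OF \<gamma> _ k d]) auto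
  qed
  have "below ord A \<gamma> k * piL N M p ord A \<gamma> k = det_on (J \<gamma>) (phi \<gamma> k A)"
    by (rule piL_recursion(1)[OF A \<gamma> k, symmetric])
  also have "\<dots> = below ord A \<gamma> k * f \<gamma> k"
    unfolding f[OF \<gamma> k] prod_Pow_split[OF fin, of f k] b ..
  finally have "below ord A \<gamma> k * piL N M p ord A \<gamma> k = below ord A \<gamma> k * f \<gamma> k" .
  then show ?case using piL_recursion(2)[OF A \<gamma> k] by simp
qed

lemma regular_mulL:
  assumes C: "regular C" and D: "regular D"
  shows "regular (mulL N M p C D)"
proof -
  have L: "C \<in> Lset N M p" "D \<in> Lset N M p" using C D by (auto simp: regular_def)
  have "det (Phi \<alpha> k (mulL N M p C D)) \<noteq> 0" if "\<alpha> \<subseteq> {..<N}" "k \<in> cube ({..<N} - \<alpha>)" for \<alpha> k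
    unfolding Phi_mulL[OF L that] det_mult[OF Phi_carrier Phi_carrier] using C D that by (simp add: regular_def)
  then show ?thesis using mulL_Lset[OF L] by (simp add: regular_def)
qed

lemma piL_mulL:
  assumes C: "regular C" and D: "regular D" and \<gamma>: "\<gamma> \<subseteq> {..<N}" and k: "k \<in> cube ({..<N} - \<gamma>)"
  shows "piL N M p ord (mulL N M p C D) \<gamma> k = piL N M p ord C \<gamma> k * piL N M p ord D \<gamma> k"
proof (rule piL_determined[OF regular_mulL[OF C D] _ \<gamma> k])
  have L: "C \<in> Lset N M p" "D \<in> Lset N M p" using C D by (auto simp: regular_def)
  fix \<gamma> k assume a: "\<gamma> \<subseteq> {..<N}" "k \<in> cube ({..<N} - \<gamma>)"
  show "det_on (J \<gamma>) (phi \<gamma> k (mulL N M p C D)) = (\<Prod>\<alpha>\<in>Pow \<gamma>. \<Prod>d\<in>cells p (\<gamma> - \<alpha>).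
     piL N M p ord C \<alpha> (merge k (cellpt p d) (\<gamma> - \<alpha>)) * piL N M p ord D \<alpha> (merge k (cellpt p d) (\<gamma> - \<alpha>)))"
    unfolding det_Phi[OF a(1), symmetric] Phi_mulL[OF L a] det_mult[OF Phi_carrier Phi_carrier]
      det_Phi_piL[OF C ord a] det_Phi_piL[OF D ord a] by (simp only: prod.distrib)
qed

text \<open>\<open>piL\<close> inherits constancy on cells from the blocks of the factors; hence it
  has finitely many values, and pointwise convergence at the corners controls the maximum
  norm.\<close>

lemma piL_cell_cong:
  assumes A: "regular A" and \<alpha>: "\<alpha> \<subseteq> {..<N}" and k: "k \<in> cube ({..<N} - \<alpha>)" "k' \<in> cube ({..<N} - \<alpha>)"
    "cl p ({..<N} - \<alpha>) k = cl p ({..<N} - \<alpha>) k'"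
  shows "piL N M p ord A \<alpha> k = piL N M p ord A \<alpha> k'"
proof -
  obtain G where G: "factors G" and
    pi: "\<And>\<alpha> k. \<alpha> \<subseteq> {..<N} \<Longrightarrow> k \<in> cube ({..<N} - \<alpha>) \<Longrightarrow> piL N M p ord A \<alpha> k = det (Phi \<alpha> k (G \<alpha>))"
    using piL_factors[OF A ord] by blast
  show ?thesis
    unfolding pi[OF \<alpha> k(1)] pi[OF \<alpha> k(2)] Phi_cell_cong[OF factors_Lset[OF G] \<alpha> k] ..
qed

end

section \<open>The trace as a finite sum and the traces of blocks\<close>

lemma tau_eq:
  assumes A: "A \<in> Lset N M p" and \<alpha>: "\<alpha> \<subseteq> {..<N}" and k: "k \<in> cube ({..<N} - \<alpha>)"
  shows "tau M A \<alpha> k = (\<Sum>i<M. h ^ card \<alpha> * (\<Sum>d\<in>cells p \<alpha>. A \<alpha> (merge k (cellpt p d) \<alpha>) (cellpt p d) i i))"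
  unfolding tau_def
proof (rule sum.cong[OF refl])
  fix i
  interpret prob_space "cubeM \<alpha>" by (rule prob_space_cubeM)
  have fin: "finite \<alpha>" using \<alpha> by (rule finite_subN)
  let ?F = "\<lambda>d. A \<alpha> (merge k (cellpt p d) \<alpha>) (cellpt p d) i i"
  have int: "integrable (cubeM \<alpha>) (ind p \<alpha> d)" for d
    using integrable_ind_mult[of \<alpha> "\<lambda>_. 1" d] by simp
  have "(\<integral>x. A \<alpha> (merge k x \<alpha>) x i i \<partial>cubeM \<alpha>) = (\<integral>x. (\<Sum>d\<in>cells p \<alpha>. ?F d * ind p \<alpha> d x) \<partial>cubeM \<alpha>)"
  proof (intro Bochner_Integration.integral_cong refl)
    fix x assume "x \<in> space (cubeM \<alpha>)"
    then have x: "x \<in> cube \<alpha>" by (rule cubeM_in_cube)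
    have c: "cl p \<alpha> x \<in> cells p \<alpha>" using x by (rule cl_in_cells[OF p_pos])
    have "{..<N} \<inter> \<alpha> = \<alpha>" using \<alpha> by auto
    then have "A \<alpha> (merge k x \<alpha>) x i i = ?F (cl p \<alpha> x)"
      using x k cellpt_in_cube[OF p_pos c]
      by (intro Lset_cell[OF A] merge_cube cl_merge_cong) (simp_all add: cl_cellpt[OF p_pos] cres_cl)
    then show "A \<alpha> (merge k x \<alpha>) x i i = (\<Sum>d\<in>cells p \<alpha>. ?F d * ind p \<alpha> d x)"
      by (simp add: sum_ind[OF p_pos fin x])
  qed
  also have "\<dots> = (\<Sum>d\<in>cells p \<alpha>. ?F d * h ^ card \<alpha>)"
    using int integral_ind[OF fin] by (simp add: Bochner_Integration.integral_sum)
  finally show "(\<integral>x. A \<alpha> (merge k x \<alpha>) x i i \<partial>cubeM \<alpha>) = h ^ card \<alpha> * (\<Sum>d\<in>cells p \<alpha>. ?F d)"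
    by (simp add: sum_distrib_left mult.commute)
qed

lemma sum_J: "(\<Sum>a\<in>J \<gamma>. F a) = (\<Sum>d\<in>cells p \<gamma>. \<Sum>m<M. F (d, m))"
  using sum.cartesian_product[of "\<lambda>d m. F (d, m)" "{..<M}" "cells p \<gamma>"] by (simp add: J_def)

text \<open>On the diagonal the matching condition of \<open>phi\<close> always holds, so every
  \<beta> below \<gamma> contributes. Splitting the cell of \<gamma>, the part in \<beta> sums with
  its weight to the integral that defines \<open>tau\<close>, and the part in \<gamma> - \<beta>
  remains as a parameter.\<close>

lemma trace_phi:
  assumes A: "A \<in> Lset N M p" and \<gamma>: "\<gamma> \<subseteq> {..<N}" and k: "k \<in> cube ({..<N} - \<gamma>)"
  shows "(\<Sum>a\<in>J \<gamma>. phi \<gamma> k A a a) = (\<Sum>\<beta>\<in>Pow \<gamma>. \<Sum>d\<in>cells p (\<gamma> - \<beta>). tau M A \<beta> (merge k (cellpt p d) (\<gamma> - \<beta>)))"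
proof -
  let ?t = "\<lambda>\<beta> d m. h ^ card \<beta> * A \<beta> (merge k (cellpt p d) \<gamma>) (cellpt p d) m m"
  have "(\<Sum>a\<in>J \<gamma>. phi \<gamma> k A a a) = (\<Sum>d\<in>cells p \<gamma>. \<Sum>m<M. \<Sum>\<beta>\<in>Pow \<gamma>. ?t \<beta> d m)"
    unfolding sum_J by (simp add: phi_def)
  also have "\<dots> = (\<Sum>d\<in>cells p \<gamma>. \<Sum>\<beta>\<in>Pow \<gamma>. \<Sum>m<M. ?t \<beta> d m)"
    by (intro sum.cong refl) (rule sum.swap)
  also have "\<dots> = (\<Sum>\<beta>\<in>Pow \<gamma>. \<Sum>d\<in>cells p \<gamma>. \<Sum>m<M. ?t \<beta> d m)"
    by (rule sum.swap)
  also have "\<dots> = (\<Sum>\<beta>\<in>Pow \<gamma>. \<Sum>d\<in>cells p (\<gamma> - \<beta>). tau M A \<beta> (merge k (cellpt p d) (\<gamma> - \<beta>)))"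
  proof (rule sum.cong[OF refl])
    fix \<beta> assume "\<beta> \<in> Pow \<gamma>"
    then have b: "\<beta> \<subseteq> \<gamma>" and bN: "\<beta> \<subseteq> {..<N}" using \<gamma> by auto
    have "(\<Sum>d\<in>cells p \<gamma>. \<Sum>m<M. ?t \<beta> d m) = (\<Sum>d\<in>cells p (\<gamma> - \<beta>). \<Sum>e\<in>cells p \<beta>. \<Sum>m<M. ?t \<beta> (cmerge d e \<beta>) m)"
      by (rule sum_cells_split[OF b])
    also have "\<dots> = (\<Sum>d\<in>cells p (\<gamma> - \<beta>). tau M A \<beta> (merge k (cellpt p d) (\<gamma> - \<beta>)))"
    proof (rule sum.cong[OF refl])
      fix d assume d: "d \<in> cells p (\<gamma> - \<beta>)"
      let ?K = "merge k (cellpt p d) (\<gamma> - \<beta>)"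
      have K: "?K \<in> cube ({..<N} - \<beta>)" by (rule merge_cell_cube[OF \<gamma> b k d])
      have "?t \<beta> (cmerge d e \<beta>) m = h ^ card \<beta> * A \<beta> (merge ?K (cellpt p e) \<beta>) (cellpt p e) m m" if e: "e \<in> cells p \<beta>" for e m
      proof -
        have mm: "merge k (cellpt p (cmerge d e \<beta>)) \<gamma> = merge ?K (cellpt p e) \<beta>"
          using b by (auto simp: merge_def cellpt_def cmerge_def fun_eq_iff)
        have c: "merge ?K (cellpt p e) \<beta> \<in> cube {..<N}" using K cellpt_in_cube[OF p_pos e] by (rule merge_cube)
        have "A \<beta> (merge ?K (cellpt p e) \<beta>) (cellpt p (cmerge d e \<beta>)) m m = A \<beta> (merge ?K (cellpt p e) \<beta>) (cellpt p e) m m"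
          by (rule Lset_cell[OF A c c cellpt_in_cube[OF p_pos cmerge_in_cells[OF d e b]] cellpt_in_cube[OF p_pos e] refl])
             (simp add: cl_cellpt[OF p_pos] cres_cmerge[OF e] cres_cells[OF e])
        then show ?thesis unfolding mm by simp
      qed
      then have "(\<Sum>e\<in>cells p \<beta>. \<Sum>m<M. ?t \<beta> (cmerge d e \<beta>) m) =
        (\<Sum>e\<in>cells p \<beta>. \<Sum>m<M. h ^ card \<beta> * A \<beta> (merge ?K (cellpt p e) \<beta>) (cellpt p e) m m)" by (intro sum.cong refl)
      also have "\<dots> = (\<Sum>m<M. \<Sum>e\<in>cells p \<beta>. h ^ card \<beta> * A \<beta> (merge ?K (cellpt p e) \<beta>) (cellpt p e) m m)" by (rule sum.swap)
      also have "\<dots> = tau M A \<beta> ?K" unfolding tau_eq[OF A bN K] sum_distrib_left ..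
      finally show "(\<Sum>e\<in>cells p \<beta>. \<Sum>m<M. ?t \<beta> (cmerge d e \<beta>) m) = tau M A \<beta> ?K" .
    qed
    finally show "(\<Sum>d\<in>cells p \<gamma>. \<Sum>m<M. ?t \<beta> d m) = (\<Sum>d\<in>cells p (\<gamma> - \<beta>). tau M A \<beta> (merge k (cellpt p d) (\<gamma> - \<beta>)))" .
  qed
  finally show ?thesis .
qed

text \<open>Matrix traces are cyclic in every block. By induction the proper subsets contribute
  equally to both block traces, which leaves equality at \<gamma>.\<close>

lemma tau_mulL_commute:
  assumes A: "A \<in> Lset N M p" and B: "B \<in> Lset N M p"
  shows "\<gamma> \<subseteq> {..<N} \<Longrightarrow> k \<in> cube ({..<N} - \<gamma>) \<Longrightarrow> tau M (mulL N M p A B) \<gamma> k = tau M (mulL N M p B A) \<gamma> k"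
proof (induction "card \<gamma>" arbitrary: \<gamma> k rule: less_induct)
  case less
  note \<gamma> = less.prems(1) and k = less.prems(2)
  have fin: "finite \<gamma>" using \<gamma> by (rule finite_subN)
  let ?AB = "mulL N M p A B" and ?BA = "mulL N M p B A"
  have "(\<Sum>a\<in>J \<gamma>. phi \<gamma> k ?AB a a) = (\<Sum>a\<in>J \<gamma>. \<Sum>c\<in>J \<gamma>. phi \<gamma> k A a c * phi \<gamma> k B c a)"
    using phi_mulL[OF A B \<gamma> k] by (intro sum.cong refl) simp
  also have "\<dots> = (\<Sum>c\<in>J \<gamma>. \<Sum>a\<in>J \<gamma>. phi \<gamma> k B c a * phi \<gamma> k A a c)"
    by (subst sum.swap) (simp only: mult.commute)
  also have "\<dots> = (\<Sum>a\<in>J \<gamma>. phi \<gamma> k ?BA a a)"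
    using phi_mulL[OF B A \<gamma> k] by (intro sum.cong refl) simp
  finally have tr: "(\<Sum>a\<in>J \<gamma>. phi \<gamma> k ?AB a a) = (\<Sum>a\<in>J \<gamma>. phi \<gamma> k ?BA a a)" .
  have "(\<Sum>\<alpha>\<in>Pow \<gamma> - {\<gamma>}. \<Sum>d\<in>cells p (\<gamma> - \<alpha>). tau M ?AB \<alpha> (merge k (cellpt p d) (\<gamma> - \<alpha>))) =
     (\<Sum>\<alpha>\<in>Pow \<gamma> - {\<gamma>}. \<Sum>d\<in>cells p (\<gamma> - \<alpha>). tau M ?BA \<alpha> (merge k (cellpt p d) (\<gamma> - \<alpha>)))"
  proof (intro sum.cong refl)
    fix \<alpha> d assume a: "\<alpha> \<in> Pow \<gamma> - {\<gamma>}" and d: "d \<in> cells p (\<gamma> - \<alpha>)"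
    then have "card \<alpha> < card \<gamma>" using fin by (intro psubset_card_mono) auto
    then show "tau M ?AB \<alpha> (merge k (cellpt p d) (\<gamma> - \<alpha>)) = tau M ?BA \<alpha> (merge k (cellpt p d) (\<gamma> - \<alpha>))"
      using a \<gamma> by (intro less.hyps merge_cell_cube[OF \<gamma> _ k d]) auto
  qed
  then show ?case
    using tr unfolding trace_phi[OF mulL_Lset[OF A B] \<gamma> k] trace_phi[OF mulL_Lset[OF B A] \<gamma> k]
      sum_Pow_split[OF fin] by simp
qed

lemma tau_linL:
  assumes A: "A \<in> Lset N M p" and B: "B \<in> Lset N M p" and \<alpha>: "\<alpha> \<subseteq> {..<N}" and k: "k \<in> cube ({..<N} - \<alpha>)"
  shows "tau M (linL c A d B) \<alpha> k = c * tau M A \<alpha> k + d * tau M B \<alpha> k"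
  unfolding tau_eq[OF linL_Lset[OF A B] \<alpha> k] tau_eq[OF A \<alpha> k] tau_eq[OF B \<alpha> k] unfolding linL_def
  by (simp add: sum.distrib sum_distrib_left distrib_left mult_ac)

section \<open>Estimates by the norm of the algebra\<close>

abbreviation rowset :: "opL \<Rightarrow> nat set \<Rightarrow> real set" where
  "rowset A \<alpha> \<equiv> {(\<Sum>j<M. cmod (A \<alpha> k x i j)) | k x i. k \<in> cube {..<N} \<and> x \<in> cube \<alpha> \<and> i < M}"

lemma zero_in_cube: "(\<lambda>_. 0) \<in> cube S" by (simp add: cube_def)

lemma rowset_nonempty: "rowset A \<alpha> \<noteq> {}"
proof -
  have "(\<Sum>j<M. cmod (A \<alpha> (\<lambda>_. 0) (\<lambda>_. 0) 0 j)) \<in> rowset A \<alpha>" using zero_in_cube M_pos by blast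
  then show ?thesis by blast
qed

lemma rowset_bdd: "A \<in> Lset N M p \<Longrightarrow> bdd_above (rowset A \<alpha>)"
proof -
  assume "A \<in> Lset N M p"
  then obtain B where B: "\<forall>\<alpha> k x i j. cmod (A \<alpha> k x i j) \<le> B" using Lset_bounded by blast
  have "(\<Sum>j<M. cmod (A \<alpha> k x i j)) \<le> real M * B" for k x i
    using sum_bounded_above[of "{..<M}" "\<lambda>j. cmod (A \<alpha> k x i j)" B] B by simp
  then show ?thesis by (intro bdd_aboveI[of _ "real M * B"]) blast
qed

lemma Sup_rowset_nonneg:
  assumes "A \<in> Lset N M p" shows "0 \<le> Sup (rowset A \<alpha>)"
proof -
  obtain r where r: "r \<in> rowset A \<alpha>" using rowset_nonempty by blast
  then have "0 \<le> r" by (auto intro: sum_nonneg)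
  then show ?thesis using cSup_upper[OF r rowset_bdd[OF assms]] by simp
qed

lemma normL_nonneg: "A \<in> Lset N M p \<Longrightarrow> 0 \<le> normL N M A"
  unfolding normL_def by (intro sum_nonneg Sup_rowset_nonneg)

lemma row_le_normL:
  assumes A: "A \<in> Lset N M p" and \<alpha>: "\<alpha> \<subseteq> {..<N}" and "k \<in> cube {..<N}" "x \<in> cube \<alpha>" "i < M"
  shows "(\<Sum>j<M. cmod (A \<alpha> k x i j)) \<le> normL N M A"
proof -
  have "(\<Sum>j<M. cmod (A \<alpha> k x i j)) \<in> rowset A \<alpha>" using assms by blast
  then have "(\<Sum>j<M. cmod (A \<alpha> k x i j)) \<le> Sup (rowset A \<alpha>)" by (rule cSup_upper[OF _ rowset_bdd[OF A]])
  also have "\<dots> \<le> normL N M A"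
    unfolding normL_def using \<alpha> Sup_rowset_nonneg[OF A] by (intro member_le_sum[where f = "\<lambda>\<alpha>. Sup (rowset A \<alpha>)"]) auto
  finally show ?thesis .
qed

lemma entry_le_normL:
  assumes A: "A \<in> Lset N M p"
  shows "cmod (A \<alpha> k x i j) \<le> normL N M A"
proof (cases "\<alpha> \<subseteq> {..<N} \<and> k \<in> cube {..<N} \<and> x \<in> cube \<alpha> \<and> i < M \<and> j < M")
  case True
  then have "cmod (A \<alpha> k x i j) \<le> (\<Sum>j<M. cmod (A \<alpha> k x i j))" by (intro member_le_sum) auto
  also have "\<dots> \<le> normL N M A" using True by (intro row_le_normL[OF A]) auto
  finally show ?thesis .
next
  case False
  then show ?thesis using Lset_outside[OF A False] normL_nonneg[OF A] by simp
qed

text \<open>A crude majorant by a finite sum over corners and indices, through which entrywise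
  convergence implies convergence in norm.\<close>

lemma normL_le:
  assumes A: "A \<in> Lset N M p"
  shows "normL N M A \<le> (\<Sum>\<alpha>\<in>Pow {..<N}. \<Sum>c\<in>cells p {..<N}. \<Sum>d\<in>cells p \<alpha>. \<Sum>i<M. \<Sum>j<M. cmod (A \<alpha> (cellpt p c) (cellpt p d) i j))"
  unfolding normL_def
proof (rule sum_mono, rule cSup_least[OF rowset_nonempty])
  fix \<alpha> r assume "\<alpha> \<in> Pow {..<N}" and "r \<in> rowset A \<alpha>"
  then obtain k x i where \<alpha>: "\<alpha> \<subseteq> {..<N}" and r: "r = (\<Sum>j<M. cmod (A \<alpha> k x i j))" and k: "k \<in> cube {..<N}" and x: "x \<in> cube \<alpha>" and i: "i < M"
    by auto
  let ?f = "\<lambda>c d i. \<Sum>j<M. cmod (A \<alpha> (cellpt p c) (cellpt p d) i j)"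
  have fin: "finite (cells p \<alpha>)" "finite (cells p {..<N})" using finite_subN[OF \<alpha>] by (auto intro: finite_cells)
  have "r = ?f (cl p {..<N} k) (cl p \<alpha> x) i" unfolding r using Lset_cellpt[OF A k x] by simp
  also have "\<dots> \<le> (\<Sum>i<M. ?f (cl p {..<N} k) (cl p \<alpha> x) i)"
    using i by (intro member_le_sum[where f = "?f (cl p {..<N} k) (cl p \<alpha> x)"]) (auto intro: sum_nonneg)
  also have "\<dots> \<le> (\<Sum>d\<in>cells p \<alpha>. \<Sum>i<M. ?f (cl p {..<N} k) d i)"
    using fin cl_in_cells[OF p_pos x]
    by (intro member_le_sum[where f = "\<lambda>d. \<Sum>i<M. ?f (cl p {..<N} k) d i"]) (auto intro!: sum_nonneg)
  also have "\<dots> \<le> (\<Sum>c\<in>cells p {..<N}. \<Sum>d\<in>cells p \<alpha>. \<Sum>i<M. ?f c d i)"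
    using fin cl_in_cells[OF p_pos k]
    by (intro member_le_sum[where f = "\<lambda>c. \<Sum>d\<in>cells p \<alpha>. \<Sum>i<M. ?f c d i"]) (auto intro!: sum_nonneg)
  finally show "r \<le> (\<Sum>c\<in>cells p {..<N}. \<Sum>d\<in>cells p \<alpha>. \<Sum>i<M. ?f c d i)" .
qed

lemma tau_le_normL:
  assumes A: "A \<in> Lset N M p" and \<alpha>: "\<alpha> \<subseteq> {..<N}" and k: "k \<in> cube ({..<N} - \<alpha>)"
  shows "cmod (tau M A \<alpha> k) \<le> real M * normL N M A"
proof -
  interpret prob_space "cubeM \<alpha>" by (rule prob_space_cubeM)
  have "cmod (tau M A \<alpha> k) \<le> (\<Sum>i<M. cmod (\<integral>x. A \<alpha> (merge k x \<alpha>) x i i \<partial>cubeM \<alpha>))"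
    unfolding tau_def by (rule norm_sum)
  also have "\<dots> \<le> (\<Sum>i<M. normL N M A)"
  proof (rule sum_mono)
    fix i
    have "cmod (\<integral>x. A \<alpha> (merge k x \<alpha>) x i i \<partial>cubeM \<alpha>) \<le> (\<integral>x. cmod (A \<alpha> (merge k x \<alpha>) x i i) \<partial>cubeM \<alpha>)"
      by (rule integral_norm_bound)
    also have "\<dots> \<le> normL N M A"
    proof (cases "integrable (cubeM \<alpha>) (\<lambda>x. cmod (A \<alpha> (merge k x \<alpha>) x i i))")
      case True
      then show ?thesis using entry_le_normL[OF A] by (intro integral_le_const) auto
    next
      \<comment> \<open>Without integrability the integral is 0 by convention, and the bound is
        nonnegativity of the norm.\<close>
      case False
      then show ?thesis using normL_nonneg[OF A] by (simp add: not_integrable_integral_eq)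
    qed
    finally show "cmod (\<integral>x. A \<alpha> (merge k x \<alpha>) x i i \<partial>cubeM \<alpha>) \<le> normL N M A" .
  qed
  also have "\<dots> = real M * normL N M A" by simp
  finally show ?thesis .
qed

end

section \<open>Exponentials, continuity and norms\<close>

context staircase_algebra
begin

lemma powL_Lset: "A \<in> Lset N M p \<Longrightarrow> powL N M p A m \<in> Lset N M p"
  by (induction m) (auto intro: idL_Lset mulL_Lset)

lemma Phi_powL:
  assumes A: "A \<in> Lset N M p" and \<gamma>: "\<gamma> \<subseteq> {..<N}" and k: "k \<in> cube ({..<N} - \<gamma>)"
  shows "Phi \<gamma> k (powL N M p A m) = Phi \<gamma> k A ^\<^sub>m m"
proof (induction m)
  case 0
  have "dim_row (Phi \<gamma> k A) = nJ \<gamma>" by (simp add: Phi_def)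
  then show ?case using Phi_id[OF \<gamma> k] by simp
next
  case (Suc m)
  have "Phi \<gamma> k (powL N M p A (Suc m)) = Phi \<gamma> k A * Phi \<gamma> k (powL N M p A m)"
    using Phi_mulL[OF A powL_Lset[OF A] \<gamma> k] by simp
  then show ?case unfolding Suc pow_mat_Suc_left[OF Phi_carrier] .
qed

lemma summable_phi_powL:
  assumes A: "A \<in> Lset N M p" and \<gamma>: "\<gamma> \<subseteq> {..<N}" and k: "k \<in> cube ({..<N} - \<gamma>)" and ab: "a \<in> J \<gamma>" "b \<in> J \<gamma>"
  shows "summable (\<lambda>m. phi \<gamma> k (powL N M p A m) a b / of_nat (fact m))"
proof -
  obtain i where i: "i < nJ \<gamma>" "a = eJ \<gamma> i" by (rule eJ_surj[OF \<gamma> ab(1)])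
  obtain j where j: "j < nJ \<gamma>" "b = eJ \<gamma> j" by (rule eJ_surj[OF \<gamma> ab(2)])
  have "(Phi \<gamma> k A ^\<^sub>m m) $$ (i, j) = phi \<gamma> k (powL N M p A m) a b" for m
    unfolding Phi_powL[OF A \<gamma> k, symmetric] using i j by (simp add: Phi_def)
  then show ?thesis using summable_pow_mat[OF Phi_carrier i(1) j(1), of k A] by simp
qed

text \<open>The blocks of powers are powers of blocks, so each block has a convergent exponential
  series. Solving \<open>phi_split\<close> for the top component transfers convergence to the
  coefficients, by induction on the size of \<alpha>.\<close>

lemma summable_powL:
  assumes A: "A \<in> Lset N M p"
  shows "summable (\<lambda>m. powL N M p A m \<alpha> k x i j / of_nat (fact m))"
proof (cases "\<alpha> \<subseteq> {..<N} \<and> k \<in> cube {..<N} \<and> x \<in> cube \<alpha> \<and> i < M \<and> j < M")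
  case False
  then have "powL N M p A m \<alpha> k x i j = 0" for m by (rule Lset_outside[OF powL_Lset[OF A]])
  then show ?thesis by simp
next
  case True
  then have ij: "i < M" "j < M" by auto
  have "\<alpha> \<subseteq> {..<N}" "k \<in> cube {..<N}" "x \<in> cube \<alpha>" using True by auto
  then show ?thesis
  proof (induction "card \<alpha>" arbitrary: \<alpha> k x rule: less_induct)
    case less
    note \<alpha> = less.prems(1) and k = less.prems(2) and x = less.prems(3)
    let ?P = "\<lambda>m. powL N M p A m"
    let ?d' = "cl p \<alpha> k" and ?d = "cl p \<alpha> x"
    let ?K = "merge k (cellpt p ?d') \<alpha>"
    have kg: "k \<in> cube \<alpha>" "k \<in> cube ({..<N} - \<alpha>)" using k \<alpha> by (auto simp: cube_def)
    have d: "?d' \<in> cells p \<alpha>" "?d \<in> cells p \<alpha>" using kg x by (auto intro: cl_in_cells p_pos)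
    have K: "?K \<in> cube {..<N}" using kg(2) cellpt_in_cube[OF p_pos d(1)] by (rule merge_cube)
    have J: "(?d', i) \<in> J \<alpha>" "(?d, j) \<in> J \<alpha>" using d ij by (auto simp: J_def)
    let ?s = "\<lambda>m. \<Sum>\<beta>\<in>Pow \<alpha> - {\<alpha>}. if \<forall>l\<in>\<alpha> - \<beta>. ?d' l = ?d l then h ^ card \<beta> * ?P m \<beta> ?K (cellpt p ?d) i j else 0"
    have lower: "summable (\<lambda>m. ?s m / of_nat (fact m))"
    proof -
      have "summable (\<lambda>m. \<Sum>\<beta>\<in>Pow \<alpha> - {\<alpha>}. (if \<forall>l\<in>\<alpha> - \<beta>. ?d' l = ?d l then h ^ card \<beta> else 0) * (?P m \<beta> ?K (cellpt p ?d) i j / of_nat (fact m)))"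
      proof (intro summable_sum summable_mult)
        fix \<beta> assume b: "\<beta> \<in> Pow \<alpha> - {\<alpha>}"
        then have "card \<beta> < card \<alpha>" using finite_subN[OF \<alpha>] by (intro psubset_card_mono) auto
        then show "summable (\<lambda>m. ?P m \<beta> ?K (cellpt p ?d) i j / of_nat (fact m))"
          using b \<alpha> by (intro less.hyps K cellpt_in_cube[OF p_pos d(2)]) auto
      qed
      moreover have "(\<Sum>\<beta>\<in>Pow \<alpha> - {\<alpha>}. (if \<forall>l\<in>\<alpha> - \<beta>. ?d' l = ?d l then h ^ card \<beta> else 0) * (?P m \<beta> ?K (cellpt p ?d) i j / of_nat (fact m))) = ?s m / of_nat (fact m)" for m
        unfolding sum_divide_distrib by (intro sum.cong refl) simp
      ultimately show ?thesis by simp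
    qed
    have s: "summable (\<lambda>m. (phi \<alpha> k (?P m) (?d', i) (?d, j) / of_nat (fact m) - ?s m / of_nat (fact m)) / h ^ card \<alpha>)"
      by (intro summable_divide summable_diff summable_phi_powL[OF A \<alpha> kg(2) J] lower)
    have eq: "(phi \<alpha> k (?P m) (?d', i) (?d, j) / of_nat (fact m) - ?s m / of_nat (fact m)) / h ^ card \<alpha> = ?P m \<alpha> k x i j / of_nat (fact m)" for m
      unfolding phi_split[OF powL_Lset[OF A] \<alpha> k x] diff_divide_distrib[symmetric] using h_nonzero by simp
    show ?case using s unfolding eq .
  qed
qed

definition expsum :: "opL \<Rightarrow> opL" where
  "expsum A = (\<lambda>\<alpha> k x i j. \<Sum>m. powL N M p A m \<alpha> k x i j / of_nat (fact m))"

text \<open>Literally the remainder that occurs in \<open>expL\<close>, named so that it can be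
  folded there and estimated as an element of the algebra.\<close>

definition exptail :: "opL \<Rightarrow> opL \<Rightarrow> nat \<Rightarrow> opL" where
  "exptail E A n = (\<lambda>\<alpha> k x i j. E \<alpha> k x i j - (\<Sum>m<n. powL N M p A m \<alpha> k x i j / of_nat (fact m)))"

lemma expsum_sums:
  "A \<in> Lset N M p \<Longrightarrow> (\<lambda>m. powL N M p A m \<alpha> k x i j / of_nat (fact m)) sums expsum A \<alpha> k x i j"
  unfolding expsum_def by (intro summable_sums summable_powL)

lemma expsum_Lset:
  assumes A: "A \<in> Lset N M p"
  shows "expsum A \<in> Lset N M p"
proof (rule LsetI)
  fix \<alpha> k x i j assume "\<not> (\<alpha> \<subseteq> {..<N} \<and> k \<in> cube {..<N} \<and> x \<in> cube \<alpha> \<and> i < M \<and> j < M)"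
  from Lset_outside[OF powL_Lset[OF A] this] show "expsum A \<alpha> k x i j = 0" by (simp add: expsum_def)
next
  fix \<alpha> k x k' x' i j
  assume a: "k \<in> cube {..<N}" "k' \<in> cube {..<N}" "x \<in> cube \<alpha>" "x' \<in> cube \<alpha>"
    "cl p {..<N} k = cl p {..<N} k'" "cl p \<alpha> x = cl p \<alpha> x'"
  show "expsum A \<alpha> k x i j = expsum A \<alpha> k' x' i j"
    unfolding expsum_def Lset_cell[OF powL_Lset[OF A] a] ..
qed

lemma exptail_Lset:
  assumes A: "A \<in> Lset N M p" and E: "E \<in> Lset N M p"
  shows "exptail E A n \<in> Lset N M p"
proof (rule LsetI)
  fix \<alpha> k x i j assume "\<not> (\<alpha> \<subseteq> {..<N} \<and> k \<in> cube {..<N} \<and> x \<in> cube \<alpha> \<and> i < M \<and> j < M)"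
  from Lset_outside[OF powL_Lset[OF A] this] Lset_outside[OF E this] show "exptail E A n \<alpha> k x i j = 0"
    by (simp add: exptail_def)
next
  fix \<alpha> k x k' x' i j
  assume a: "k \<in> cube {..<N}" "k' \<in> cube {..<N}" "x \<in> cube \<alpha>" "x' \<in> cube \<alpha>"
    "cl p {..<N} k = cl p {..<N} k'" "cl p \<alpha> x = cl p \<alpha> x'"
  show "exptail E A n \<alpha> k x i j = exptail E A n \<alpha> k' x' i j"
    unfolding exptail_def Lset_cell[OF powL_Lset[OF A] a] Lset_cell[OF E a] ..
qed

lemma exptail_expsum:
  assumes A: "A \<in> Lset N M p"
  shows "(\<lambda>n. normL N M (exptail (expsum A) A n)) \<longlonglongrightarrow> 0"
proof (rule tendsto_sandwich)
  let ?b = "\<lambda>n. \<Sum>\<alpha>\<in>Pow {..<N}. \<Sum>c\<in>cells p {..<N}. \<Sum>d\<in>cells p \<alpha>. \<Sum>i<M. \<Sum>j<M. cmod (exptail (expsum A) A n \<alpha> (cellpt p c) (cellpt p d) i j)"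
  note L = exptail_Lset[OF A expsum_Lset[OF A]]
  show "eventually (\<lambda>n. 0 \<le> normL N M (exptail (expsum A) A n)) sequentially"
    using normL_nonneg[OF L] by simp
  show "eventually (\<lambda>n. normL N M (exptail (expsum A) A n) \<le> ?b n) sequentially"
    using normL_le[OF L] by simp
  have "(\<lambda>n. exptail (expsum A) A n \<alpha> k x i j) \<longlonglongrightarrow> 0" for \<alpha> k x i j
  proof -
    have "(\<lambda>n. expsum A \<alpha> k x i j - (\<Sum>m<n. powL N M p A m \<alpha> k x i j / of_nat (fact m))) \<longlonglongrightarrow> expsum A \<alpha> k x i j - expsum A \<alpha> k x i j"
      using expsum_sums[OF A] unfolding sums_def by (intro tendsto_diff tendsto_const)
    then show ?thesis by (simp add: exptail_def)
  qed
  then have "?b \<longlonglongrightarrow> (\<Sum>\<alpha>\<in>Pow {..<N}. \<Sum>c\<in>cells p {..<N}. \<Sum>d\<in>cells p \<alpha>. \<Sum>i<M. \<Sum>j<M. 0)"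
    by (intro tendsto_sum tendsto_norm_zero)
  then show "?b \<longlonglongrightarrow> 0" by simp
qed simp

text \<open>Any candidate differs from \<open>expsum A\<close> in each entry by at most the sum of
  two remainders in norm. This bound holds for every \<open>n\<close> and tends to 0, so the
  candidate equals \<open>expsum A\<close>.\<close>

lemma expL_eq:
  assumes A: "A \<in> Lset N M p"
  shows "expL N M p A = expsum A"
  unfolding expL_def exptail_def[symmetric]
proof (rule the_equality)
  show "expsum A \<in> Lset N M p \<and> (\<lambda>n. normL N M (exptail (expsum A) A n)) \<longlonglongrightarrow> 0"
    using expsum_Lset[OF A] exptail_expsum[OF A] by simp
  fix E assume E: "E \<in> Lset N M p \<and> (\<lambda>n. normL N M (exptail E A n)) \<longlonglongrightarrow> 0"
  show "E = expsum A"
  proof (intro ext)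
    fix \<alpha> k x i j
    have "cmod (E \<alpha> k x i j - expsum A \<alpha> k x i j) \<le> normL N M (exptail E A n) + normL N M (exptail (expsum A) A n)" for n
    proof -
      have eq: "E \<alpha> k x i j - expsum A \<alpha> k x i j = exptail E A n \<alpha> k x i j - exptail (expsum A) A n \<alpha> k x i j"
        by (simp add: exptail_def)
      have "cmod (E \<alpha> k x i j - expsum A \<alpha> k x i j) \<le> cmod (exptail E A n \<alpha> k x i j) + cmod (exptail (expsum A) A n \<alpha> k x i j)"
        unfolding eq by (rule norm_triangle_ineq4)
      also have "\<dots> \<le> normL N M (exptail E A n) + normL N M (exptail (expsum A) A n)"
        by (rule add_mono[OF entry_le_normL[OF exptail_Lset[OF A conjunct1[OF E]]] entry_le_normL[OF exptail_Lset[OF A expsum_Lset[OF A]]]])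
      finally show ?thesis .
    qed
    moreover have "(\<lambda>n. normL N M (exptail E A n) + normL N M (exptail (expsum A) A n)) \<longlonglongrightarrow> 0 + 0"
      by (rule tendsto_add[OF conjunct2[OF E] exptail_expsum[OF A]])
    ultimately have "cmod (E \<alpha> k x i j - expsum A \<alpha> k x i j) \<le> 0"
      using LIMSEQ_le_const[of "\<lambda>n. normL N M (exptail E A n) + normL N M (exptail (expsum A) A n)" "0 + 0"] by force
    then show "E \<alpha> k x i j = expsum A \<alpha> k x i j" by simp
  qed
qed

lemma phi_expsum:
  assumes A: "A \<in> Lset N M p"
  shows "(\<lambda>m. phi \<gamma> k (powL N M p A m) a b / of_nat (fact m)) sums phi \<gamma> k (expsum A) a b"
proof -
  obtain d' i d j where [simp]: "a = (d', i)" "b = (d, j)" by (cases a, cases b)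
  let ?c = "\<lambda>\<beta>. if \<forall>l\<in>\<gamma> - \<beta>. d' l = d l then h ^ card \<beta> else 0"
  have e: "phi \<gamma> k C a b = (\<Sum>\<beta>\<in>Pow \<gamma>. ?c \<beta> * C \<beta> (merge k (cellpt p d') \<gamma>) (cellpt p d) i j)" for C
    unfolding phi_def by (auto intro!: sum.cong)
  have "(\<lambda>m. \<Sum>\<beta>\<in>Pow \<gamma>. ?c \<beta> * (powL N M p A m \<beta> (merge k (cellpt p d') \<gamma>) (cellpt p d) i j / of_nat (fact m)))
     sums (\<Sum>\<beta>\<in>Pow \<gamma>. ?c \<beta> * expsum A \<beta> (merge k (cellpt p d') \<gamma>) (cellpt p d) i j)"
    by (intro sums_sum sums_mult expsum_sums[OF A])
  then show ?thesis unfolding e sum_divide_distrib by simp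
qed

lemma det_phi_expsum:
  assumes A: "A \<in> Lset N M p" and \<gamma>: "\<gamma> \<subseteq> {..<N}" and k: "k \<in> cube ({..<N} - \<gamma>)"
  shows "det (Phi \<gamma> k (expsum A)) = exp (\<Sum>a\<in>J \<gamma>. phi \<gamma> k A a a)"
proof -
  have "det (Phi \<gamma> k (expsum A)) = exp (\<Sum>i<nJ \<gamma>. Phi \<gamma> k A $$ (i, i))"
  proof (rule det_exp[OF Phi_carrier Phi_carrier])
    fix i j assume ij: "i < nJ \<gamma>" "j < nJ \<gamma>"
    show "(\<lambda>m. (Phi \<gamma> k A ^\<^sub>m m) $$ (i, j) / of_nat (fact m)) sums Phi \<gamma> k (expsum A) $$ (i, j)"
      using phi_expsum[OF A, of \<gamma> k "eJ \<gamma> i" "eJ \<gamma> j"] ij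
      unfolding Phi_powL[OF A \<gamma> k, symmetric] by (simp add: Phi_def)
  qed
  also have "(\<Sum>i<nJ \<gamma>. Phi \<gamma> k A $$ (i, i)) = (\<Sum>i\<in>{0..<nJ \<gamma>}. phi \<gamma> k A (eJ \<gamma> i) (eJ \<gamma> i))"
    by (rule sum.cong) (auto simp: Phi_def)
  also have "\<dots> = (\<Sum>a\<in>J \<gamma>. phi \<gamma> k A a a)"
    by (rule sum.reindex_bij_betw[OF eJ_bij[OF \<gamma>]])
  finally show ?thesis .
qed

text \<open>The block determinant of the exponential is the exponential of the block trace, and
  \<open>exp\<close> turns the sum in \<open>trace_phi\<close> into the product required by
  \<open>piL_determined\<close>. Since \<open>exp\<close> has no zeros, the exponential is
  regular.\<close>

lemma piL_expL:
  assumes ord: "set ord = Pow {..<N}" "distinct ord"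
    and A: "A \<in> Lset N M p" and \<gamma>: "\<gamma> \<subseteq> {..<N}" and k: "k \<in> cube ({..<N} - \<gamma>)"
  shows "piL N M p ord (expL N M p A) \<gamma> k = exp (tau M A \<gamma> k)"
proof -
  have R: "regular (expsum A)"
    unfolding regular_def using expsum_Lset[OF A] det_phi_expsum[OF A] by simp
  show ?thesis
    unfolding expL_eq[OF A]
  proof (rule piL_determined[OF ord R _ \<gamma> k])
    fix \<gamma> k assume a: "\<gamma> \<subseteq> {..<N}" "k \<in> cube ({..<N} - \<gamma>)"
    have fin: "finite (cells p (\<gamma> - \<alpha>))" for \<alpha> using finite_subN[OF a(1)] by (intro finite_cells) auto
    show "det_on (J \<gamma>) (phi \<gamma> k (expsum A)) =
      (\<Prod>\<alpha>\<in>Pow \<gamma>. \<Prod>d\<in>cells p (\<gamma> - \<alpha>). exp (tau M A \<alpha> (merge k (cellpt p d) (\<gamma> - \<alpha>))))"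
      unfolding det_Phi[OF a(1), symmetric] det_phi_expsum[OF A a] trace_phi[OF A a]
      using finite_subN[OF a(1)] fin by (simp add: exp_sum)
  qed
qed

section \<open>Continuity of the determinant and the trace\<close>

lemma tendsto_det_on:
  assumes "\<And>a b. a \<in> S \<Longrightarrow> b \<in> S \<Longrightarrow> ((\<lambda>t. X t a b) \<longlongrightarrow> Y a b) F"
  shows "((\<lambda>t. det_on S (X t)) \<longlongrightarrow> det_on S Y) F"
  unfolding det_on_def
  by (intro tendsto_sum tendsto_mult tendsto_const tendsto_prod assms) (auto simp: permutes_in_image)

text \<open>Invertible elements that approach \<open>A\<close> in norm, packaged as a filter so that
  continuity follows from limit rules; \<open>eventually_nearbyD\<close> translates back to
  \<epsilon> and \<delta>.\<close>

definition nearby :: "opL \<Rightarrow> opL filter" where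
  "nearby A = inf (filtercomap (\<lambda>B. normL N M (linL 1 A (-1) B)) (nhds 0)) (principal (InvL N M p))"

lemma InvL_Lset: "A \<in> InvL N M p \<Longrightarrow> A \<in> Lset N M p"
  by (simp add: InvL_def)

lemma eventually_nearby_InvL: "eventually (\<lambda>B. B \<in> InvL N M p) (nearby A)"
  unfolding nearby_def eventually_inf_principal by simp

lemma eventually_nearbyD:
  assumes A: "A \<in> InvL N M p" and "eventually P (nearby A)"
  shows "\<exists>\<delta>>0. \<forall>B\<in>InvL N M p. normL N M (linL 1 A (-1) B) < \<delta> \<longrightarrow> P B"
proof -
  have "eventually (\<lambda>B. B \<in> InvL N M p \<longrightarrow> P B) (filtercomap (\<lambda>B. normL N M (linL 1 A (-1) B)) (nhds 0))"
    using assms(2) unfolding nearby_def eventually_inf_principal .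
  then obtain Q where Q: "eventually Q (nhds (0::real))"
    and QP: "\<And>B. Q (normL N M (linL 1 A (-1) B)) \<Longrightarrow> B \<in> InvL N M p \<longrightarrow> P B"
    unfolding eventually_filtercomap by blast
  obtain \<delta> where \<delta>: "\<delta> > 0" "\<And>t. dist t 0 < \<delta> \<Longrightarrow> Q t" using Q unfolding eventually_nhds_metric by blast
  have "P B" if B: "B \<in> InvL N M p" and n: "normL N M (linL 1 A (-1) B) < \<delta>" for B
  proof -
    have "0 \<le> normL N M (linL 1 A (-1) B)" by (intro normL_nonneg linL_Lset InvL_Lset A B)
    then show ?thesis using QP \<delta>(2) n B by simp
  qed
  then show ?thesis using \<delta>(1) by blast
qed

lemma nearby_entry:
  assumes A: "A \<in> InvL N M p"
  shows "((\<lambda>B. B \<alpha> k x i j) \<longlongrightarrow> A \<alpha> k x i j) (nearby A)"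
proof (rule metric_tendsto_imp_tendsto)
  show "((\<lambda>B. normL N M (linL 1 A (-1) B)) \<longlongrightarrow> 0) (nearby A)"
    unfolding nearby_def by (rule tendsto_mono[OF inf_le1 filterlim_filtercomap])
  show "eventually (\<lambda>B. dist (B \<alpha> k x i j) (A \<alpha> k x i j) \<le> dist (normL N M (linL 1 A (-1) B)) 0) (nearby A)"
    using eventually_nearby_InvL
  proof eventually_elim
    case (elim B)
    have L: "linL 1 A (-1) B \<in> Lset N M p" by (intro linL_Lset InvL_Lset A elim)
    have "dist (B \<alpha> k x i j) (A \<alpha> k x i j) = cmod (linL 1 A (-1) B \<alpha> k x i j)"
      by (simp add: dist_norm linL_def norm_minus_commute)
    then show ?case using entry_le_normL[OF L, of \<alpha> k x i j] normL_nonneg[OF L] by simp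
  qed
qed

lemma nearby_phi:
  assumes A: "A \<in> InvL N M p"
  shows "((\<lambda>B. phi \<gamma> k B a b) \<longlongrightarrow> phi \<gamma> k A a b) (nearby A)"
proof -
  obtain d' i d j where [simp]: "a = (d', i)" "b = (d, j)" by (cases a, cases b)
  let ?c = "\<lambda>\<beta>. if \<forall>l\<in>\<gamma> - \<beta>. d' l = d l then h ^ card \<beta> else 0"
  have e: "phi \<gamma> k C a b = (\<Sum>\<beta>\<in>Pow \<gamma>. ?c \<beta> * C \<beta> (merge k (cellpt p d') \<gamma>) (cellpt p d) i j)" for C
    unfolding phi_def by (auto intro!: sum.cong)
  show ?thesis unfolding e by (intro tendsto_sum tendsto_mult tendsto_const nearby_entry[OF A])
qed

text \<open>The recursion expresses \<open>piL\<close> at \<gamma> as a quotient. The numerator is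
  polynomial in the coefficients, the denominator converges by induction, and its limit is nonzero
  because \<open>A\<close> is invertible.\<close>

lemma nearby_piL:
  assumes ord: "set ord = Pow {..<N}" "distinct ord" and A: "A \<in> InvL N M p"
  shows "\<gamma> \<subseteq> {..<N} \<Longrightarrow> k \<in> cube ({..<N} - \<gamma>) \<Longrightarrow>
    ((\<lambda>B. piL N M p ord B \<gamma> k) \<longlongrightarrow> piL N M p ord A \<gamma> k) (nearby A)"
proof (induction "card \<gamma>" arbitrary: \<gamma> k rule: less_induct)
  case less
  note \<gamma> = less.prems(1) and k = less.prems(2)
  note rec = piL_recursion[OF ord InvL_regular \<gamma> k]
  have "((\<lambda>B. below ord B \<gamma> k) \<longlongrightarrow> below ord A \<gamma> k) (nearby A)"
  proof (intro tendsto_prod)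
    fix \<alpha> d assume a: "\<alpha> \<in> Pow \<gamma> - {\<gamma>}" and d: "d \<in> cells p (\<gamma> - \<alpha>)"
    then have "card \<alpha> < card \<gamma>" using finite_subN[OF \<gamma>] by (intro psubset_card_mono) auto
    then show "((\<lambda>B. piL N M p ord B \<alpha> (merge k (cellpt p d) (\<gamma> - \<alpha>))) \<longlongrightarrow> piL N M p ord A \<alpha> (merge k (cellpt p d) (\<gamma> - \<alpha>))) (nearby A)"
      using a \<gamma> by (intro less.hyps merge_cell_cube[OF \<gamma> _ k d]) auto
  qed
  then have "((\<lambda>B. det_on (J \<gamma>) (phi \<gamma> k B) / below ord B \<gamma> k) \<longlongrightarrow> det_on (J \<gamma>) (phi \<gamma> k A) / below ord A \<gamma> k) (nearby A)"
    by (intro tendsto_divide tendsto_det_on nearby_phi[OF A] rec(2)[OF A])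
  moreover have "det_on (J \<gamma>) (phi \<gamma> k B) / below ord B \<gamma> k = piL N M p ord B \<gamma> k" if B: "B \<in> InvL N M p" for B
    unfolding rec(1)[OF B] using rec(2)[OF B] by (rule nonzero_mult_div_cancel_left)
  ultimately show ?case
    using A eventually_nearby_InvL[of A] by (auto elim!: Lim_transform_eventually eventually_mono)
qed

lemma distC_le:
  assumes "\<And>\<alpha> k. \<alpha> \<subseteq> {..<N} \<Longrightarrow> k \<in> cube ({..<N} - \<alpha>) \<Longrightarrow> cmod (f \<alpha> k - g \<alpha> k) \<le> e"
  shows "distC N f g \<le> e"
  unfolding distC_def
proof (rule cSup_least)
  have "cmod (f {} (\<lambda>_. 0) - g {} (\<lambda>_. 0)) \<in> {cmod (f \<alpha> k - g \<alpha> k) |\<alpha> k. \<alpha> \<subseteq> {..<N} \<and> k \<in> cube ({..<N} - \<alpha>)}"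
    using zero_in_cube by blast
  then show "{cmod (f \<alpha> k - g \<alpha> k) |\<alpha> k. \<alpha> \<subseteq> {..<N} \<and> k \<in> cube ({..<N} - \<alpha>)} \<noteq> {}" by blast
qed (use assms in blast)

lemma piL_continuous:
  assumes ord: "set ord = Pow {..<N}" "distinct ord" and A: "A \<in> InvL N M p" and e: "0 < e"
  shows "\<exists>\<delta>>0. \<forall>B\<in>InvL N M p. normL N M (linL 1 A (-1) B) < \<delta> \<longrightarrow> distC N (piL N M p ord A) (piL N M p ord B) < e"
proof (rule eventually_nearbyD[OF A])
  \<comment> \<open>Finitely many corners decide, so the pointwise limits are uniform. The margin
    \<open>e / 2\<close> absorbs the passage to the supremum, which yields only a weak
    inequality.\<close>
  have "eventually (\<lambda>B. \<forall>\<alpha>\<in>Pow {..<N}. \<forall>c\<in>cells p ({..<N} - \<alpha>).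
     dist (piL N M p ord B \<alpha> (cellpt p c)) (piL N M p ord A \<alpha> (cellpt p c)) < e / 2) (nearby A)"
  proof (intro eventually_ball_finite ballI)
    fix \<alpha> c assume "\<alpha> \<in> Pow {..<N}" "c \<in> cells p ({..<N} - \<alpha>)"
    then have "((\<lambda>B. piL N M p ord B \<alpha> (cellpt p c)) \<longlongrightarrow> piL N M p ord A \<alpha> (cellpt p c)) (nearby A)"
      by (intro nearby_piL[OF ord A] cellpt_in_cube[OF p_pos]) auto
    then show "eventually (\<lambda>B. dist (piL N M p ord B \<alpha> (cellpt p c)) (piL N M p ord A \<alpha> (cellpt p c)) < e / 2) (nearby A)"
      using e by (intro tendstoD) auto
  qed (auto intro: finite_cells)
  then show "eventually (\<lambda>B. distC N (piL N M p ord A) (piL N M p ord B) < e) (nearby A)"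
    using eventually_nearby_InvL
  proof eventually_elim
    case (elim B)
    have "distC N (piL N M p ord A) (piL N M p ord B) \<le> e / 2"
    proof (rule distC_le)
      fix \<alpha> k assume \<alpha>: "\<alpha> \<subseteq> {..<N}" and k: "k \<in> cube ({..<N} - \<alpha>)"
      let ?c = "cl p ({..<N} - \<alpha>) k"
      have c: "?c \<in> cells p ({..<N} - \<alpha>)" using k by (rule cl_in_cells[OF p_pos])
      have pc: "piL N M p ord C \<alpha> k = piL N M p ord C \<alpha> (cellpt p ?c)" if "C \<in> InvL N M p" for C
        by (rule piL_cell_cong[OF ord InvL_regular[OF that] \<alpha> k cellpt_in_cube[OF p_pos c]])
           (simp add: cl_cellpt[OF p_pos] cres_cl)
      have "dist (piL N M p ord B \<alpha> (cellpt p ?c)) (piL N M p ord A \<alpha> (cellpt p ?c)) < e / 2"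
        using elim(1) \<alpha> c by blast
      then show "cmod (piL N M p ord A \<alpha> k - piL N M p ord B \<alpha> k) \<le> e / 2"
        unfolding pc[OF A] pc[OF elim(2)] by (simp add: dist_norm norm_minus_commute)
    qed
    then show ?case using e by simp
  qed
qed

lemma tau_continuous:
  assumes A: "A \<in> Lset N M p" and e: "0 < e"
  shows "\<exists>\<delta>>0. \<forall>B\<in>Lset N M p. normL N M (linL 1 A (-1) B) < \<delta> \<longrightarrow> distC N (tau M A) (tau M B) < e"
\<comment> \<open>The trace is Lipschitz with constant \<open>M\<close>.\<close>
proof (intro exI[of _ "e / real M"] conjI ballI impI)
  show "0 < e / real M" using e M_pos by simp
  fix B assume B: "B \<in> Lset N M p" and n: "normL N M (linL 1 A (-1) B) < e / real M"
  have "distC N (tau M A) (tau M B) \<le> real M * normL N M (linL 1 A (-1) B)"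
  proof (rule distC_le)
    fix \<alpha> k assume a: "\<alpha> \<subseteq> {..<N}" "k \<in> cube ({..<N} - \<alpha>)"
    show "cmod (tau M A \<alpha> k - tau M B \<alpha> k) \<le> real M * normL N M (linL 1 A (-1) B)"
      using tau_le_normL[OF linL_Lset[OF A B] a, of 1 "-1"] tau_linL[OF A B a, of 1 "-1"] by simp
  qed
  also have "\<dots> < e" using n M_pos by (simp add: field_simps)
  finally show "distC N (tau M A) (tau M B) < e" .
qed

section \<open>The operator norm of the trace\<close>

lemma normL_id: "normL N M (idL N M) = 1"
proof -
  have row: "(\<Sum>j<M. cmod (idL N M \<alpha> k x i j)) = (if \<alpha> = {} then 1 else 0)" if "k \<in> cube {..<N}" "i < M" for \<alpha> k x i
  proof (cases "\<alpha> = {}")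
    case True
    then have "(\<Sum>j<M. cmod (idL N M \<alpha> k x i j)) = (\<Sum>j<M. if i = j then 1 else 0)"
      using that by (intro sum.cong refl) (simp add: idL_def)
    then show ?thesis using that True by simp
  next
    case False
    then show ?thesis by (simp add: idL_def)
  qed
  have "rowset (idL N M) \<alpha> = {if \<alpha> = {} then 1 else 0}" for \<alpha>
  proof
    show "rowset (idL N M) \<alpha> \<subseteq> {if \<alpha> = {} then 1 else 0}" using row by blast
    show "{if \<alpha> = {} then 1 else 0} \<subseteq> rowset (idL N M) \<alpha>"
    proof
      fix r assume "r \<in> {if \<alpha> = {} then 1 else 0 :: real}"
      then have "r = (\<Sum>j<M. cmod (idL N M \<alpha> (\<lambda>_. 0) (\<lambda>_. 0) 0 j))"
        using row[OF zero_in_cube M_pos, of \<alpha> "\<lambda>_. 0"] by simp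
      then show "r \<in> rowset (idL N M) \<alpha>" using zero_in_cube M_pos by blast
    qed
  qed
  then show ?thesis by (simp add: normL_def)
qed

lemma normC_tau_le:
  assumes A: "A \<in> Lset N M p" shows "normC N (tau M A) \<le> real M * normL N M A"
proof -
  have "normC N (tau M A) = distC N (tau M A) (\<lambda>_ _. 0)" by (simp add: normC_def distC_def)
  also have "\<dots> \<le> real M * normL N M A" using tau_le_normL[OF A] by (intro distC_le) simp
  finally show ?thesis .
qed

lemma normC_tau_id: "normC N (tau M (idL N M)) = real M"
proof (rule antisym)
  show "normC N (tau M (idL N M)) \<le> real M" using normC_tau_le[OF idL_Lset] by (simp add: normL_id)
  let ?S = "{cmod (tau M (idL N M) \<alpha> k) |\<alpha> k. \<alpha> \<subseteq> {..<N} \<and> k \<in> cube ({..<N} - \<alpha>)}"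
  have "tau M (idL N M) {} (\<lambda>_. 0) = of_nat M"
    using tau_eq[OF idL_Lset, of "{}" "\<lambda>_. 0"] zero_in_cube by (simp add: idL_def)
  then have "cmod (tau M (idL N M) {} (\<lambda>_. 0)) = real M" by simp
  moreover have "cmod (tau M (idL N M) {} (\<lambda>_. 0)) \<in> ?S" using zero_in_cube by blast
  ultimately have "real M \<in> ?S" by simp
  moreover have "bdd_above ?S"
    using tau_le_normL[OF idL_Lset] by (intro bdd_aboveI[of _ "real M"]) (auto simp: normL_id)
  ultimately show "real M \<le> normC N (tau M (idL N M))" unfolding normC_def by (rule cSup_upper)
qed

text \<open>The supremum is attained at the identity, which has norm 1 and whose trace at {} is the
  constant \<open>M\<close>; the upper bound adds up \<open>M\<close> diagonal entries, each at most
  the norm.\<close>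

lemma tau_operator_norm:
  "Sup {normC N (tau M A) / normL N M A | A. A \<in> Lset N M p \<and> normL N M A \<noteq> 0} = real M"
proof (rule cSup_eq_maximum)
  show "real M \<in> {normC N (tau M A) / normL N M A | A. A \<in> Lset N M p \<and> normL N M A \<noteq> 0}"
    by (intro CollectI exI[of _ "idL N M"]) (simp add: normL_id normC_tau_id idL_Lset)
  fix r assume "r \<in> {normC N (tau M A) / normL N M A | A. A \<in> Lset N M p \<and> normL N M A \<noteq> 0}"
  then obtain A where A: "A \<in> Lset N M p" "normL N M A \<noteq> 0" and r: "r = normC N (tau M A) / normL N M A" by blast
  have "0 < normL N M A" using normL_nonneg[OF A(1)] A(2) by simp
  then show "r \<le> real M" unfolding r using normC_tau_le[OF A(1)] by (simp add: divide_le_eq)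
qed

end

theorem theorem2:
  fixes N M p :: nat and ord :: "nat set list"
  assumes "0 < N" and "0 < M" and "0 < p" and "valid_order N ord"
  shows
   "(\<forall>c d A B. A \<in> Lset N M p \<longrightarrow> B \<in> Lset N M p \<longrightarrow>
        ceq N (tau M (linL c A d B)) (\<lambda>\<alpha> k. c * tau M A \<alpha> k + d * tau M B \<alpha> k))
  \<and> (\<forall>A\<in>Lset N M p. \<forall>B\<in>Lset N M p.
        ceq N (tau M (mulL N M p A B)) (tau M (mulL N M p B A)))
  \<and> (\<forall>C\<in>InvL N M p. \<forall>D\<in>InvL N M p.
        ceq N (piL N M p ord (mulL N M p C D)) (\<lambda>\<alpha> k. piL N M p ord C \<alpha> k * piL N M p ord D \<alpha> k))
  \<and> (\<forall>A\<in>Lset N M p. \<forall>e>0. \<exists>\<delta>>0. \<forall>B\<in>Lset N M p.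
        normL N M (linL 1 A (-1) B) < \<delta> \<longrightarrow> distC N (tau M A) (tau M B) < e)
  \<and> (\<forall>A\<in>InvL N M p. \<forall>e>0. \<exists>\<delta>>0. \<forall>B\<in>InvL N M p.
        normL N M (linL 1 A (-1) B) < \<delta> \<longrightarrow> distC N (piL N M p ord A) (piL N M p ord B) < e)
  \<and> (\<forall>A\<in>Lset N M p. ceq N (piL N M p ord (expL N M p A)) (\<lambda>\<alpha> k. exp (tau M A \<alpha> k)))
  \<and> Sup {normC N (tau M A) / normL N M A | A. A \<in> Lset N M p \<and> normL N M A \<noteq> 0} = real M"
proof -
  interpret staircase_algebra N M p using assms by unfold_locales
  have ord: "set ord = Pow {..<N}" "distinct ord" using assms(4) by (simp_all add: valid_order_def)
  show ?thesis
    unfolding ceq_def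
    by (intro conjI allI ballI impI tau_linL tau_mulL_commute piL_mulL[OF ord] InvL_regular tau_continuous
        piL_continuous[OF ord] piL_expL[OF ord] tau_operator_norm)
qed

end
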